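(* Let $G$ be a finite group satisfying condition (C). Then $G$ contains a Carter subgroup if and only if $G$ satisfies condition (E).
   Context: A Carter subgroup of a group is a nilpotent subgroup that coincides with its own normalizer. Induced automorphisms. If $A,B,H$ are subgroups of a group $G$ with $B\unlhd A$, put $N_H(A/B)=N_H(A)\cap N_H(B)$. Each $x\in N_H(A/B)$ induces an automorphism $Ba\mapsto Bx^{-1}ax$ of $A/B$. This gives a homomorphism $N_H(A/B)\to \mathrm{Aut}(A/B)$, whose image is denoted $\mathrm{Aut}_H(A/B)$ and whose kernel is denoted $C_H(A/B)$. In particular, if $S=A/B$ is a composition factor of $G$ (regarded as a section of $G$), then $\mathrm{Aut}_H(S)$ is defined for every $H\le G$. Condition (C). A finite group $G$ satisfies (C) if for every nonabelian composition factor $S$ of $G$ and every nilpotent subgroup $N$ of $G$, the Carter subgroups (if any exist) of $\langle \mathrm{Aut}_N(S), S\rangle$ are conjugate in that group; here $S$ is identified with $\mathrm{Inn}(S)\le\mathrm{Aut}(S)$. Condition (E). Let $G$ be a finite group satisfying (C) and let $G=G_0\ge G_1\ge\dots\ge G_n=\{e\}$ be a chief series of $G$. For each $i=0,\dots,n-1$ write $G_i/G_{i+1}=T_{i,1}\times\dots\times T_{i,k_i}$, where $T_{i,1}\simeq\dots\simeq T_{i,k_i}\simeq T_i$ and $T_i$ is a simple group (possibly cyclic of prime order). For $i\ge 1$ let $\overline{K}_i$ denote a Carter subgroup of $G/G_i$ (if one exists), and let $K_i$ denote its complete preimage in $G/G_{i+1}$. For $i=0$ put $\overline{K}_0=\{e\}$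 and $K_0=G/G_1$. The group $G$ satisfies (E) if for every $i\in\{0,\dots,n-1\}$ and $j\in\{1,\dots,k_i\}$, either $\overline{K}_i$ does not exist, or $\mathrm{Aut}_{K_i}(T_{i,j})$ contains a Carter subgroup. Here $T_{i,j}$ is viewed as a subgroup of $G/G_{i+1}$, so that $\mathrm{Aut}_{K_i}(T_{i,j})=N_{K_i}(T_{i,j})/C_{K_i}(T_{i,j})$. *)

theory Defs
  imports "HOL-Algebra.Algebra"
begin

section \<open>Nilpotent groups and Carter subgroups\<close>

primrec lower_central :: "('a, 'b) monoid_scheme \<Rightarrow> nat \<Rightarrow> 'a set" where
  "lower_central G 0 = carrier G"
| "lower_central G (Suc n) =
     generate G {x \<otimes>\<^bsub>G\<^esub> y \<otimes>\<^bsub>G\<^esub> inv\<^bsub>G\<^esub> x \<otimes>\<^bsub>G\<^esub> inv\<^bsub>G\<^esub> y | x y.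
       x \<in> lower_central G n \<and> y \<in> carrier G}"

definition nilpotent_group :: "('a, 'b) monoid_scheme \<Rightarrow> bool" where
  "nilpotent_group G \<longleftrightarrow> group G \<and> (\<exists>n. lower_central G n = {\<one>\<^bsub>G\<^esub>})"

definition nilpotent_subgroup :: "'a set \<Rightarrow> ('a, 'b) monoid_scheme \<Rightarrow> bool" where
  "nilpotent_subgroup H G \<longleftrightarrow> subgroup H G \<and> nilpotent_group (G\<lparr>carrier := H\<rparr>)"

definition carter_subgroup :: "'a set \<Rightarrow> ('a, 'b) monoid_scheme \<Rightarrow> bool" where
  "carter_subgroup H G \<longleftrightarrow> nilpotent_subgroup H G \<and> normalizer G H = H"

definition carter_conjugate :: "('a, 'b) monoid_scheme \<Rightarrow> bool" where
  "carter_conjugate G \<longleftrightarrow>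
     (\<forall>H K. carter_subgroup H G \<and> carter_subgroup K G \<longrightarrow>
        (\<exists>g\<in>carrier G. K = g <#\<^bsub>G\<^esub> H #>\<^bsub>G\<^esub> inv\<^bsub>G\<^esub> g))"


section \<open>Sections and induced automorphisms\<close>

abbreviation section_group ::
  "('a, 'b) monoid_scheme \<Rightarrow> 'a set \<Rightarrow> 'a set \<Rightarrow> 'a set monoid" where
  "section_group G A B \<equiv> (G\<lparr>carrier := A\<rparr>) Mod B"

definition section_normalizer ::
  "('a, 'b) monoid_scheme \<Rightarrow> 'a set \<Rightarrow> 'a set \<Rightarrow> 'a set \<Rightarrow> 'a set" where
  "section_normalizer G H A B = H \<inter> normalizer G A \<inter> normalizer G B"

text \<open>For \<open>x\<close> normalizing \<open>B\<close>, the set \<open>x\<inverse> (B a) x\<close> is the coset \<open>B (x\<inverse> a x)\<close>;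
  see lemma \<open>induced_aut_coset\<close>.\<close>

definition induced_aut ::
  "('a, 'b) monoid_scheme \<Rightarrow> 'a set \<Rightarrow> 'a set \<Rightarrow> 'a \<Rightarrow> 'a set \<Rightarrow> 'a set" where
  "induced_aut G A B x =
     (\<lambda>Y \<in> carrier (section_group G A B). inv\<^bsub>G\<^esub> x <#\<^bsub>G\<^esub> Y #>\<^bsub>G\<^esub> x)"

text \<open>With composition of functions written on the left, \<open>x \<mapsto> induced_aut G A B x\<close>
  reverses products; its image is the same set for either convention.\<close>

definition induced_auts ::
  "('a, 'b) monoid_scheme \<Rightarrow> 'a set \<Rightarrow> 'a set \<Rightarrow> 'a set \<Rightarrow> ('a set \<Rightarrow> 'a set) set" where
  "induced_auts G H A B = induced_aut G A B ` section_normalizer G H A B"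

definition induced_aut_group ::
  "('a, 'b) monoid_scheme \<Rightarrow> 'a set \<Rightarrow> 'a set \<Rightarrow> 'a set \<Rightarrow> ('a set \<Rightarrow> 'a set) monoid" where
  "induced_aut_group G H A B =
     (AutoGroup (section_group G A B))\<lparr>carrier := induced_auts G H A B\<rparr>"

definition inner_auts :: "('a, 'b) monoid_scheme \<Rightarrow> ('a \<Rightarrow> 'a) set" where
  "inner_auts S = (\<lambda>g. \<lambda>x \<in> carrier S. inv\<^bsub>S\<^esub> g \<otimes>\<^bsub>S\<^esub> x \<otimes>\<^bsub>S\<^esub> g) ` carrier S"


section \<open>Composition factors and condition (C)\<close>

definition composition_series ::
  "('a, 'b) monoid_scheme \<Rightarrow> nat \<Rightarrow> (nat \<Rightarrow> 'a set) \<Rightarrow> bool" where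
  "composition_series G m H \<longleftrightarrow>
     H 0 = carrier G \<and> H m = {\<one>\<^bsub>G\<^esub>} \<and>
     (\<forall>i\<le>m. subgroup (H i) G) \<and>
     (\<forall>i<m. H (Suc i) \<lhd> (G\<lparr>carrier := H i\<rparr>) \<and>
            simple_group (section_group G (H i) (H (Suc i))))"

definition composition_factor ::
  "('a, 'b) monoid_scheme \<Rightarrow> 'a set \<Rightarrow> 'a set \<Rightarrow> bool" where
  "composition_factor G A B \<longleftrightarrow>
     (\<exists>m H i. composition_series G m H \<and> i < m \<and> A = H i \<and> B = H (Suc i))"

definition condition_C :: "('a, 'b) monoid_scheme \<Rightarrow> bool" where
  "condition_C G \<longleftrightarrow>
     (\<forall>A B N. composition_factor G A B \<and> \<not> comm_group (section_group G A B) \<and>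
        nilpotent_subgroup N G \<longrightarrow>
        (let S = section_group G A B in
          carter_conjugate
            ((AutoGroup S)\<lparr>carrier :=
               generate (AutoGroup S) (induced_auts G N A B \<union> inner_auts S)\<rparr>)))"


section \<open>Chief series and condition (E)\<close>

definition chief_series ::
  "('a, 'b) monoid_scheme \<Rightarrow> nat \<Rightarrow> (nat \<Rightarrow> 'a set) \<Rightarrow> bool" where
  "chief_series G n H \<longleftrightarrow>
     H 0 = carrier G \<and> H n = {\<one>\<^bsub>G\<^esub>} \<and>
     (\<forall>i\<le>n. H i \<lhd> G) \<and>
     (\<forall>i<n. H (Suc i) \<subset> H i \<and>
        (\<forall>M. M \<lhd> G \<and> H (Suc i) \<subseteq> M \<and> M \<subseteq> H i \<longrightarrow> M = H (Suc i) \<or> M = H i))"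

definition internal_direct_product ::
  "('a, 'b) monoid_scheme \<Rightarrow> 'i set \<Rightarrow> ('i \<Rightarrow> 'a set) \<Rightarrow> bool" where
  "internal_direct_product P J T \<longleftrightarrow>
     (\<forall>j\<in>J. T j \<lhd> P) \<and>
     generate P (\<Union>j\<in>J. T j) = carrier P \<and>
     (\<forall>j\<in>J. T j \<inter> generate P (\<Union>l\<in>J - {j}. T l) = {\<one>\<^bsub>P\<^esub>})"

text \<open>\<open>T i 1, \<dots>, T i (k i)\<close> are subgroups of the chief factor \<open>H i / H (i + 1)\<close>,
  hence sets of cosets of \<open>H (i + 1)\<close>.\<close>

definition chief_decomposition ::
  "('a, 'b) monoid_scheme \<Rightarrow> nat \<Rightarrow> (nat \<Rightarrow> 'a set) \<Rightarrow>
     (nat \<Rightarrow> nat) \<Rightarrow> (nat \<Rightarrow> nat \<Rightarrow> 'a set set) \<Rightarrow> bool" where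
  "chief_decomposition G n H k T \<longleftrightarrow>
     (\<forall>i<n. let P = section_group G (H i) (H (Suc i)) in
        internal_direct_product P {1..k i} (T i) \<and>
        (\<forall>j\<in>{1..k i}. simple_group (P\<lparr>carrier := T i j\<rparr>)) \<and>
        (\<forall>j\<in>{1..k i}. \<forall>l\<in>{1..k i}. P\<lparr>carrier := T i j\<rparr> \<cong> P\<lparr>carrier := T i l\<rparr>))"

text \<open>\<open>Kbar i\<close> is unconstrained if \<open>G / H i\<close> has no Carter subgroup; condition (E) then
  ignores it.\<close>

definition carter_choice ::
  "('a, 'b) monoid_scheme \<Rightarrow> nat \<Rightarrow> (nat \<Rightarrow> 'a set) \<Rightarrow> (nat \<Rightarrow> 'a set set) \<Rightarrow> bool" where
  "carter_choice G n H Kbar \<longleftrightarrow>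
     Kbar 0 = {\<one>\<^bsub>G Mod H 0\<^esub>} \<and>
     (\<forall>i. 1 \<le> i \<and> i < n \<longrightarrow> (\<exists>K. carter_subgroup K (G Mod H i)) \<longrightarrow>
        carter_subgroup (Kbar i) (G Mod H i))"

text \<open>The complete preimage of \<open>K \<subseteq> G / M\<close> under the natural map \<open>G / N \<rightarrow> G / M\<close>,
  \<open>N x \<mapsto> M x\<close>, for \<open>N \<subseteq> M\<close>.\<close>

definition factor_preimage ::
  "('a, 'b) monoid_scheme \<Rightarrow> 'a set \<Rightarrow> 'a set \<Rightarrow> 'a set set \<Rightarrow> 'a set set" where
  "factor_preimage G M N K = {Y \<in> carrier (G Mod N). M <#>\<^bsub>G\<^esub> Y \<in> K}"

text \<open>The data entering condition (E) -- the chief series \<open>H\<close>, the decompositions \<open>T\<close> of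
  its factors and the choice \<open>Kbar\<close> -- are parameters. The group of automorphisms induced on
  the subgroup \<open>T i j\<close> of \<open>G / H (i + 1)\<close> is the one induced on the section
  \<open>T i j / {e}\<close>.\<close>

definition condition_E ::
  "('a, 'b) monoid_scheme \<Rightarrow> nat \<Rightarrow> (nat \<Rightarrow> 'a set) \<Rightarrow>
     (nat \<Rightarrow> nat) \<Rightarrow> (nat \<Rightarrow> nat \<Rightarrow> 'a set set) \<Rightarrow> (nat \<Rightarrow> 'a set set) \<Rightarrow> bool" where
  "condition_E G n H k T Kbar \<longleftrightarrow>
     (\<forall>i<n. \<forall>j\<in>{1..k i}.
        (1 \<le> i \<and> \<not> (\<exists>K. carter_subgroup K (G Mod H i))) \<or>
        (let Q = G Mod H (Suc i);
             K = factor_preimage G (H i) (H (Suc i)) (Kbar i)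
         in \<exists>L. carter_subgroup L (induced_aut_group Q K (T i j) {\<one>\<^bsub>Q\<^esub>})))"


section \<open>Sanity checks\<close>

lemma (in group) normalizer_iff:
  assumes "B \<subseteq> carrier G"
  shows "x \<in> normalizer G B \<longleftrightarrow> x \<in> carrier G \<and> x <# B #> inv x = B"
  using assms by (auto simp: normalizer_def stabilizer_def)

lemma (in group) induced_aut_coset:
  assumes A: "subgroup A G" and B: "B \<lhd> (G\<lparr>carrier := A\<rparr>)"
    and x: "x \<in> normalizer G B" and a: "a \<in> A"
  shows "induced_aut G A B x (B #> a) = B #> (inv x \<otimes> a \<otimes> x)"
proof -
  have BA: "B \<subseteq> A"
    using normal_imp_subgroup[OF B] subgroup.subset by force
  have Ac: "A \<subseteq> carrier G"
    using A subgroup.subset by blast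
  have Bc: "B \<subseteq> carrier G" and ac: "a \<in> carrier G"
    using BA Ac a by auto
  have xc: "x \<in> carrier G" and xB: "x <# B #> inv x = B"
    using x normalizer_iff[OF Bc] by auto
  have "inv x <# B = inv x <# (x <# (B #> inv x))"
    using xB xc Bc by (simp add: coset_assoc)
  also have "\<dots> = B #> inv x"
    using xc Bc by (simp add: lcos_m_assoc lcos_mult_one r_coset_subset_G)
  finally have *: "inv x <# B = B #> inv x" .
  have "B #> a \<in> carrier (section_group G A B)"
    using a by (auto simp: FactGroup_def RCOSETS_def r_coset_def)
  then have "induced_aut G A B x (B #> a) = inv x <# (B #> a) #> x"
    by (simp add: induced_aut_def)
  also have "\<dots> = (inv x <# B) #> a #> x"
    using xc ac Bc by (simp add: coset_assoc)
  also have "\<dots> = B #> (inv x \<otimes> a \<otimes> x)"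
    unfolding * using xc ac Bc by (simp add: coset_mult_assoc)
  finally show ?thesis .
qed

lemma (in group) factor_preimage_zero:
  assumes N: "N \<lhd> G"
  shows "factor_preimage G (carrier G) N {\<one>\<^bsub>G Mod carrier G\<^esub>} = carrier (G Mod N)"
proof -
  have "carrier G <#> (N #> x) = carrier G" if x: "x \<in> carrier G" for x
  proof
    have Nc: "N \<subseteq> carrier G"
      using normal_imp_subgroup[OF N] subgroup.subset by blast
    show "carrier G <#> (N #> x) \<subseteq> carrier G"
      using r_coset_subset_G[OF Nc x] by (auto simp: set_mult_def)
    show "carrier G \<subseteq> carrier G <#> (N #> x)"
    proof
      fix y assume y: "y \<in> carrier G"
      have "x \<in> N #> x"
        using rcos_self[OF x normal_imp_subgroup[OF N]] .
      moreover have "y = (y \<otimes> inv x) \<otimes> x" "y \<otimes> inv x \<in> carrier G"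
        using x y by (simp_all add: m_assoc)
      ultimately show "y \<in> carrier G <#> (N #> x)"
        unfolding set_mult_def by blast
    qed
  qed
  then show ?thesis
    by (auto simp: factor_preimage_def FactGroup_def RCOSETS_def)
qed

end

theory Submission
  imports Defs "HOL-Number_Theory.Cong"
begin

text \<open>
  Carter subgroups are lifted along one chief factor \<open>N\<close> of \<open>G\<close> at a time. Let \<open>N\<close> be a normal
  subgroup of the quotient \<open>Q\<close> and \<open>Y / N\<close> a Carter subgroup of \<open>Q / N\<close>. Then \<open>Y / N\<close> is nilpotent and
  the Carter subgroups of \<open>Q\<close> are, up to conjugacy, those of \<open>Y\<close>. If \<open>N\<close> is abelian, then \<open>Y\<close> is
  metanilpotent, and a metanilpotent group has exactly one conjugacy class of Carter subgroups.

  Let \<open>N = T\<^sub>1 \<times> \<dots> \<times> T\<^sub>k\<close> be nonabelian. If \<open>K\<close> is a Carter subgroup of \<open>Y\<close>, then \<open>Aut\<^sub>K(T\<^sub>j)\<close> is one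
  of \<open>Aut\<^sub>Y(T\<^sub>j)\<close>: let \<open>E\<close> consist of the elements of \<open>N\<close> inducing elements of \<open>Aut\<^sub>K(T\<^sub>j)\<close> for all
  \<open>j\<close>. An element of \<open>N\<close> normalizing \<open>Aut\<^sub>K(T\<^sub>j)\<close> spreads along the \<open>K\<close>-orbit of \<open>T\<^sub>j\<close> to an element
  that normalizes the metanilpotent group \<open>E K\<close>; as the Carter subgroups of \<open>E K\<close> are conjugate,
  it lies in \<open>E K\<close>. Conversely, let \<open>L\<^sub>j\<close> be a Carter subgroup of \<open>Aut\<^sub>Y(T\<^sub>j)\<close> for every \<open>j\<close>, and let
  \<open>V\<close> be the stabilizer in \<open>Y\<close> of the tuple of the \<open>L\<^sub>j\<close>. Then \<open>V\<close> is metanilpotent, \<open>V N = Y\<close>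
  because the \<open>L\<^sub>j\<close> are unique up to conjugacy, and a Carter subgroup of \<open>V\<close> is one of \<open>Y\<close>. Two
  Carter subgroups of \<open>Y\<close> can be conjugated so as to induce the same tuple; they then lie in the
  same group \<open>V\<close> and are conjugate there.

  Condition (C) speaks about nilpotent subgroups of \<open>G\<close>, whereas \<open>Y / N\<close> is a nilpotent section;
  by the Frattini argument for Sylow subgroups it is the image of a nilpotent subgroup.
\<close>

subsection \<open>Sections of a group\<close>

context group begin

text \<open>The induction along the chief series has to carry conjugacy together with existence.
  Condition (E) speaks of one chosen Carter subgroup of each quotient, so the choice must not
  matter; and that \<open>K N / N\<close> is a Carter subgroup of \<open>Q / N\<close> when
  \<open>K\<close> is one of \<open>Q\<close> is a Frattini argument that itself consumes conjugacy
  inside \<open>K N\<close>. Condition (C) gives conjugacy only for automorphism groups generated by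
  the inner automorphisms and those induced by a nilpotent subgroup, hence only over groups
  \<open>Y\<close> with \<open>Y / N\<close> nilpotent; everything else has to be squeezed into
  metanilpotent groups, where conjugacy is unconditional. The second obstacle is the passage between
  one factor \<open>T_j\<close> and all of \<open>N\<close>: as the product is direct, the action of
  an element of \<open>N\<close> can be prescribed independently on each factor, whereas an element
  of \<open>K\<close> permutes the factors and only its stabilizers act on a single one.
  \<open>Aut_K(T)\<close> is studied as \<open>N_K(T) C(T) / C(T)\<close>, with the centralizer
  taken in the whole group, so that for fixed \<open>T\<close> all these groups live in one ambient
  group over the same kernel.\<close>

definition cj :: "'a \<Rightarrow> 'a \<Rightarrow> 'a" where
  "cj x a = x \<otimes> a \<otimes> inv x"

abbreviation cjs :: "'a \<Rightarrow> 'a set \<Rightarrow> 'a set" where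
  "cjs x A \<equiv> cj x ` A"

definition commutator :: "'a \<Rightarrow> 'a \<Rightarrow> 'a" where
  "commutator a b = a \<otimes> b \<otimes> inv a \<otimes> inv b"

definition normal_in :: "'a set \<Rightarrow> 'a set \<Rightarrow> bool" where
  "normal_in M U \<longleftrightarrow> subgroup M G \<and> subgroup U G \<and> M \<subseteq> U \<and> (\<forall>x\<in>U. \<forall>m\<in>M. cj x m \<in> M)"

text \<open>A quotient \<open>U / M\<close> is described inside the ambient group: the preimages of the members of
  its upper central series, its nilpotency, and the preimages of its Carter subgroups. Inductions
  that pass to quotients then do not change the type of the group elements.\<close>

primrec upper_central :: "'a set \<Rightarrow> 'a set \<Rightarrow> nat \<Rightarrow> 'a set" where
  "upper_central U M 0 = M"
| "upper_central U M (Suc n) = {z \<in> U. \<forall>x\<in>U. commutator z x \<in> upper_central U M n}"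

definition nilpotent_mod :: "'a set \<Rightarrow> 'a set \<Rightarrow> bool" where
  "nilpotent_mod U M \<longleftrightarrow> (\<exists>n. U \<subseteq> upper_central U M n)"

definition carter_mod :: "'a set \<Rightarrow> 'a set \<Rightarrow> 'a set \<Rightarrow> bool" where
  "carter_mod U M K \<longleftrightarrow> subgroup K G \<and> M \<subseteq> K \<and> K \<subseteq> U \<and> nilpotent_mod K M \<and> (\<forall>x\<in>U. cjs x K = K \<longrightarrow> x \<in> K)"

lemma cancel_left [simp]:
  "x \<in> carrier G \<Longrightarrow> y \<in> carrier G \<Longrightarrow> inv x \<otimes> (x \<otimes> y) = y"
  "x \<in> carrier G \<Longrightarrow> y \<in> carrier G \<Longrightarrow> x \<otimes> (inv x \<otimes> y) = y"
  by (simp_all add: m_assoc[symmetric])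

lemmas word = m_assoc inv_mult_group cj_def commutator_def

lemma subgroupD: "subgroup A G \<Longrightarrow> a \<in> A \<Longrightarrow> a \<in> carrier G"
  using subgroup.mem_carrier by fast

lemma sub_m: "subgroup A G \<Longrightarrow> a \<in> A \<Longrightarrow> b \<in> A \<Longrightarrow> a \<otimes> b \<in> A"
  by (rule subgroup.m_closed)

lemma sub_i: "subgroup A G \<Longrightarrow> a \<in> A \<Longrightarrow> inv a \<in> A"
  by (rule subgroup.m_inv_closed)

lemma sub_1: "subgroup A G \<Longrightarrow> \<one> \<in> A"
  by (rule subgroup.one_closed)

lemma cj_closed [simp]: "x \<in> carrier G \<Longrightarrow> a \<in> carrier G \<Longrightarrow> cj x a \<in> carrier G"
  by (simp add: cj_def)

lemma commutator_closed [simp]: "x \<in> carrier G \<Longrightarrow> a \<in> carrier G \<Longrightarrow> commutator x a \<in> carrier G"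
  by (simp add: commutator_def)

lemma cj_mult: "x \<in> carrier G \<Longrightarrow> a \<in> carrier G \<Longrightarrow> b \<in> carrier G \<Longrightarrow> cj x (a \<otimes> b) = cj x a \<otimes> cj x b"
  by (simp add: word)

text \<open>Conjugating by \<open>x\<close> on the left makes this a left action. The induced
  automorphisms of the definitions have \<open>inv x\<close> on the left; both conventions yield the
  same sets, because the groups involved are closed under inverses.\<close>

lemma cj_cj: "x \<in> carrier G \<Longrightarrow> y \<in> carrier G \<Longrightarrow> a \<in> carrier G \<Longrightarrow> cj x (cj y a) = cj (x \<otimes> y) a"
  by (simp add: word)

lemma cj_one [simp]: "a \<in> carrier G \<Longrightarrow> cj \<one> a = a" "x \<in> carrier G \<Longrightarrow> cj x \<one> = \<one>"
  by (simp_all add: word)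

lemma cj_cancel [simp]:
  "x \<in> carrier G \<Longrightarrow> a \<in> carrier G \<Longrightarrow> cj (inv x) (cj x a) = a"
  "x \<in> carrier G \<Longrightarrow> a \<in> carrier G \<Longrightarrow> cj x (cj (inv x) a) = a"
  by (simp_all add: word)

lemma cj_commutator: "x \<in> carrier G \<Longrightarrow> a \<in> carrier G \<Longrightarrow> b \<in> carrier G \<Longrightarrow> cj x (commutator a b) = commutator (cj x a) (cj x b)"
  by (simp add: word)

lemma cj_hom: "x \<in> carrier G \<Longrightarrow> group_hom G G (cj x)"
  by unfold_locales (auto simp: hom_def cj_mult)

lemma cj_in_subgroup: "subgroup A G \<Longrightarrow> x \<in> A \<Longrightarrow> a \<in> A \<Longrightarrow> cj x a \<in> A"
  by (simp add: cj_def sub_m sub_i)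

lemma commutator_in_subgroup: "subgroup A G \<Longrightarrow> x \<in> A \<Longrightarrow> a \<in> A \<Longrightarrow> commutator x a \<in> A"
  by (simp add: commutator_def sub_m sub_i)

lemma inj_cj: "x \<in> carrier G \<Longrightarrow> A \<subseteq> carrier G \<Longrightarrow> inj_on (cj x) A"
  by (rule inj_on_inverseI[of _ "cj (inv x)"]) auto

lemma cjs_cjs: "x \<in> carrier G \<Longrightarrow> y \<in> carrier G \<Longrightarrow> A \<subseteq> carrier G \<Longrightarrow> cjs x (cjs y A) = cjs (x \<otimes> y) A"
  unfolding image_image by (rule image_cong) (auto simp: cj_cj subset_iff)

lemma cjs_one [simp]: "A \<subseteq> carrier G \<Longrightarrow> cjs \<one> A = A"
  using image_cong[of A A "cj \<one>" id] by (simp add: subset_iff)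

lemma cjs_closed: "x \<in> carrier G \<Longrightarrow> A \<subseteq> carrier G \<Longrightarrow> cjs x A \<subseteq> carrier G"
  by auto

lemma cjs_cancel [simp]:
  "x \<in> carrier G \<Longrightarrow> A \<subseteq> carrier G \<Longrightarrow> cjs (inv x) (cjs x A) = A"
  "x \<in> carrier G \<Longrightarrow> A \<subseteq> carrier G \<Longrightarrow> cjs x (cjs (inv x) A) = A"
  by (simp_all add: cjs_cjs)

lemma cjs_inv_eq: "x \<in> carrier G \<Longrightarrow> A \<subseteq> carrier G \<Longrightarrow> cjs x A = B \<Longrightarrow> cjs (inv x) B = A"
  by auto

lemma cjs_mem_iff: "x \<in> carrier G \<Longrightarrow> A \<subseteq> carrier G \<Longrightarrow> a \<in> carrier G \<Longrightarrow> a \<in> cjs x A \<longleftrightarrow> cj (inv x) a \<in> A"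
proof -
  assume x: "x \<in> carrier G" "A \<subseteq> carrier G" "a \<in> carrier G"
  have "a \<in> cjs x A" if "cj (inv x) a \<in> A" using imageI[OF that, of "cj x"] x by simp
  moreover have "cj (inv x) a \<in> A" if "a \<in> cjs x A" using that x by auto
  ultimately show ?thesis by blast
qed

lemma cjs_subgroup: "x \<in> carrier G \<Longrightarrow> subgroup A G \<Longrightarrow> subgroup (cjs x A) G"
  using group_hom.subgroup_img_is_subgroup[OF cj_hom] by blast

lemma cjs_self: "subgroup A G \<Longrightarrow> x \<in> A \<Longrightarrow> cjs x A = A"
proof -
  assume A: "subgroup A G" and x: "x \<in> A"
  have "a \<in> cjs x A" if "a \<in> A" for a
  proof -
    have "cj (inv x) a \<in> A" using A x that by (simp add: cj_in_subgroup sub_i)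
    then show ?thesis using A x that by (simp add: cjs_mem_iff subgroup.subset subgroupD)
  qed
  then show ?thesis using A x cj_in_subgroup by blast
qed

text \<open>In an infinite group \<open>cjs x A\<close> can be a proper subset of \<open>A\<close>,
  hence the separate condition on the inverse. In a finite group counting settles the matter from
  one inclusion (\<open>cjs_sub_eq\<close>).\<close>

lemma cjs_eqI: "x \<in> carrier G \<Longrightarrow> A \<subseteq> carrier G \<Longrightarrow> (\<And>a. a \<in> A \<Longrightarrow> cj x a \<in> A) \<Longrightarrow> (\<And>a. a \<in> A \<Longrightarrow> cj (inv x) a \<in> A) \<Longrightarrow> cjs x A = A"
proof -
  assume x: "x \<in> carrier G" "A \<subseteq> carrier G" and a: "\<And>a. a \<in> A \<Longrightarrow> cj x a \<in> A" "\<And>a. a \<in> A \<Longrightarrow> cj (inv x) a \<in> A"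
  have "A \<subseteq> cjs x A" using a(2) x by (auto simp: cjs_mem_iff subset_iff)
  then show ?thesis using a(1) by blast
qed

lemma normalizer_eq: "A \<subseteq> carrier G \<Longrightarrow> normalizer G A = {x \<in> carrier G. cjs x A = A}"
proof -
  have "x <# A #> inv x = cjs x A" for x
    by (auto simp: l_coset_def r_coset_def cj_def)
  moreover assume "A \<subseteq> carrier G"
  ultimately have "x \<in> normalizer G A \<longleftrightarrow> x \<in> carrier G \<and> cjs x A = A" for x
    using normalizer_iff[of A x] by simp
  then show ?thesis by blast
qed

lemma normal_inD:
  assumes "normal_in M U"
  shows "subgroup M G" "subgroup U G" "M \<subseteq> U" "x \<in> U \<Longrightarrow> m \<in> M \<Longrightarrow> cj x m \<in> M"
  using assms by (auto simp: normal_in_def)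

lemma normal_in_cjs: "normal_in M U \<Longrightarrow> x \<in> U \<Longrightarrow> cjs x M = M"
  by (rule cjs_eqI) (auto dest: normal_inD subgroupD intro: sub_i simp: normal_in_def sub_i)

lemma stab_subgroup:
  assumes "subgroup U G" "A \<subseteq> carrier G"
  shows "subgroup {x \<in> U. cjs x A = A} G"
proof (rule subgroupI)
  have "\<one> \<in> {x \<in> U. cjs x A = A}" using assms sub_1 by simp
  then show "{x \<in> U. cjs x A = A} \<noteq> {}" by blast
  show "{x \<in> U. cjs x A = A} \<subseteq> carrier G" using assms subgroupD by blast
  fix a assume a: "a \<in> {x \<in> U. cjs x A = A}"
  then have ac: "a \<in> carrier G" using assms subgroupD by blast
  have "cjs (inv a) A = A" using a ac assms(2) by (intro cjs_inv_eq) auto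
  then show "inv a \<in> {x \<in> U. cjs x A = A}" using a sub_i[OF assms(1)] by simp
  fix b assume b: "b \<in> {x \<in> U. cjs x A = A}"
  then have "b \<in> carrier G" using assms subgroupD by blast
  then have "cjs (a \<otimes> b) A = A" using a b ac assms(2) cjs_cjs[of a b A] by simp
  then show "a \<otimes> b \<in> {x \<in> U. cjs x A = A}" using a b sub_m[OF assms(1)] by simp
qed

lemma normal_in_stab:
  assumes "subgroup U G" "subgroup A G" "A \<subseteq> U"
  shows "normal_in A {x \<in> U. cjs x A = A}"
  using stab_subgroup[OF assms(1), of A] assms
  by (auto simp: normal_in_def subgroup.subset cjs_self subgroupD cj_in_subgroup)

lemma normal_in_restrict: "normal_in M U \<Longrightarrow> subgroup Y G \<Longrightarrow> Y \<subseteq> U \<Longrightarrow> normal_in (M \<inter> Y) Y"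
  by (auto simp: normal_in_def subgroups_Inter_pair cj_in_subgroup subset_iff)

lemma normal_in_sub: "normal_in M U \<Longrightarrow> subgroup Y G \<Longrightarrow> M \<subseteq> Y \<Longrightarrow> Y \<subseteq> U \<Longrightarrow> normal_in M Y"
  by (auto simp: normal_in_def)

lemma normal_in_one: "subgroup U G \<Longrightarrow> normal_in {\<one>} U"
  by (simp add: normal_in_def triv_subgroup sub_1 subgroupD)

lemma normal_in_Int: "normal_in M U \<Longrightarrow> normal_in N U \<Longrightarrow> normal_in (M \<inter> N) U"
  by (auto simp: normal_in_def subgroups_Inter_pair)

lemma commutator_memI:
  assumes "normal_in M U" "z \<in> M" "x \<in> U"
  shows "commutator z x \<in> M"
proof -
  have c: "z \<in> carrier G" "x \<in> carrier G" using assms normal_inD subgroupD by blast+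
  have "commutator z x = z \<otimes> cj x (inv z)" using c by (simp add: word)
  then show ?thesis using assms normal_inD sub_m sub_i by metis
qed

lemma commutator_swap: "a \<in> carrier G \<Longrightarrow> b \<in> carrier G \<Longrightarrow> commutator b a = inv (commutator a b)"
  by (simp add: word)

subsection \<open>Products with a normal subgroup\<close>

lemma mult_memI: "h \<in> H \<Longrightarrow> k \<in> K \<Longrightarrow> h \<otimes> k \<in> H <#> K"
  by (auto simp: set_mult_def)

lemma mult_memE: "x \<in> H <#> K \<Longrightarrow> (\<And>h k. h \<in> H \<Longrightarrow> k \<in> K \<Longrightarrow> x = h \<otimes> k \<Longrightarrow> P) \<Longrightarrow> P"
  by (auto simp: set_mult_def)

text \<open>Normality of \<open>B\<close> lets its elements be moved to the right:
  \<open>(k m) (l n) = (k l) (cj (inv l) m n)\<close>. The facts are bundled since nearly every use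
  of the group \<open>K B\<close> needs several of them.\<close>

lemma prod_normal_in:
  assumes B: "normal_in B U" and K: "subgroup K G" "K \<subseteq> U"
  shows "subgroup (K <#> B) G" "K \<subseteq> K <#> B" "B \<subseteq> K <#> B" "K <#> B \<subseteq> U" "normal_in B (K <#> B)"
proof -
  note b = normal_inD[OF B]
  have kc: "k \<in> carrier G" if "k \<in> K" for k using that K subgroupD by blast
  have bc: "k \<in> carrier G" if "k \<in> B" for k using that b subgroupD by blast
  have nb: "cj k m \<in> B" if "k \<in> K" "m \<in> B" for k m using that b(4) K by blast
  show s: "subgroup (K <#> B) G"
  proof (rule subgroupI)
    show "K <#> B \<subseteq> carrier G" using kc bc by (auto elim!: mult_memE)
    show "K <#> B \<noteq> {}" using sub_1[OF K(1)] sub_1[OF b(1)] mult_memI by blast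
    fix x assume "x \<in> K <#> B"
    then obtain k m where x: "k \<in> K" "m \<in> B" "x = k \<otimes> m" by (rule mult_memE)
    have "inv x = inv k \<otimes> cj k (inv m)" using x kc bc by (simp add: word)
    moreover have "cj k (inv m) \<in> B" using x nb b(1) sub_i by metis
    ultimately show "inv x \<in> K <#> B" using x K mult_memI sub_i by metis
    fix y assume "y \<in> K <#> B"
    then obtain l n where y: "l \<in> K" "n \<in> B" "y = l \<otimes> n" by (rule mult_memE)
    have "x \<otimes> y = (k \<otimes> l) \<otimes> (cj (inv l) m \<otimes> n)" using x y kc bc by (simp add: word)
    moreover have "cj (inv l) m \<otimes> n \<in> B" using x y nb b(1) K sub_i sub_m by metis
    ultimately show "x \<otimes> y \<in> K <#> B" using x y K mult_memI sub_m by metis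
  qed
  show "K \<subseteq> K <#> B" 
    using mult_memI[OF _ sub_1[OF b(1)], of _ K] kc by force
  show B': "B \<subseteq> K <#> B" 
    using mult_memI[OF sub_1[OF K(1)], of _ B] bc by force
  show le: "K <#> B \<subseteq> U" using K b by (auto elim!: mult_memE simp: subset_iff sub_m)
  show "normal_in B (K <#> B)" using normal_in_sub[OF B s B' le] .
qed

lemma prod_subset: "subgroup Y G \<Longrightarrow> K \<subseteq> Y \<Longrightarrow> B \<subseteq> Y \<Longrightarrow> K <#> B \<subseteq> Y"
  by (auto elim!: mult_memE simp: subset_iff sub_m)

lemma cjs_prod: "x \<in> carrier G \<Longrightarrow> A \<subseteq> carrier G \<Longrightarrow> B \<subseteq> carrier G \<Longrightarrow> cjs x (A <#> B) = cjs x A <#> cjs x B"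
proof -
  assume "x \<in> carrier G" "A \<subseteq> carrier G" "B \<subseteq> carrier G"
  then have "cj x (a \<otimes> b) = cj x a \<otimes> cj x b" if "a \<in> A" "b \<in> B" for a b using that cj_mult by blast
  then show ?thesis unfolding set_mult_def by (force simp: image_iff)
qed

text \<open>Dedekind's modular law: the \<open>B\<close>-part \<open>inv k x\<close> of an element
  of \<open>L\<close> stays in \<open>L\<close>, because \<open>k\<close> does.\<close>

lemma dedekind:
  assumes "subgroup K G" "subgroup L G" "K \<subseteq> L" "x \<in> K <#> B" "x \<in> L" "B \<subseteq> carrier G"
  shows "x \<in> K <#> (B \<inter> L)"
proof -
  obtain k b where x: "k \<in> K" "b \<in> B" "x = k \<otimes> b" using assms(4) by (rule mult_memE)
  have "b = inv k \<otimes> x" using x assms subgroupD by (metis cancel_left(1) subsetD)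
  then have "b \<in> L" using x assms by (metis sub_m sub_i subset_iff)
  then show ?thesis using x mult_memI by blast
qed

subsection \<open>Relative upper central series\<close>

text \<open>One induction for both claims: that the next term is a normal subgroup uses normality of
  the previous one, and that it is nonempty uses the inclusion.\<close>

lemma upper_central_props:
  assumes M: "normal_in M U"
  shows "normal_in (upper_central U M n) U \<and> upper_central U M n \<subseteq> upper_central U M (Suc n)"
proof (induction n)
  case 0
  show ?case using M commutator_memI[OF M] normal_inD(3)[OF M] by auto
next
  case (Suc n)
  let ?Z = "upper_central U M n" let ?W = "upper_central U M (Suc n)"
  have Z: "normal_in ?Z U" using Suc by simp
  note z = normal_inD[OF Z]
  have Xc: "x \<in> carrier G" if "x \<in> U" for x using that z subgroupD by blast
  have X1: "x \<otimes> y \<in> U" "inv x \<in> U" "\<one> \<in> U" if "x \<in> U" "y \<in> U" for x y using z(2) that by (auto simp: sub_i sub_m sub_1)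
  have sW: "subgroup ?W G"
  proof (rule subgroupI)
    show "?W \<subseteq> carrier G" using Xc by auto
    show "?W \<noteq> {}" using Suc z(1) sub_1 by blast
    fix a assume a: "a \<in> ?W"
    then have aX: "a \<in> U" by simp
    have "commutator (inv a) x \<in> ?Z" if x: "x \<in> U" for x
    proof -
      have "commutator (inv a) x = cj (inv a) (inv (commutator a x))" using aX x Xc by (simp add: word)
      moreover have "inv (commutator a x) \<in> ?Z" by (rule sub_i[OF z(1)]) (use a x in auto)
      ultimately show ?thesis using z(4) X1 aX by metis
    qed
    then show "inv a \<in> ?W" using X1 aX by simp
    fix b assume b: "b \<in> ?W"
    then have bX: "b \<in> U" by simp
    have "commutator (a \<otimes> b) x \<in> ?Z" if x: "x \<in> U" for x
    proof -
      have "commutator (a \<otimes> b) x = cj a (commutator b x) \<otimes> commutator a x" using aX bX x Xc by (simp add: word)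
      moreover have "commutator a x \<in> ?Z" "commutator b x \<in> ?Z" using a b x by auto
      ultimately show ?thesis using z(4) aX z(1) sub_m by metis
    qed
    then show "a \<otimes> b \<in> ?W" using X1 aX bX by simp
  qed
  have "cj y a \<in> ?W" if y: "y \<in> U" and a: "a \<in> ?W" for y a
  proof -
    have aX: "a \<in> U" using a by simp
    have "commutator (cj y a) x \<in> ?Z" if x: "x \<in> U" for x
    proof -
      have i: "cj (inv y) x \<in> U" using x y z(2) X1 cj_in_subgroup by metis
      have "commutator (cj y a) x = cj y (commutator a (cj (inv y) x))" using aX x y Xc by (simp add: cj_commutator)
      then show ?thesis using z(4) y i a by auto
    qed
    then show ?thesis using aX y z(2) cj_in_subgroup by auto
  qed
  then have W: "normal_in ?W U" using sW z(2) unfolding normal_in_def by auto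
  then show ?case using commutator_memI[OF W] by auto
qed

lemmas upper_central_normal_in = upper_central_props[THEN conjunct1]

lemma upper_central_mono_index: "normal_in M U \<Longrightarrow> m \<le> n \<Longrightarrow> upper_central U M m \<subseteq> upper_central U M n"
  by (rule lift_Suc_mono_le[of "upper_central U M"]) (use upper_central_props in blast)+

lemma upper_central_base: "normal_in M U \<Longrightarrow> M \<subseteq> upper_central U M n"
  using upper_central_mono_index[of M U 0 n] by simp

lemma upper_central_mono: "M \<subseteq> M' \<Longrightarrow> upper_central U M n \<subseteq> upper_central U M' n"
  by (induction n) auto

lemma upper_central_sub: "Y \<subseteq> U \<Longrightarrow> subgroup Y G \<Longrightarrow> upper_central U M n \<inter> Y \<subseteq> upper_central Y (M \<inter> Y) n"
proof (induction n)
  case (Suc n)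
  have 1: "commutator z x \<in> Y" if "z \<in> Y" "x \<in> Y" for z x using that Suc.prems commutator_in_subgroup by blast
  show ?case
  proof
    fix z assume z: "z \<in> upper_central U M (Suc n) \<inter> Y"
    then have "commutator z x \<in> upper_central Y (M \<inter> Y) n" if "x \<in> Y" for x using Suc 1[of z x] that by auto
    then show "z \<in> upper_central Y (M \<inter> Y) (Suc n)" using z by simp
  qed
qed simp

lemma upper_central_add: "upper_central U (upper_central U M n) m = upper_central U M (m + n)"
  by (induction m) auto

lemma nilpotent_mod_sub: "nilpotent_mod U M \<Longrightarrow> Y \<subseteq> U \<Longrightarrow> subgroup Y G \<Longrightarrow> nilpotent_mod Y (M \<inter> Y)"
  unfolding nilpotent_mod_def using upper_central_sub by blast

lemma nilpotent_mod_mono: "nilpotent_mod U M \<Longrightarrow> M \<subseteq> M' \<Longrightarrow> nilpotent_mod U M'"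
  unfolding nilpotent_mod_def using upper_central_mono by blast

lemma nilpotent_mod_sub': "nilpotent_mod U M \<Longrightarrow> Y \<subseteq> U \<Longrightarrow> subgroup Y G \<Longrightarrow> M \<subseteq> M' \<Longrightarrow> nilpotent_mod Y M'"
  using nilpotent_mod_sub nilpotent_mod_mono by (metis inf.coboundedI1)

lemma nilpotent_mod_refl: "nilpotent_mod U U"
  unfolding nilpotent_mod_def by (rule exI[of _ 0]) simp

text \<open>The upper central series over \<open>M\<close> can be restarted at its
  \<open>n\<close>-th term, which already contains \<open>B\<close>. For this \<open>B\<close> has
  to be hypercentral modulo \<open>M\<close>; mere nilpotency of \<open>B\<close> would not
  do.\<close>

lemma nilpotent_mod_ext: "nilpotent_mod U B \<Longrightarrow> B \<subseteq> upper_central U M n \<Longrightarrow> nilpotent_mod U M"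
proof -
  assume "nilpotent_mod U B" "B \<subseteq> upper_central U M n"
  then obtain m where "U \<subseteq> upper_central U B m" unfolding nilpotent_mod_def by blast
  also have "\<dots> \<subseteq> upper_central U (upper_central U M n) m" using \<open>B \<subseteq> upper_central U M n\<close> by (rule upper_central_mono)
  finally show ?thesis unfolding nilpotent_mod_def upper_central_add by blast
qed

text \<open>Since \<open>M\<close> lies in \<open>B\<close>, the image of \<open>K\<close> modulo
  \<open>B\<close> is a quotient of its image modulo \<open>M\<close>. The induction shows that a
  factor from \<open>B\<close> does not change the level of an element in the upper central
  series.\<close>

lemma nilpotent_mod_mult:
  assumes B: "normal_in B U" and K: "subgroup K G" "K \<subseteq> U" and n: "nilpotent_mod K M" and MB: "M \<subseteq> B"
  shows "nilpotent_mod (K <#> B) B"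
proof -
  note b = normal_inD[OF B]
  have kc: "k \<in> carrier G" if "k \<in> K" for k using that K subgroupD by blast
  have bc: "k \<in> carrier G" if "k \<in> B" for k using that b subgroupD by blast
  have nb: "cj k m \<in> B" if "k \<in> K" "m \<in> B" for k m using that b(4) K by blast
  have bb: "x \<otimes> y \<in> B" "inv x \<in> B" if "x \<in> B" "y \<in> B" for x y using that b(1) by (auto simp: sub_m sub_i)
  have KK: "x \<otimes> y \<in> K" "inv x \<in> K" if "x \<in> K" "y \<in> K" for x y using that K(1) by (auto simp: sub_m sub_i)
  have "z \<otimes> u \<in> upper_central (K <#> B) B n" if "z \<in> upper_central K M n" "u \<in> B" for z u n
    using that
  proof (induction n arbitrary: z u)
    case 0 then show ?case using MB b(1) sub_m by fastforce
  next
    case (Suc n)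
    have zK: "z \<in> K" using Suc.prems by simp
    have "commutator (z \<otimes> u) y \<in> upper_central (K <#> B) B n" if "y \<in> K <#> B" for y
    proof -
      obtain k v where y: "k \<in> K" "v \<in> B" "y = k \<otimes> v" using \<open>y \<in> K <#> B\<close> by (rule mult_memE)
      \<comment> \<open>Chosen so that \<open>[z u, k v] = [z, k] w\<close>: all contributions of
        \<open>B\<close> are gathered in \<open>w\<close>, and the level is decided by the
        commutator inside \<open>K\<close>.\<close>
      define w where "w = cj (k \<otimes> z) (cj (inv k) u \<otimes> v \<otimes> inv u) \<otimes> cj k (inv v)"
      have "w \<in> B" unfolding w_def using zK y Suc.prems(2) by (intro bb nb KK) auto
      moreover have "commutator (z \<otimes> u) y = commutator z k \<otimes> w"
        unfolding w_def y(3) using zK y Suc.prems(2) kc bc by (simp add: word)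
      moreover have "commutator z k \<in> upper_central K M n" using Suc.prems y by auto
      ultimately show ?thesis using Suc.IH by simp
    qed
    then show ?case using zK Suc.prems(2) mult_memI by simp
  qed
  moreover obtain n where "K \<subseteq> upper_central K M n" using n unfolding nilpotent_mod_def by blast
  ultimately show ?thesis unfolding nilpotent_mod_def by (blast elim: mult_memE)
qed

text \<open>The normalizer condition. Let \<open>m\<close> be the first index whose term of the
  upper central series is not inside \<open>L\<close>; it is positive because term 0 is
  \<open>M\<close>. Commutators of term \<open>m\<close> with \<open>L\<close> lie in the preceding
  term, hence in \<open>L\<close>, so term \<open>m\<close> normalizes \<open>L\<close>.\<close>

lemma nilpotent_mod_normalizer:
  assumes M: "normal_in M U" and n: "nilpotent_mod U M" and L: "subgroup L G" "M \<subseteq> L" "L \<subseteq> U" "L \<noteq> U"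
  shows "\<exists>x\<in>U - L. cjs x L = L"
proof -
  obtain n where "U \<subseteq> upper_central U M n" using n unfolding nilpotent_mod_def by blast
  then have ex: "\<exists>n. \<not> upper_central U M n \<subseteq> L" using L by blast
  define m where "m = (LEAST n. \<not> upper_central U M n \<subseteq> L)"
  have m: "\<not> upper_central U M m \<subseteq> L" unfolding m_def using ex by (rule LeastI_ex)
  then obtain k where k: "m = Suc k" using L(2) by (cases m) auto
  have kl: "upper_central U M k \<subseteq> L" using not_less_Least[of k "\<lambda>n. \<not> upper_central U M n \<subseteq> L"] k unfolding m_def by auto
  obtain x where x: "x \<in> upper_central U M m" "x \<notin> L" using m by blast
  have W: "normal_in (upper_central U M m) U" using upper_central_normal_in[OF M] .
  have Xc: "x \<in> carrier G" if "x \<in> U" for x using that normal_inD[OF W] subgroupD by blast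
  have main: "cj y l \<in> L" if y: "y \<in> upper_central U M m" and l: "l \<in> L" for y l
  proof -
    have yX: "y \<in> U" using y k by simp
    have "commutator y l \<in> L" using y k l L(3) kl by auto
    moreover have "cj y l = commutator y l \<otimes> l" using Xc yX l L by (auto simp: word subset_iff)
    ultimately show ?thesis using l L(1) sub_m by metis
  qed
  have xX: "x \<in> U" using x(1) k by simp
  have "inv x \<in> upper_central U M m" using x normal_inD(1)[OF W] sub_i by blast
  then have "cjs x L = L" using main x Xc xX L by (intro cjs_eqI) (auto simp: subset_iff)
  then show ?thesis using x xX by blast
qed

end

lemma (in group_hom) hom_commutator: "a \<in> carrier G \<Longrightarrow> b \<in> carrier G \<Longrightarrow> h (group.commutator G a b) = group.commutator H (h a) (h b)"
  by (simp add: G.commutator_def H.commutator_def)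

lemma (in group_hom) upper_central_image: 
  assumes U: "U \<subseteq> carrier G" and z: "z \<in> group.upper_central G U M n"  and M: "M \<subseteq> carrier G"
  shows "h z \<in> group.upper_central H (h ` U) (h ` M) n"
  using z
proof (induction n arbitrary: z)
  case (Suc n)
  have "H.commutator (h z) (h x) \<in> H.upper_central (h ` U) (h ` M) n" if "x \<in> U" for x
  proof -
    have "h (G.commutator z x) \<in> H.upper_central (h ` U) (h ` M) n" using Suc that by auto
    moreover have "z \<in> carrier G" "x \<in> carrier G" using Suc.prems that U by auto
    ultimately show ?thesis using hom_commutator[of z x] by simp
  qed
  then show ?case using Suc.prems by auto
qed simp

lemma (in group_hom) nilpotent_mod_image: 
  assumes U: "U \<subseteq> carrier G" and n: "group.nilpotent_mod G U M" and M: "M \<subseteq> carrier G"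
  shows "group.nilpotent_mod H (h ` U) (h ` M)"
  using n upper_central_image[OF U _ M] unfolding G.nilpotent_mod_def H.nilpotent_mod_def by blast

lemma (in group_hom) upper_central_preimage: 
  assumes U: "U \<subseteq> carrier G" and M: "\<And>x. x \<in> U \<Longrightarrow> h x \<in> M' \<Longrightarrow> x \<in> M"
    and z: "h z \<in> group.upper_central H (h ` U) M' n" "z \<in> U" and s: "subgroup U G"
  shows "z \<in> group.upper_central G U M n"
  using z
proof (induction n arbitrary: z)
  case (Suc n)
  have "G.commutator z x \<in> G.upper_central U M n" if "x \<in> U" for x
  proof (rule Suc.IH)
    have "z \<in> carrier G" "x \<in> carrier G" using Suc.prems that U by auto
    then show "h (G.commutator z x) \<in> H.upper_central (h ` U) M' n" using Suc.prems that hom_commutator[of z x] by auto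
    show "G.commutator z x \<in> U" using G.commutator_in_subgroup[OF s Suc.prems(2) that] .
  qed
  then show ?case using Suc.prems by auto
qed (use M in auto)

lemma (in group_hom) nilpotent_mod_preimage: 
  assumes U: "subgroup U G" and M: "\<And>x. x \<in> U \<Longrightarrow> h x \<in> M' \<Longrightarrow> x \<in> M"
    and n: "group.nilpotent_mod H (h ` U) M'"
  shows "group.nilpotent_mod G U M"
  using n upper_central_preimage[OF subgroup.subset[OF U] M _ _ U] unfolding G.nilpotent_mod_def H.nilpotent_mod_def by blast

subsection \<open>Fixed points of p-groups and Sylow subgroups\<close>

locale fin_group = group +
  assumes fin: "finite (carrier G)"

text \<open>By the orbit-stabilizer theorem every orbit has prime power length, so all orbits other
  than fixed points vanish modulo \<open>p\<close>.\<close>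

lemma (in group_action) p_group_fixed_points:
  assumes p: "Factorial_Ring.prime p" and ord: "order G = p ^ a" and fE: "finite E"
  shows "[card {w \<in> E. \<forall>g\<in>carrier G. \<phi> g w = w} = card E] (mod p)"
proof -
  let ?F = "{w \<in> E. \<forall>g\<in>carrier G. \<phi> g w = w}" and ?Ob = "orbits G E \<phi>"
  have one: "card (orbit G \<phi> w) = 1 \<longleftrightarrow> w \<in> ?F" if w: "w \<in> E" for w
  proof
    assume "card (orbit G \<phi> w) = 1"
    then obtain v where v: "orbit G \<phi> w = {v}" by (rule card_1_singletonE)
    then have "v = w" using orbit_refl[OF w] by simp
    then have "\<phi> g w = w" if "g \<in> carrier G" for g using v that unfolding orbit_def by blast
    then show "w \<in> ?F" using w by simp
  next
    assume "w \<in> ?F"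
    then have "orbit G \<phi> w = {w}" using orbit_refl[OF w] unfolding orbit_def by blast
    then show "card (orbit G \<phi> w) = 1" by simp
  qed
  have oE: "Ob \<subseteq> E" if "Ob \<in> ?Ob" for Ob using that orbits_coverture by blast
  have E: "card E = (\<Sum>Ob\<in>?Ob. card Ob)"
    unfolding card_eq_sum using disjoint_sum[OF fE, of "\<lambda>_. 1::nat"] by (rule sym)

  have "card ?F = (\<Sum>w\<in>E. if w \<in> ?F then 1 else 0)" by (rule card_as_sums) (use fE in auto)
  also have "\<dots> = (\<Sum>Ob\<in>?Ob. \<Sum>w\<in>Ob. if w \<in> ?F then 1 else 0)" using disjoint_sum[OF fE, of "\<lambda>w. if w \<in> ?F then 1 else 0"] by (rule sym)
  finally have F: "card ?F = (\<Sum>Ob\<in>?Ob. \<Sum>w\<in>Ob. if w \<in> ?F then 1 else 0)" .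
  have "[(\<Sum>w\<in>Ob. if w \<in> ?F then 1 else 0) = card Ob] (mod p)" if Ob: "Ob \<in> ?Ob" for Ob
  proof -
    obtain x where x: "x \<in> E" "Ob = orbit G \<phi> x" using Ob unfolding orbits_def by blast
    show ?thesis
    proof (cases "card Ob = 1")
      case True
      then have "x \<in> ?F" using one x by simp
      then have "Ob = {x}" using x orbit_refl[OF x(1)] True by (metis card_1_singletonE singletonD)
      then show ?thesis using \<open>x \<in> ?F\<close> by simp
    next
      case False
      have "card Ob dvd p ^ a" using orbit_stabilizer_theorem[OF x(1)] ord x(2) by (metis dvd_triv_left)
      then obtain i where "card Ob = p ^ i" using p divides_primepow_nat by blast
      then have pO: "p dvd card Ob" using False by (cases i) auto
      have "w \<notin> ?F" if w: "w \<in> Ob" for w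
      proof -
        have "w \<in> E" using w oE Ob by blast
        have "orbit G \<phi> w \<in> ?Ob" using \<open>w \<in> E\<close> unfolding orbits_def by blast
        moreover have "w \<in> Ob \<inter> orbit G \<phi> w" using w orbit_refl \<open>w \<in> E\<close> by simp
        ultimately have "Ob = orbit G \<phi> w" using disjoint_union Ob by blast
        then show ?thesis using one[OF \<open>w \<in> E\<close>] False by simp
      qed
      then have "(\<Sum>w\<in>Ob. if w \<in> ?F then 1 else (0::nat)) = 0" by (intro sum.neutral) auto
      then show ?thesis using pO by (auto simp: cong_def)
    qed
  qed
  then show ?thesis unfolding E F by (intro cong_sum)
qed

context fin_group begin

lemma fin_sub: "subgroup A G \<Longrightarrow> finite A"
  using fin finite_subset subgroup.subset by blast

text \<open>Frees the counting arguments below from the extensional bijections required by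
  \<open>group_action\<close>: \<open>act\<close> is any function that obeys the laws of an action
  on \<open>E\<close>.\<close>

lemma fixed_points:
  assumes p: "Factorial_Ring.prime p" and P: "subgroup P G" "card P = p ^ a" and fE: "finite E"
    and act: "\<And>g w. g \<in> P \<Longrightarrow> w \<in> E \<Longrightarrow> act g w \<in> E"
      "\<And>g h w. g \<in> P \<Longrightarrow> h \<in> P \<Longrightarrow> w \<in> E \<Longrightarrow> act (g \<otimes> h) w = act g (act h w)"
      "\<And>w. w \<in> E \<Longrightarrow> act \<one> w = w"
  shows "[card {w \<in> E. \<forall>g\<in>P. act g w = w} = card E] (mod p)"
proof -
  interpret P: group "G\<lparr>carrier := P\<rparr>" using P subgroup_imp_group by blast
  let ?\<phi> = "\<lambda>g. \<lambda>w\<in>E. act g w"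
  have bij: "?\<phi> g \<in> Bij E" if g: "g \<in> P" for g
  proof -
    have i: "inv g \<in> P" "g \<in> carrier G" using g P sub_i subgroupD by auto
    have "act (inv g) (act g w) = w" "act g (act (inv g) w) = w" if "w \<in> E" for w
      using act(2)[of "inv g" g w] act(2)[of g "inv g" w] act(3) that g i by auto
    then have "bij_betw (act g) E E" using act(1) g i by (intro bij_betw_byWitness[where f' = "act (inv g)"]) auto
    then show ?thesis unfolding Bij_def by (simp add: bij_betw_def inj_on_def)
  qed
  interpret A: group_action "G\<lparr>carrier := P\<rparr>" E ?\<phi>
  proof (intro group_action.intro group_hom.intro group_hom_axioms.intro)
    show "group (G\<lparr>carrier := P\<rparr>)" by (rule P.is_group)
    show "group (BijGroup E)" by (rule group_BijGroup)
    have "?\<phi> (g \<otimes> h) = compose E (?\<phi> g) (?\<phi> h)" if "g \<in> P" "h \<in> P" for g h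
      using act that by (auto simp: compose_def fun_eq_iff)
    then show "?\<phi> \<in> hom (G\<lparr>carrier := P\<rparr>) (BijGroup E)"
      using bij by (auto simp: hom_def BijGroup_def)
  qed
  have "{w \<in> E. \<forall>g\<in>P. act g w = w} = {w \<in> E. \<forall>g\<in>carrier (G\<lparr>carrier := P\<rparr>). ?\<phi> g w = w}" by auto
  then show ?thesis using A.p_group_fixed_points[OF p _ fE, of a] P(2) by (simp add: order_def)
qed

lemma lagrange_sub:
  assumes "subgroup A G" "subgroup B G" "A \<subseteq> B"
  shows "card (rcosets\<^bsub>G\<lparr>carrier := B\<rparr>\<^esub> A) * card A = card B"
proof -
  interpret B: group "G\<lparr>carrier := B\<rparr>" using assms subgroup_imp_group by blast
  have "subgroup A (G\<lparr>carrier := B\<rparr>)" using assms subgroup_incl by blast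
  from B.lagrange[OF this] show ?thesis by (simp add: order_def)
qed

lemma card_sub_dvd: "subgroup A G \<Longrightarrow> subgroup B G \<Longrightarrow> A \<subseteq> B \<Longrightarrow> card A dvd card B"
  using lagrange_sub by (metis dvd_triv_right)

lemma card_sub_pos: "subgroup A G \<Longrightarrow> card A > 0"
  using fin_sub sub_1 card_gt_0_iff by blast

text \<open>If \<open>p\<close> does not divide \<open>card U\<close>, this forces \<open>P\<close>
  to be trivial, so that statements can range over all primes without a divisibility
  condition.\<close>

definition is_sylow :: "nat \<Rightarrow> 'a set \<Rightarrow> 'a set \<Rightarrow> bool" where
  "is_sylow p U P \<longleftrightarrow> subgroup P G \<and> P \<subseteq> U \<and> card P = p ^ multiplicity p (card U)"

lemma is_sylow_ex:
  assumes "Factorial_Ring.prime p" "subgroup U G"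
  shows "\<exists>P. is_sylow p U P"
proof -
  interpret U: group "G\<lparr>carrier := U\<rparr>" using assms subgroup_imp_group by blast
  have "order (G\<lparr>carrier := U\<rparr>) = p ^ multiplicity p (card U) * (card U div p ^ multiplicity p (card U))"
    by (simp add: order_def multiplicity_dvd)
  then obtain P where "subgroup P (G\<lparr>carrier := U\<rparr>)" "card P = p ^ multiplicity p (card U)"
    using sylow_thm[OF assms(1) U.is_group] fin_sub[OF assms(2)] by auto
  moreover have "subgroup P G" using calculation incl_subgroup assms by blast
  ultimately show ?thesis unfolding is_sylow_def using subgroup.subset by fastforce
qed

lemma is_sylow_between:
  assumes p: "Factorial_Ring.prime p" and P: "is_sylow p U P" and W: "subgroup W G" "P \<subseteq> W" "W \<subseteq> U" and U: "subgroup U G"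
  shows "is_sylow p W P"
proof -
  have P': "subgroup P G" "card P = p ^ multiplicity p (card U)" using P unfolding is_sylow_def by auto
  have "multiplicity p (card W) \<le> multiplicity p (card U)"
    using card_sub_dvd[OF W(1) U W(3)] card_sub_pos[OF U] by (intro dvd_imp_multiplicity_le) auto
  moreover have "multiplicity p (card U) \<le> multiplicity p (card W)"
    using card_sub_dvd[OF P'(1) W(1,2)] P'(2) card_sub_pos[OF W(1)] p
    by (intro multiplicity_geI) (auto simp: not_prime_unit)
  ultimately show ?thesis using P' W unfolding is_sylow_def by simp
qed

text \<open>\<open>Q\<close> acts by right multiplication on the cosets of \<open>P\<close> in
  \<open>U\<close>, whose number is prime to \<open>p\<close>; a fixed coset \<open>P x\<close> says
  that \<open>x Q (inv x)\<close> lies in \<open>P\<close>.\<close>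

lemma is_sylow_contains_conj:
  assumes p: "Factorial_Ring.prime p" and P: "is_sylow p U P" and U: "subgroup U G"
    and Q: "subgroup Q G" "Q \<subseteq> U" "card Q = p ^ b"
  shows "\<exists>x\<in>U. cjs x Q \<subseteq> P"
proof -
  have P': "subgroup P G" "P \<subseteq> U" "card P = p ^ multiplicity p (card U)" using P unfolding is_sylow_def by auto
  let ?E = "rcosets\<^bsub>G\<lparr>carrier := U\<rparr>\<^esub> P"
  have Ei: "?E = {P #> x | x. x \<in> U}" unfolding RCOSETS_def by auto
  have Uc: "x \<in> carrier G" if "x \<in> U" for x using that U subgroupD by blast
  have Pc: "P \<subseteq> carrier G" using P' subgroup.subset by blast
  have m: "card ?E * p ^ multiplicity p (card U) = card U" using lagrange_sub[OF P'(1) U P'(2)] P'(3) by simp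
  have nd: "\<not> p dvd card ?E"
  proof
    assume "p dvd card ?E"
    then have "p ^ Suc (multiplicity p (card U)) dvd card U" using m by (metis mult_dvd_mono power_Suc dvd_refl)
    then show False using p card_sub_pos[OF U] not_prime_unit[of p]
      by (metis less_numeral_extra(3) power_dvd_iff_le_multiplicity Suc_n_not_le_n)
  qed
  have finE: "finite ?E" using Ei fin_sub[OF U] by simp
  \<comment> \<open>The inverse turns right multiplication into a left action.\<close>
  have "[card {w \<in> ?E. \<forall>g\<in>Q. w #> inv g = w} = card ?E] (mod p)"
  proof (rule fixed_points[OF p Q(1,3) finE])
    fix g w assume g: "g \<in> Q" and w: "w \<in> ?E"
    then obtain x where x: "x \<in> U" "w = P #> x" using Ei by blast
    have c: "x \<in> carrier G" "g \<in> carrier G" "inv g \<in> U" using g x Uc U Q sub_i by blast+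
    then have "w #> inv g = P #> (x \<otimes> inv g)" using x Pc by (simp add: coset_mult_assoc)
    then show "w #> inv g \<in> ?E" using Ei x c sub_m[OF U] by blast
    fix h assume h: "h \<in> Q"
    then have "h \<in> carrier G" using Q Uc by blast
    then show "w #> inv (g \<otimes> h) = w #> inv h #> inv g" using x c Pc
      by (simp add: coset_mult_assoc inv_mult_group m_assoc)
  next
    fix w assume "w \<in> ?E"
    then obtain x where "x \<in> U" "w = P #> x" using Ei by blast
    then show "w #> inv \<one> = w" using Uc Pc by (simp add: coset_mult_assoc)
  qed
  then have "card {w \<in> ?E. \<forall>g\<in>Q. w #> inv g = w} \<noteq> 0" using nd by (metis cong_0_iff cong_sym)
  then have "{w \<in> ?E. \<forall>g\<in>Q. w #> inv g = w} \<noteq> {}" by (intro notI) simp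
  then obtain w where w: "w \<in> ?E" "\<forall>g\<in>Q. w #> inv g = w" by blast
  then obtain x where x: "x \<in> U" "w = P #> x" using Ei by blast
  have "cj x g \<in> P" if g: "g \<in> Q" for g
  proof -
    have c: "x \<in> carrier G" "g \<in> carrier G" using g x Uc Q by blast+
    have "inv g \<in> Q" using g Q sub_i by blast
    then have "P #> x #> inv (inv g) = P #> x" using w x by blast
    then have "P #> (x \<otimes> g) = P #> x" using c Pc by (simp add: coset_mult_assoc)
    then have "x \<otimes> g \<in> P #> x" using rcos_self[of "x \<otimes> g" P] c P' by simp
    then obtain q where "q \<in> P" "x \<otimes> g = q \<otimes> x" unfolding r_coset_def by blast
    moreover then have "cj x g = q" using c P'(1) subgroupD by (simp add: cj_def m_assoc)
    ultimately show ?thesis by simp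
  qed
  then show ?thesis using x by blast
qed

lemma card_cjs: "x \<in> carrier G \<Longrightarrow> A \<subseteq> carrier G \<Longrightarrow> card (cjs x A) = card A"
  by (simp add: card_image inj_cj)

lemma cjs_sub_eq: "x \<in> carrier G \<Longrightarrow> A \<subseteq> carrier G \<Longrightarrow> cjs x A \<subseteq> A \<Longrightarrow> cjs x A = A"
  using card_cjs fin by (metis card_subset_eq finite_subset)

section \<open>Sylow subgroups over a nilpotent quotient and the Frattini argument\<close>

text \<open>The normalizer \<open>W\<close> of \<open>P M\<close> is self-normalizing: if
  \<open>x\<close> normalizes \<open>W\<close>, then \<open>cjs x P\<close> is a
  \<open>p\<close>-subgroup of \<open>W\<close> and some \<open>w\<close> in \<open>W\<close> takes
  it back to \<open>P\<close>, so \<open>w x\<close> normalizes \<open>P M\<close> and lies in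
  \<open>W\<close>. By the normalizer condition \<open>W = U\<close>.\<close>

lemma nilpotent_mod_is_sylow_normal:
  assumes M: "normal_in M U" and n: "nilpotent_mod U M" and p: "Factorial_Ring.prime p" and P: "is_sylow p U P"
  shows "normal_in (P <#> M) U"
proof -
  note m = normal_inD[OF M]
  have P': "subgroup P G" "P \<subseteq> U" "card P = p ^ multiplicity p (card U)" using P unfolding is_sylow_def by auto
  define L where "L = P <#> M"
  note L = prod_normal_in[OF M P'(1,2), folded L_def]
  have Lc: "L \<subseteq> carrier G" using L(1) subgroup.subset by blast
  have Uc: "x \<in> carrier G" if "x \<in> U" for x using that m subgroupD by blast
  have Pc: "P \<subseteq> carrier G" using P' subgroup.subset by blast
  have Mc: "M \<subseteq> carrier G" using m subgroup.subset by blast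
  define W where "W = {x \<in> U. cjs x L = L}"
  have Wi: "x \<in> W \<longleftrightarrow> x \<in> U \<and> cjs x L = L" for x unfolding W_def by simp
  have W: "normal_in L W" using normal_in_stab[OF m(2) L(1,4)] unfolding W_def .
  have WU: "W \<subseteq> U" unfolding W_def by blast
  have "W = U"
  proof (rule ccontr)
    assume ne: "W \<noteq> U"
    have "M \<subseteq> W" using normal_inD(3)[OF W] L(3) by blast
    from nilpotent_mod_normalizer[OF M n normal_inD(2)[OF W] this WU ne]
    obtain x where x: "x \<in> U" "x \<notin> W" "cjs x W = W" by blast
    have xc: "x \<in> carrier G" using x Uc by blast
    have PW: "P \<subseteq> W" using normal_inD(3)[OF W] L(2) by blast
    then have "cjs x P \<subseteq> W" using x by blast
    from is_sylow_contains_conj[OF p is_sylow_between[OF p P normal_inD(2)[OF W] PW WU m(2)] normal_inD(2)[OF W] cjs_subgroup[OF xc P'(1)] this]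
    obtain w where w: "w \<in> W" "cjs w (cjs x P) \<subseteq> P" using trans[OF card_cjs[OF xc Pc] P'(3)] by blast
    have wc: "w \<in> carrier G" "w \<in> U" using w Uc WU by blast+
    have wx: "cjs (w \<otimes> x) P \<subseteq> P" using w cjs_cjs[OF wc(1) xc Pc] by simp
    have wxU: "w \<otimes> x \<in> U" using sub_m[OF m(2)] wc x by blast
    have "cjs (w \<otimes> x) M = M" using normal_in_cjs[OF M wxU] .
    then have "cjs (w \<otimes> x) L = cjs (w \<otimes> x) P <#> M"
      using cjs_prod[OF m_closed[OF wc(1) xc] Pc Mc] unfolding L_def by (simp only:)
    also have "\<dots> \<subseteq> L" unfolding L_def using wx by (rule mono_set_mult) simp
    finally have "cjs (w \<otimes> x) L = L" by (rule cjs_sub_eq[OF m_closed[OF wc(1) xc] Lc])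
    then have "w \<otimes> x \<in> W" using wxU Wi by blast
    then have "inv w \<otimes> (w \<otimes> x) \<in> W" using sub_m[OF normal_inD(2)[OF W]] sub_i[OF normal_inD(2)[OF W]] w by blast
    then show False using x wc xc by simp
  qed
  then show ?thesis using W unfolding L_def by simp
qed

text \<open>A conjugate of \<open>P\<close> under \<open>U\<close> stays inside the normal subgroup
  \<open>P M\<close>, where Sylow subgroups are conjugate; correcting by an element of
  \<open>P M\<close> leaves an element of the normalizer.\<close>

lemma frattini:
  assumes M: "normal_in M U" and p: "Factorial_Ring.prime p" and P: "is_sylow p U P" and L: "normal_in (P <#> M) U"
  shows "{x \<in> U. cjs x P = P} <#> M = U"
proof -
  note m = normal_inD[OF M]
  have P': "subgroup P G" "P \<subseteq> U" "card P = p ^ multiplicity p (card U)" using P unfolding is_sylow_def by auto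
  have Pc: "P \<subseteq> carrier G" using P' subgroup.subset by blast
  define N where "N = {x \<in> U. cjs x P = P}"
  have Ni: "x \<in> N \<longleftrightarrow> x \<in> U \<and> cjs x P = P" for x unfolding N_def by simp
  have N: "normal_in P N" using normal_in_stab[OF m(2) P'(1,2)] unfolding N_def .
  have Uc: "x \<in> carrier G" if "x \<in> U" for x using that m subgroupD by blast
  have PL: "P \<subseteq> P <#> M" using prod_normal_in(2)[OF M P'(1,2)] .
  have sy: "is_sylow p (P <#> M) P" using is_sylow_between[OF p P normal_inD(1)[OF L] PL normal_inD(3)[OF L] m(2)] .
  have "x \<in> N <#> M" if x: "x \<in> U" for x
  proof -
    have xc: "x \<in> carrier G" and xi: "inv x \<in> U" "inv x \<in> carrier G" using x Uc sub_i[OF m(2)] by auto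
    have "cjs (inv x) P \<subseteq> P <#> M" using PL normal_inD(4)[OF L xi(1)] by blast
    from is_sylow_contains_conj[OF p sy normal_inD(1)[OF L] cjs_subgroup[OF xi(2) P'(1)] this]
    obtain l where l: "l \<in> P <#> M" "cjs l (cjs (inv x) P) \<subseteq> P" using trans[OF card_cjs[OF xi(2) Pc] P'(3)] by blast
    have lU: "l \<in> U" using l normal_inD(3)[OF L] by blast
    have lc: "l \<in> carrier G" using lU Uc by simp
    have "cjs (l \<otimes> inv x) P \<subseteq> P" using l cjs_cjs[of l "inv x" P] lc xc Pc by simp
    then have "cjs (l \<otimes> inv x) P = P" by (rule cjs_sub_eq[OF m_closed[OF lc xi(2)] Pc])
    then have "l \<otimes> inv x \<in> N" using lU xi sub_m[OF m(2)] Ni by blast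
    then have i: "inv (l \<otimes> inv x) \<in> N" using sub_i[OF normal_inD(2)[OF N]] by blast
    obtain q k where q: "q \<in> P" "k \<in> M" "l = q \<otimes> k" using l(1) by (rule mult_memE)
    have qc: "q \<in> carrier G" "k \<in> carrier G" using q Pc m subgroupD by blast+
    have "x = (inv (l \<otimes> inv x) \<otimes> q) \<otimes> k" using xc lc qc q(3) by (simp add: word)
    moreover have "inv (l \<otimes> inv x) \<otimes> q \<in> N" using i q normal_inD(3)[OF N] sub_m[OF normal_inD(2)[OF N]] by blast
    ultimately show ?thesis using mult_memI[OF _ q(2)] by metis
  qed
  moreover have "N <#> M \<subseteq> U" by (rule prod_subset[OF m(2) _ m(3)]) (simp add: N_def)
  ultimately show ?thesis unfolding N_def by blast
qed

section \<open>Nilpotency from normal Sylow subgroups, and nilpotent supplements\<close>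

text \<open>Each full prime power of \<open>card U\<close> divides \<open>card D\<close>, so the two
  orders agree.\<close>

lemma all_is_sylow_subset:
  assumes D: "subgroup D G" "D \<subseteq> U" and U: "subgroup U G"
    and all: "\<And>p. Factorial_Ring.prime p \<Longrightarrow> \<exists>P. is_sylow p U P \<and> P \<subseteq> D"
  shows "D = U"
proof -
  have "card U dvd card D"
  proof (rule multiplicity_le_imp_dvd)
    show "card U \<noteq> 0" using card_sub_pos[OF U] by simp
    fix p :: nat assume p: "Factorial_Ring.prime p"
    then obtain P where "is_sylow p U P" "P \<subseteq> D" using all by blast
    then have "is_sylow p D P" using is_sylow_between[OF p _ D(1) _ D(2) U] by blast
    then show "multiplicity p (card U) \<le> multiplicity p (card D)"
      using \<open>is_sylow p U P\<close> p unfolding is_sylow_def by (metis order_refl power_inject_exp prime_gt_1_nat)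
  qed
  then have "card U \<le> card D" using card_sub_pos[OF D(1)] by (simp add: dvd_imp_le)
  then show ?thesis using D(2) fin_sub[OF U] by (simp add: card_seteq)
qed

lemma upper_central_stable:
  assumes M: "normal_in M U"
  shows "\<exists>n. upper_central U M (Suc n) = upper_central U M n"
proof (rule ccontr)
  assume neg: "\<nexists>n. upper_central U M (Suc n) = upper_central U M n"
  have fU: "finite (upper_central U M n)" for n using upper_central_normal_in[OF M] normal_inD(1) fin_sub by blast
  have "n \<le> card (upper_central U M n)" for n
  proof (induction n)
    case (Suc n)
    have "upper_central U M n \<subset> upper_central U M (Suc n)" using upper_central_props[OF M, of n] neg by blast
    then have "card (upper_central U M n) < card (upper_central U M (Suc n))" using fU psubset_card_mono by blast
    then show ?case using Suc by linarith
  qed simp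
  moreover have "card (upper_central U M n) \<le> card U" for n
    using upper_central_normal_in[OF M, of n] normal_inD fin_sub card_mono by metis
  ultimately show False by (metis Suc_n_not_le_n order_trans)
qed

text \<open>\<open>Z\<close> is the hypercenter, where the upper central series stops growing. If it
  is proper, some Sylow subgroup \<open>P\<close> is not inside it, and the \<open>p\<close>-group
  \<open>P\<close> fixes under conjugation a nontrivial coset \<open>D x\<close> of
  \<open>D = Z \<inter> P\<close>. So \<open>[x, P]\<close> lies in \<open>Z\<close>, Sylow
  subgroups for other primes commute with \<open>x\<close>, and \<open>x\<close> belongs to the next
  term of the series, a contradiction.\<close>

lemma all_is_sylow_normal_nilpotent_mod:
  assumes U: "subgroup U G" and all: "\<And>p P. Factorial_Ring.prime p \<Longrightarrow> is_sylow p U P \<Longrightarrow> normal_in P U"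
  shows "nilpotent_mod U {\<one>}"
proof -
  have M: "normal_in {\<one>} U" using normal_in_one[OF U] .
  obtain n where n: "upper_central U {\<one>} (Suc n) = upper_central U {\<one>} n" using upper_central_stable[OF M] by blast
  define Z where "Z = upper_central U {\<one>} n"
  have Z: "normal_in Z U" unfolding Z_def using upper_central_normal_in[OF M] .
  note z = normal_inD[OF Z]
  have Uc: "x \<in> carrier G" if "x \<in> U" for x using that U subgroupD by blast
  have "Z = U"
  proof (rule ccontr)
    assume "Z \<noteq> U"
    then obtain p where p: "Factorial_Ring.prime p" "\<nexists>P. is_sylow p U P \<and> P \<subseteq> Z" using all_is_sylow_subset[OF z(1,3) U] by blast
    obtain P where P: "is_sylow p U P" using is_sylow_ex[OF p(1) U] by blast
    then have PZ: "\<not> P \<subseteq> Z" using p by blast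
    have P': "subgroup P G" "P \<subseteq> U" "card P = p ^ multiplicity p (card U)" using P unfolding is_sylow_def by auto
    have Pn: "normal_in P U" using all p P by blast
    define D where "D = Z \<inter> P"
    have D: "normal_in D P" unfolding D_def using normal_in_restrict[OF Z P'(1,2)] .
    note d = normal_inD[OF D]
    have Dc: "D \<subseteq> carrier G" using d(1) subgroup.subset by blast
    have Pc: "x \<in> carrier G" if "x \<in> P" for x using that P' Uc by blast
    let ?E = "rcosets\<^bsub>G\<lparr>carrier := P\<rparr>\<^esub> D"
    have Ei: "?E = {D #> x | x. x \<in> P}" unfolding RCOSETS_def by auto
    have finE: "finite ?E" using Ei fin_sub[OF P'(1)] by simp
    have cE: "card ?E * card D = card P" using lagrange_sub[OF d(1) P'(1) d(3)] .
    have "card ?E \<noteq> 1"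
    proof
      assume "card ?E = 1"
      then have "card D = card P" using cE by simp
      then have "D = P" using d(3) fin_sub[OF P'(1)] by (simp add: card_subset_eq)
      then show False using PZ unfolding D_def by blast
    qed
    moreover have "card ?E dvd p ^ multiplicity p (card U)" using cE P'(3) by (metis dvd_triv_left)
    then obtain i where "card ?E = p ^ i" using p(1) divides_primepow_nat by blast
    ultimately have pE: "p dvd card ?E" by (cases i) auto
    have cjc: "cjs g (D #> x) = D #> cj g x" if g: "g \<in> P" and x: "x \<in> P" for g x
    proof -
      have 1: "cj g (y \<otimes> x) = cj g y \<otimes> cj g x" if "y \<in> D" for y using that cj_mult Pc g x Dc by blast
      have 2: "cjs g D = D" using normal_in_cjs[OF D g] .
      have "cjs g (D #> x) = (\<lambda>y. y \<otimes> cj g x) ` (cjs g D)" using 1 unfolding r_coset_def by (force simp: image_iff)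
      also have "\<dots> = D #> cj g x" unfolding 2 r_coset_def by blast
      finally show ?thesis .
    qed
    have cg: "[card {w \<in> ?E. \<forall>g\<in>P. cjs g w = w} = card ?E] (mod p)"
    proof (rule fixed_points[OF p(1) P'(1,3) finE])
      fix g w assume g: "g \<in> P" and w: "w \<in> ?E"
      then obtain x where x: "x \<in> P" "w = D #> x" using Ei by blast
      then show "cjs g w \<in> ?E" using cjc[OF g x(1)] Ei cj_in_subgroup[OF P'(1) g x(1)] by blast
      fix h assume "h \<in> P"
      then show "cjs (g \<otimes> h) w = cjs g (cjs h w)" using cjs_cjs Pc g x r_coset_subset_G[OF Dc] by auto
    next
      fix w assume "w \<in> ?E"
      then obtain x where x: "x \<in> P" "w = D #> x" using Ei by blast
      then show "cjs \<one> w = w" using r_coset_subset_G[OF Dc] Pc by simp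
    qed
    define F where "F = {w \<in> ?E. \<forall>g\<in>P. cjs g w = w}"
    have pF: "p dvd card F" using cong_dvd_iff[OF cg] pE unfolding F_def by (rule iffD2)
    have DF: "D \<in> F"
    proof -
      have "D = D #> \<one>" using Dc by simp
      then have "D \<in> ?E" using Ei sub_1[OF P'(1)] by blast
      then show ?thesis using normal_in_cjs[OF D] unfolding F_def by simp
    qed
    \<comment> \<open>\<open>D\<close> itself is fixed, and \<open>p\<close> divides the number of
      fixed cosets, so there is a second one.\<close>
    have "card F \<noteq> 1" using pF p(1) by auto
    then have "F \<noteq> {D}" by auto
    then obtain w where w: "w \<in> F" "w \<noteq> D" using DF by blast
    then have wF: "w \<in> ?E" "\<And>g. g \<in> P \<Longrightarrow> cjs g w = w" unfolding F_def by auto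
    then obtain x where x: "x \<in> P" "w = D #> x" using Ei by blast
    have xZ: "x \<notin> Z" using w x coset_join2[OF _ d(1), of x] Pc unfolding D_def by auto
    have xg: "commutator x g \<in> Z" if g: "g \<in> P" for g
    proof -
      have c: "g \<in> carrier G" "x \<in> carrier G" using g x Pc by auto
      have "D #> cj g x = D #> x" using wF(2)[OF g] cjc[OF g x(1)] unfolding x(2) by simp
      then have "cj g x \<in> D #> x" using rcos_self[of "cj g x" D] c d by simp
      then obtain q where q: "q \<in> D" "cj g x = q \<otimes> x" unfolding r_coset_def by blast
      have qc: "q \<in> carrier G" using q Dc by blast
      have "commutator g x = cj g x \<otimes> inv x" using c by (simp add: word)
      also have "\<dots> = q" using q c qc by (simp add: m_assoc)
      finally have "commutator x g = inv q" using commutator_swap[of g x] c by simp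
      then show ?thesis using q sub_i[OF z(1)] unfolding D_def by simp
    qed
    have xU: "x \<in> U" using x P' by blast
    \<comment> \<open>A subgroup, because \<open>Z\<close> is normal; therefore one Sylow subgroup
      for each prime decides that it is all of \<open>U\<close>.\<close>
    let ?C = "{u \<in> U. commutator x u \<in> Z}"
    have C: "subgroup ?C G"
    proof (rule subgroupI)
      show "?C \<subseteq> carrier G" using Uc by blast
      have "commutator x \<one> = \<one>" using Uc[OF xU] by (simp add: word)
      then show "?C \<noteq> {}" using sub_1[OF U] sub_1[OF z(1)] by force
      fix a assume a: "a \<in> ?C"
      have "commutator x (inv a) = cj (inv a) (inv (commutator x a))" using a Uc xU by (simp add: word)
      also have "\<dots> \<in> Z" by (rule z(4)) (use a sub_i[OF U] sub_i[OF z(1)] in auto)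
      finally show "inv a \<in> ?C" using a sub_i[OF U] by blast
      fix b assume b: "b \<in> ?C"
      have "commutator x (a \<otimes> b) = commutator x a \<otimes> cj a (commutator x b)" using a b Uc xU by (simp add: word)
      also have "\<dots> \<in> Z" by (rule sub_m[OF z(1)]) (use a b z(4) in auto)
      finally show "a \<otimes> b \<in> ?C" using a b sub_m[OF U] by blast
    qed
    have "?C = U"
    proof (rule all_is_sylow_subset[OF C _ U])
      show "?C \<subseteq> U" by blast
      fix q :: nat assume q: "Factorial_Ring.prime q"
      show "\<exists>P. is_sylow q U P \<and> P \<subseteq> ?C"
      proof (cases "q = p")
        case True then show ?thesis using P xg P'(2) by blast
      next
        case False
        obtain Q where Q: "is_sylow q U Q" using is_sylow_ex[OF q U] by blast
        then have Q': "subgroup Q G" "Q \<subseteq> U" "card Q = q ^ multiplicity q (card U)" unfolding is_sylow_def by auto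
        have Qn: "normal_in Q U" using all q Q by blast
        have PQ: "subgroup (P \<inter> Q) G" using subgroups_Inter_pair P' Q' by blast
        have "card (P \<inter> Q) dvd card P" "card (P \<inter> Q) dvd card Q" using card_sub_dvd PQ P' Q' by blast+
        moreover have "coprime (card P) (card Q)" using P'(3) Q'(3) p(1) q False by (simp add: primes_coprime)
        ultimately have "card (P \<inter> Q) = 1" using coprime_common_divisor_nat[of "card P" "card Q" "card (P \<inter> Q)"] by blast
        then obtain e where "P \<inter> Q = {e}" by (rule card_1_singletonE)
        then have one: "P \<inter> Q = {\<one>}" using sub_1[OF PQ] by (metis singletonD)
        have "commutator x g \<in> Z" if g: "g \<in> Q" for g
        proof -
          have gU: "g \<in> U" using g Q' by blast
          have "commutator x g \<in> P" using commutator_memI[OF Pn x(1) gU] .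
          moreover have "commutator x g \<in> Q" using commutator_memI[OF Qn g xU] commutator_swap[of g x] Uc gU xU sub_i[OF Q'(1)] by metis
          ultimately have "commutator x g = \<one>" using one by blast
          then show ?thesis using sub_1[OF z(1)] by simp
        qed
        then show ?thesis using Q Q' by blast
      qed
    qed
    then have "x \<in> upper_central U {\<one>} (Suc n)" using xU unfolding Z_def by auto
    then show False using xZ unfolding n Z_def by contradiction
  qed
  then show ?thesis unfolding nilpotent_mod_def Z_def by blast
qed

text \<open>The recursion passes to a proper supplement of \<open>M\<close> while there is one. If
  there is none, the Frattini argument makes the normalizer of every Sylow subgroup a supplement,
  hence all of \<open>U\<close>; then all Sylow subgroups are normal and \<open>U\<close> itself is
  nilpotent.\<close>

theorem nilpotent_mod_lift:
  assumes "normal_in M U" "nilpotent_mod U M"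
  shows "\<exists>R. subgroup R G \<and> R \<subseteq> U \<and> nilpotent_mod R {\<one>} \<and> R <#> M = U"
  using assms
proof (induction "card U" arbitrary: U M rule: less_induct)
  case less
  note M = less.prems(1) and n = less.prems(2)
  note m = normal_inD[OF M]
  show ?case
  proof (cases "\<exists>V. subgroup V G \<and> V \<subset> U \<and> V <#> M = U")
    case True
    then obtain V where V: "subgroup V G" "V \<subset> U" "V <#> M = U" by blast
    have "card V < card U" using V fin_sub[OF m(2)] psubset_card_mono by blast
    moreover have "normal_in (M \<inter> V) V" using normal_in_restrict[OF M V(1)] V by blast
    moreover have "nilpotent_mod V (M \<inter> V)" using nilpotent_mod_sub[OF n _ V(1)] V by blast
    ultimately obtain R where R: "subgroup R G" "R \<subseteq> V" "nilpotent_mod R {\<one>}" "R <#> (M \<inter> V) = V" using less.hyps by blast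
    have "u \<in> R <#> M" if u: "u \<in> U" for u
    proof -
      have "u \<in> V <#> M" using u V by simp
      then obtain v k where v: "v \<in> V" "k \<in> M" "u = v \<otimes> k" by (rule mult_memE)
      then have "v \<in> R <#> (M \<inter> V)" using R by simp
      then obtain r l where r: "r \<in> R" "l \<in> M" "v = r \<otimes> l" by (blast elim: mult_memE)
      have "u = r \<otimes> (l \<otimes> k)" using v r R(1) m(1) subgroupD by (simp add: m_assoc)
      then show ?thesis using r v sub_m[OF m(1)] mult_memI by metis
    qed
    moreover have "R <#> M \<subseteq> U" using prod_subset[OF m(2) _ m(3)] R V by blast
    ultimately show ?thesis using R V by blast
  next
    case False
    have "nilpotent_mod U {\<one>}"
    proof (rule all_is_sylow_normal_nilpotent_mod[OF m(2)])
      fix p P assume p: "Factorial_Ring.prime p" and P: "is_sylow p U P"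
      have P': "subgroup P G" "P \<subseteq> U" using P unfolding is_sylow_def by auto
      let ?N = "{x \<in> U. cjs x P = P}"
      have N: "normal_in P ?N" using normal_in_stab[OF m(2) P'] .
      have "?N <#> M = U" using frattini[OF M p P nilpotent_mod_is_sylow_normal[OF M n p P]] .
      then have "?N = U" using False normal_inD(2)[OF N] by blast
      then show "normal_in P U" using N by simp
    qed
    moreover have "U <#> M = U" using prod_normal_in(2)[OF M m(2)] prod_subset[OF m(2) _ m(3)] by blast
    ultimately show ?thesis using m(2) by blast
  qed
qed

end

context fin_group begin

subsection \<open>Carter subgroups of metanilpotent sections\<close>

lemma carter_modD:
  assumes "carter_mod U M K"
  shows "subgroup K G" "M \<subseteq> K" "K \<subseteq> U" "nilpotent_mod K M" "x \<in> U \<Longrightarrow> cjs x K = K \<Longrightarrow> x \<in> K"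
  using assms unfolding carter_mod_def by auto

lemma nilpotent_mod_self_normalizing:
  assumes n: "nilpotent_mod U M" and M: "normal_in M U" and K: "subgroup K G" "M \<subseteq> K" "K \<subseteq> U"
    and s: "\<And>x. x \<in> U \<Longrightarrow> cjs x K = K \<Longrightarrow> x \<in> K"
  shows "K = U"
proof (rule ccontr)
  assume "K \<noteq> U"
  from nilpotent_mod_normalizer[OF M n K this] obtain x where "x \<in> U - K" "cjs x K = K" ..
  then show False using s[of x] by blast
qed

lemma carter_mod_nilpotent_mod: "carter_mod U M K \<Longrightarrow> nilpotent_mod U M \<Longrightarrow> normal_in M U \<Longrightarrow> K = U"
  by (rule nilpotent_mod_self_normalizing) (blast dest: carter_modD)+

lemma carter_mod_restrict: "carter_mod U M K \<Longrightarrow> K \<subseteq> Y \<Longrightarrow> Y \<subseteq> U \<Longrightarrow> carter_mod Y M K"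
  unfolding carter_mod_def by auto

lemma carter_mod_refl: "nilpotent_mod U M \<Longrightarrow> normal_in M U \<Longrightarrow> carter_mod U M U"
  unfolding carter_mod_def normal_in_def by auto

lemma nilpotent_mod_cjs:
  assumes x: "x \<in> carrier G" and "nilpotent_mod K M" "K \<subseteq> carrier G" "M \<subseteq> carrier G"
  shows "nilpotent_mod (cjs x K) (cjs x M)"
  using group_hom.nilpotent_mod_image[OF cj_hom[OF x]] assms by blast

lemma carter_mod_cjs:
  assumes x: "x \<in> carrier G" and K: "carter_mod U M K" and U: "subgroup U G"
  shows "carter_mod (cjs x U) (cjs x M) (cjs x K)"
proof -
  note k = carter_modD[OF K]
  have Kc: "K \<subseteq> carrier G" "M \<subseteq> carrier G" using k subgroup.subset by blast+
  have Uc: "U \<subseteq> carrier G" using U subgroup.subset by blast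
  have "y \<in> cjs x K" if y: "y \<in> cjs x U" "cjs y (cjs x K) = cjs x K" for y
  proof -
    obtain u where u: "u \<in> U" "y = cj x u" using y by blast
    have uc: "u \<in> carrier G" using u Uc by blast
    have "y \<otimes> x = x \<otimes> u" using u uc x by (simp add: word)
    then have "cjs (x \<otimes> u) K = cjs x K" using y(2) cjs_cjs[of y x K] u uc x Kc by simp
    then have "cjs x (cjs u K) = cjs x K" using cjs_cjs[OF x uc Kc(1)] by simp
    then have "cjs (inv x) (cjs x (cjs u K)) = cjs (inv x) (cjs x K)" by simp
    then have "cjs u K = K" using x uc Kc cjs_closed[OF uc Kc(1)] by simp
    then show ?thesis using k(5) u by blast
  qed
  moreover have "nilpotent_mod (cjs x K) (cjs x M)" using nilpotent_mod_cjs[OF x k(4) Kc] .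
  ultimately show ?thesis using cjs_subgroup[OF x k(1)] k(2,3) unfolding carter_mod_def by blast
qed

lemma carter_mod_cjs_in:
  assumes x: "x \<in> U" and K: "carter_mod U M K" and M: "normal_in M U"
  shows "carter_mod U M (cjs x K)"
  using carter_mod_cjs[OF subgroupD[OF normal_inD(2)[OF M] x] K normal_inD(2)[OF M]] normal_in_cjs[OF M x] cjs_self[OF normal_inD(2)[OF M] x] by simp

text \<open>What normalizes \<open>K\<close> also normalizes \<open>K B = L\<close> and therefore
  lies in \<open>L\<close>; after that only the property of \<open>K\<close> inside \<open>L\<close>
  is at stake.\<close>

lemma carter_mod_trans:
  assumes L: "carter_mod U B L" and K: "carter_mod L M K" and KB: "K <#> B = L" and B: "normal_in B U"
  shows "carter_mod U M K"
proof -
  note l = carter_modD[OF L] and k = carter_modD[OF K] and b = normal_inD[OF B]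
  have "x \<in> K" if x: "x \<in> U" "cjs x K = K" for x
  proof -
    have xc: "x \<in> carrier G" using x b subgroupD by blast
    have "cjs x L = cjs x K <#> cjs x B" 
      using cjs_prod[OF xc subgroup.subset[OF k(1)] subgroup.subset[OF b(1)]] KB by simp
    also have "\<dots> = L" using x(2) normal_in_cjs[OF B x(1)] KB by simp
    finally have "x \<in> L" using l(5) x by blast
    then show ?thesis using k(5) x by blast
  qed
  then show ?thesis using k l unfolding carter_mod_def by blast
qed

text \<open>Frattini argument for Carter subgroups: if \<open>x\<close> normalizes
  \<open>K B\<close>, then \<open>cjs x K\<close> is a Carter subgroup of \<open>K B\<close>, so
  some \<open>y\<close> in \<open>K B\<close> has the same effect on \<open>K\<close>, and
  \<open>inv y x\<close> normalizes \<open>K\<close>. This is the step that ties existence in a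
  quotient to conjugacy.\<close>

lemma carter_mod_prod:
  assumes B: "normal_in B U" and M: "normal_in M U" and MB: "M \<subseteq> B" and K: "carter_mod U M K"
    and conj: "\<And>K'. carter_mod (K <#> B) M K' \<Longrightarrow> \<exists>x\<in>K <#> B. K' = cjs x K"
  shows "carter_mod U B (K <#> B)"
proof -
  note k = carter_modD[OF K] and b = normal_inD[OF B]
  define L where "L = K <#> B"
  note p = prod_normal_in[OF B k(1,3), folded L_def]
  have Kc: "K \<subseteq> carrier G" using k subgroup.subset by blast
  have "nilpotent_mod L B" unfolding L_def using nilpotent_mod_mult[OF B k(1,3,4) MB] .
  moreover have "x \<in> L" if x: "x \<in> U" "cjs x L = L" for x
  proof -
    have xc: "x \<in> carrier G" using x b subgroupD by blast
    have "carter_mod (cjs x L) (cjs x M) (cjs x K)" by (rule carter_mod_cjs[OF xc carter_mod_restrict[OF K p(2,4)] p(1)])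
    then have "carter_mod L M (cjs x K)" using x(2) normal_in_cjs[OF M x(1)] by simp
    then obtain y where y: "y \<in> L" "cjs x K = cjs y K" using conj unfolding L_def by blast
    have yc: "y \<in> carrier G" "y \<in> U" using y p(1,4) subgroupD by blast+
    have "cjs (inv y) (cjs x K) = K" unfolding y(2) using yc Kc by simp
    then have "cjs (inv y \<otimes> x) K = K" using cjs_cjs[of "inv y" x K] yc xc Kc by simp
    moreover have "inv y \<otimes> x \<in> U" using yc x sub_i[OF b(2)] sub_m[OF b(2)] by blast
    ultimately have "inv y \<otimes> x \<in> L" using k(5) p(2) by blast
    then have "y \<otimes> (inv y \<otimes> x) \<in> L" using y sub_m[OF p(1)] by blast
    then show ?thesis using xc yc by simp
  qed
  ultimately show ?thesis using p unfolding carter_mod_def L_def by blast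
qed

section \<open>Existence of Carter subgroups in metanilpotent sections\<close>

text \<open>Take \<open>K\<close> of largest order among the supplements of \<open>B\<close> that
  are nilpotent modulo \<open>M\<close>; one exists by \<open>nilpotent_mod_lift\<close>. Its
  normalizer \<open>N\<close> equals \<open>K (B \<inter> N)\<close>, and
  \<open>B \<inter> N\<close> is hypercentral in \<open>N\<close>, because its commutators with
  \<open>K\<close> fall into \<open>K \<inter> B\<close>. So \<open>N\<close> is again such a
  supplement and equals \<open>K\<close>.\<close>

lemma carter_mod_ex_abelian:
  assumes M: "normal_in M U" and B: "normal_in B U" and MB: "M \<subseteq> B" and ab: "\<And>b c. b \<in> B \<Longrightarrow> c \<in> B \<Longrightarrow> commutator b c \<in> M"
    and n: "nilpotent_mod U B"
  shows "\<exists>K. carter_mod U M K \<and> K <#> B = U"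
proof -
  note b = normal_inD[OF B] and m = normal_inD[OF M]
  define Q where "Q = (\<lambda>K. subgroup K G \<and> M \<subseteq> K \<and> K \<subseteq> U \<and> nilpotent_mod K M \<and> K <#> B = U)"
  obtain R where R: "subgroup R G" "R \<subseteq> U" "nilpotent_mod R {\<one>}" "R <#> B = U" using nilpotent_mod_lift[OF B n] by blast
  note p = prod_normal_in[OF M R(1,2)]
  have "{\<one>} \<subseteq> M" using sub_1[OF m(1)] by simp
  then have n1: "nilpotent_mod (R <#> M) M" using nilpotent_mod_mult[OF M R(1,2,3)] by blast
  have sup: "K <#> B = U" if "R' \<subseteq> K" "K \<subseteq> U" "R' <#> B = U" for K R'
  proof
    show "K <#> B \<subseteq> U" using prod_subset[OF b(2) that(2) b(3)] .
    show "U \<subseteq> K <#> B" using mono_set_mult[OF that(1) order_refl, of G B] that(3) by simp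
  qed
  have "Q (R <#> M)" unfolding Q_def using p n1 sup[OF p(2,4) R(4)] by blast
  moreover have "card K \<le> card U" if "Q K" for K using that card_mono[OF fin_sub[OF b(2)]] unfolding Q_def by blast
  ultimately obtain K where K: "Q K" "\<And>L. Q L \<Longrightarrow> card L \<le> card K"
    using ex_has_greatest_nat[of Q "R <#> M" card "Suc (card U)"] by (metis le_imp_less_Suc)
  have k: "subgroup K G" "M \<subseteq> K" "K \<subseteq> U" "nilpotent_mod K M" "K <#> B = U" using K(1) unfolding Q_def by auto
  define N where "N = {x \<in> U. cjs x K = K}"
  have N: "normal_in K N" using normal_in_stab[OF b(2) k(1,3)] unfolding N_def .
  have NU: "N \<subseteq> U" unfolding N_def by blast
  note nn = normal_inD[OF N]
  have Uc: "x \<in> carrier G" if "x \<in> U" for x using that b subgroupD by blast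
  have decomp: "\<exists>k\<in>K. \<exists>c\<in>B \<inter> N. x = k \<otimes> c" if "x \<in> N" for x
    using dedekind[OF k(1) nn(2,3) _ that subgroup.subset[OF b(1)]] that NU k(5) by (blast elim: mult_memE)
  have cm: "commutator d (k \<otimes> c) = commutator d k \<otimes> cj k (commutator d c)" if "d \<in> U" "k \<in> U" "c \<in> U" for d k c
    using that Uc by (simp add: word)
  have D: "normal_in (B \<inter> N) N" using normal_in_restrict[OF B nn(2) NU] .
  have MN: "normal_in M N" using normal_in_sub[OF M nn(2) _ NU] k(2) nn(3) by blast
  \<comment> \<open>\<open>B \<inter> N\<close> acts trivially on \<open>B\<close> modulo
    \<open>M\<close>, so on elements of \<open>B\<close> only the \<open>K\<close>-part of
    \<open>N = K (B \<inter> N)\<close> counts.\<close>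
  have W: "upper_central K M i \<inter> B \<subseteq> upper_central N M i" for i
  proof (induction i)
    case (Suc i)
    show ?case
    proof
      fix z assume z: "z \<in> upper_central K M (Suc i) \<inter> B"
      then have zK: "z \<in> K" "z \<in> B" by auto
      have "commutator z x \<in> upper_central N M i" if x: "x \<in> N" for x
      proof -
        obtain l c where l: "l \<in> K" "c \<in> B \<inter> N" "x = l \<otimes> c" using decomp[OF x] by blast
        have "commutator z l \<in> upper_central K M i" using z l by auto
        moreover have "commutator z l \<in> B" using commutator_memI[OF B zK(2)] l k by blast
        ultimately have 1: "commutator z l \<in> upper_central N M i" using Suc by blast
        have "commutator z c \<in> M" using ab zK l by blast
        then have "cj l (commutator z c) \<in> upper_central N M i" using normal_inD(4)[OF MN] l nn(3) upper_central_base[OF MN] by blast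
        then have "commutator z l \<otimes> cj l (commutator z c) \<in> upper_central N M i" by (rule sub_m[OF normal_inD(1)[OF upper_central_normal_in[OF MN]] 1])
        moreover have "commutator z x = commutator z l \<otimes> cj l (commutator z c)" unfolding l(3) using zK l k b(3) by (intro cm) auto
        ultimately show ?thesis by simp
      qed
      then show "z \<in> upper_central N M (Suc i)" using zK nn(3) by auto
    qed
  qed simp
  obtain i where i: "K \<subseteq> upper_central K M i" using k(4) unfolding nilpotent_mod_def by blast
  \<comment> \<open>One level above \<open>i\<close>: an element of \<open>B \<inter> N\<close> need
    not lie in \<open>K\<close>, but its commutators with \<open>K\<close> do.\<close>
  have "B \<inter> N \<subseteq> upper_central N M (Suc i)"
  proof
    fix d assume d: "d \<in> B \<inter> N"
    have "commutator d x \<in> upper_central N M i" if x: "x \<in> N" for x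
    proof -
      obtain l c where l: "l \<in> K" "c \<in> B \<inter> N" "x = l \<otimes> c" using decomp[OF x] by blast
      have c: "d \<in> carrier G" "l \<in> carrier G" using d l Uc NU k(3) by blast+
      have "cj d l \<in> K" using nn(4) d l by blast
      then have "cj d l \<otimes> inv l \<in> K" using l sub_i[OF k(1)] sub_m[OF k(1)] by blast
      then have 1: "commutator d l \<in> K" using c by (simp add: word)
      have "commutator d l \<in> B" using commutator_memI[OF B] d l k by blast
      then have 2: "commutator d l \<in> upper_central N M i" using W i 1 by blast
      have "commutator d c \<in> M" using ab d l by blast
      then have "cj l (commutator d c) \<in> upper_central N M i" using normal_inD(4)[OF MN] l nn(3) upper_central_base[OF MN] by blast
      then have "commutator d l \<otimes> cj l (commutator d c) \<in> upper_central N M i" by (rule sub_m[OF normal_inD(1)[OF upper_central_normal_in[OF MN]] 2])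
      moreover have "commutator d x = commutator d l \<otimes> cj l (commutator d c)" unfolding l(3) using d l k b(3) by (intro cm) auto
      ultimately show ?thesis by simp
    qed
    then show "d \<in> upper_central N M (Suc i)" using d by simp
  qed
  moreover have "K <#> (B \<inter> N) = N"
  proof
    show "K <#> (B \<inter> N) \<subseteq> N" using prod_subset[OF nn(2,3)] by blast
    show "N \<subseteq> K <#> (B \<inter> N)" using decomp mult_memI by blast
  qed
  then have "nilpotent_mod N (B \<inter> N)" using nilpotent_mod_mult[OF D nn(1,3) k(4)] k(2) nn(3) MB by auto
  ultimately have "nilpotent_mod N M" using nilpotent_mod_ext by blast
  then have "Q N" unfolding Q_def using nn(2) normal_inD(3)[OF MN] NU sup[OF nn(3) NU k(5)] by blast
  then have "card N \<le> card K" using K by blast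
  then have "K = N" using nn(3) fin_sub[OF nn(2)] by (simp add: card_seteq)
  then have "x \<in> K" if "x \<in> U" "cjs x K = K" for x using that unfolding N_def by blast
  then show ?thesis using k unfolding carter_mod_def by blast
qed

text \<open>The terms of the upper central series are characteristic in the section of
  \<open>E\<close> over \<open>M\<close>.\<close>

lemma upper_central_normal_in_outer:
  assumes M: "normal_in M U" and E: "normal_in E U" and ME: "M \<subseteq> E"
  shows "normal_in (upper_central E M n) U"
proof (induction n)
  case (Suc n)
  note e = normal_inD[OF E]
  have M': "normal_in M E" using normal_in_sub[OF M e(1) ME e(3)] .
  note z = normal_inD[OF upper_central_normal_in[OF M', of "Suc n"]]
  have Uc: "x \<in> carrier G" if "x \<in> U" for x using that e subgroupD by blast
  have "cj u y \<in> upper_central E M (Suc n)" if u: "u \<in> U" and y: "y \<in> upper_central E M (Suc n)" for u y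
  proof -
    have yE: "y \<in> E" using y by simp
    have "commutator (cj u y) x \<in> upper_central E M n" if x: "x \<in> E" for x
    proof -
      have c: "u \<in> carrier G" "x \<in> carrier G" "y \<in> carrier G" using u x yE Uc e(3) by blast+
      have "cj (inv u) x \<in> E" using e(4) sub_i[OF e(2)] u x by blast
      then have "commutator y (cj (inv u) x) \<in> upper_central E M n" using y by auto
      then have "cj u (commutator y (cj (inv u) x)) \<in> upper_central E M n" using normal_inD(4)[OF Suc u] by blast
      then show ?thesis using c by (simp add: cj_commutator)
    qed
    then show ?thesis using e(4)[OF u yE] by simp
  qed
  then show ?case using z e unfolding normal_in_def by blast
qed (simp add: M)

text \<open>Induction on the class of \<open>E\<close> modulo \<open>M\<close>. The center
  \<open>B\<close> of that section is divided out first; a Carter subgroup \<open>L\<close> modulo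
  \<open>B\<close> is then refined inside \<open>L\<close>, where \<open>B\<close> is an abelian
  normal section with nilpotent quotient.\<close>

theorem metanil_carter_mod_ex:
  assumes "normal_in M U" "normal_in E U" "M \<subseteq> E" "nilpotent_mod E M" "nilpotent_mod U E"
  shows "\<exists>K. carter_mod U M K"
proof -
  obtain n where "E \<subseteq> upper_central E M n" using assms unfolding nilpotent_mod_def by blast
  then show ?thesis using assms(1,3)
  proof (induction n arbitrary: M)
    case 0
    then have "E = M" by simp
    then show ?case using carter_mod_refl assms(5) 0 by blast
  next
    case (Suc n)
    define B where "B = upper_central E M (Suc 0)"
    have B: "normal_in B U" unfolding B_def using upper_central_normal_in_outer[OF Suc.prems(2) assms(2) Suc.prems(3)] .
    have ME: "normal_in M E" using normal_in_sub[OF Suc.prems(2) normal_inD(1)[OF assms(2)] Suc.prems(3) normal_inD(3)[OF assms(2)]] .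
    have MB: "M \<subseteq> B" unfolding B_def using upper_central_base[OF ME] .
    have BE: "B \<subseteq> E" unfolding B_def by auto
    have "E \<subseteq> upper_central E B n" using Suc.prems(1) upper_central_add[of E M "Suc 0" n] unfolding B_def by simp
    from Suc.IH[OF this B BE] obtain L where L: "carter_mod U B L" by blast
    note l = carter_modD[OF L]
    have "normal_in M L" using normal_in_sub[OF Suc.prems(2) l(1) _ l(3)] MB l(2) by blast
    moreover have "normal_in B L" using normal_in_sub[OF B l(1,2,3)] .
    moreover have "commutator b c \<in> M" if "b \<in> B" "c \<in> B" for b c using that BE unfolding B_def by auto
    ultimately obtain K where "carter_mod L M K" "K <#> B = L" using carter_mod_ex_abelian[of M L B] MB l(4) by blast
    then show ?case using carter_mod_trans[OF L _ _ B] by blast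
  qed
qed

section \<open>Conjugacy of Carter subgroups in metanilpotent sections\<close>

text \<open>The case in which \<open>B\<close> over \<open>M\<close> is an abelian chief factor
  supplemented by both Carter subgroups. Unless a Carter subgroup is everything, both are
  complements of it. \<open>H\<close> is the induction hypothesis for dividing out a normal subgroup
  common to \<open>K\<close> and \<open>L\<close>; it serves the case where the center of
  \<open>K\<close> over \<open>M\<close> acts trivially on \<open>B\<close>.\<close>

lemma metanil_conj_core:
  assumes M: "normal_in M U" and B: "normal_in B U" and MB: "M \<subset> B"
    and min: "\<And>D. normal_in D U \<Longrightarrow> M \<subseteq> D \<Longrightarrow> D \<subseteq> B \<Longrightarrow> D = M \<or> D = B"
    and ab: "\<And>b c. b \<in> B \<Longrightarrow> c \<in> B \<Longrightarrow> commutator b c \<in> M"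
    and K: "carter_mod U M K" "K <#> B = U" and L: "carter_mod U M L" "L <#> B = U"
    and H: "\<And>Z. normal_in Z U \<Longrightarrow> M \<subset> Z \<Longrightarrow> Z \<subseteq> K \<Longrightarrow> Z \<subseteq> L \<Longrightarrow> \<exists>x\<in>U. L = cjs x K"
  shows "\<exists>x\<in>U. L = cjs x K"
proof -
  note m = normal_inD[OF M] and b = normal_inD[OF B] and k = carter_modD[OF K(1)] and l = carter_modD[OF L(1)]
  have Uc: "x \<in> carrier G" if "x \<in> U" for x using that b subgroupD by blast
  have Bc: "x \<in> carrier G" if "x \<in> B" for x using that b subgroupD by blast
  have Mc: "x \<in> carrier G" if "x \<in> M" for x using that m subgroupD by blast
  have Kc: "x \<in> carrier G" if "x \<in> K" for x using that k subgroupD by blast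
  have one: "\<exists>x\<in>U. L = cjs x K" if "nilpotent_mod U M"
  proof -
    have "K = U" "L = U" using carter_mod_nilpotent_mod K L that M by blast+
    then show ?thesis using sub_1[OF b(2)] subgroup.subset[OF b(2)] by (intro bexI[of _ \<one>]) auto
  qed
  \<comment> \<open>As \<open>U = K' B\<close>, normality in \<open>U\<close> may be tested against
    \<open>K'\<close> and against commutators with \<open>B\<close> separately.\<close>
  have nsubI: "normal_in D U" if D: "subgroup D G" "D \<subseteq> U" "\<And>k d. k \<in> K' \<Longrightarrow> d \<in> D \<Longrightarrow> cj k d \<in> D"
    "\<And>c d. c \<in> B \<Longrightarrow> d \<in> D \<Longrightarrow> commutator c d \<in> D" and K': "K' <#> B = U" "K' \<subseteq> carrier G" for D K'
  proof -
    have "cj u d \<in> D" if u: "u \<in> U" and d: "d \<in> D" for u d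
    proof -
      obtain k c where c: "k \<in> K'" "c \<in> B" "u = k \<otimes> c" using u K'(1) by (blast elim: mult_memE)
      have cc: "c \<in> carrier G" "k \<in> carrier G" "d \<in> carrier G" using c Bc K'(2) Uc D(2) d by blast+
      have "commutator c d \<otimes> d \<in> D" using D(4)[OF c(2) d] d sub_m[OF D(1)] by blast
      then have "cj c d \<in> D" using cc by (simp add: word)
      then have "cj k (cj c d) \<in> D" using D(3) c(1) by blast
      then show ?thesis using cc c(3) by (simp add: cj_cj)
    qed
    then show ?thesis using D b(2) unfolding normal_in_def by blast
  qed
  \<comment> \<open>\<open>K' \<inter> B\<close> is normalized by \<open>K'\<close>, and by
    \<open>B\<close> because commutators within \<open>B\<close> lie in \<open>M\<close>; minimality
    of \<open>B\<close> leaves two possibilities.\<close>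
  have KB: "K' = U \<or> K' \<inter> B = M" if K': "carter_mod U M K'" "K' <#> B = U" for K'
  proof -
    note k' = carter_modD[OF K'(1)]
    have "normal_in (K' \<inter> B) U"
    proof (rule nsubI[OF _ _ _ _ K'(2)])
      show "subgroup (K' \<inter> B) G" using subgroups_Inter_pair k' b by blast
      fix y assume y: "y \<in> K' \<inter> B"
      show "cj k y \<in> K' \<inter> B" if "k \<in> K'" for k using y that cj_in_subgroup[OF k'(1)] b(4) k'(3) by blast
      show "commutator c y \<in> K' \<inter> B" if "c \<in> B" for c using ab[OF that, of y] y k'(2) MB by blast
    qed (use b k' subgroup.subset in blast)+
    then have "K' \<inter> B = M \<or> K' \<inter> B = B" using min k'(2) MB by blast
    moreover have "K' = U" if "K' \<inter> B = B"
      using prod_subset[OF k'(1) order_refl, of B] that K'(2) k'(3) by blast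
    ultimately show ?thesis by blast
  qed
  show ?thesis
  proof (cases "K = U \<or> L = U \<or> K = M")
    case True
    moreover have "nilpotent_mod U M" if "K = M"
    proof -
      have "U = B" using K(2) that prod_subset[OF b(1) _ order_refl, of M] MB b(3) by blast
      then have "U \<subseteq> upper_central U M (Suc 0)" using ab by auto
      then show ?thesis unfolding nilpotent_mod_def by blast
    qed
    ultimately show ?thesis using one k(4) l(4) by blast
  next
    case False
    then have KM: "K \<inter> B = M" and LM: "L \<inter> B = M" using KB K L by blast+
    have MK: "normal_in M K" using normal_in_sub[OF M k(1,2,3)] .
    define Z where "Z = upper_central K M (Suc 0)"
    have Zi: "z \<in> Z \<longleftrightarrow> z \<in> K \<and> (\<forall>x\<in>K. commutator z x \<in> M)" for z unfolding Z_def by simp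
    have Z: "normal_in Z K" unfolding Z_def using upper_central_normal_in[OF MK] .
    note z = normal_inD[OF Z]
    have MZ: "M \<subseteq> Z" unfolding Z_def using upper_central_base[OF MK] .
    \<comment> \<open>A trivial center would make the upper central series of \<open>K\<close> stall
      at \<open>M\<close>, although \<open>K\<close> is nilpotent modulo \<open>M\<close> and
      different from \<open>M\<close>.\<close>
    have MZ': "M \<noteq> Z"
    proof
      assume eq: "M = Z"
      have "upper_central K M n = M" for n
      proof (induction n)
        case (Suc n)
        then show ?case using eq unfolding Z_def by simp
      qed simp
      then show False using k(2,4) False unfolding nilpotent_mod_def by blast
    qed
    have cm: "commutator d (k \<otimes> c) = commutator d k \<otimes> cj k (commutator d c)" if "d \<in> U" "k \<in> U" "c \<in> U" for d k c
      using that Uc by (simp add: word)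
    show ?thesis
    \<comment> \<open>If the center acts trivially on \<open>B\<close>, it is normal in
      \<open>U\<close>, normalizes \<open>L\<close> and hence lies in \<open>L\<close>, so it can be
      divided out. Otherwise a single central element \<open>z0\<close> that acts nontrivially
      determines the complement.\<close>
    proof (cases "\<forall>z\<in>Z. \<forall>c\<in>B. commutator z c \<in> M")
      case True
      have ZB: "commutator c z \<in> M" if "z \<in> Z" "c \<in> B" for z c
        using True that commutator_swap[of z c] Bc Kc z(3) sub_i[OF m(1)] by (metis subsetD)
      have ZU: "normal_in Z U"
        using nsubI[OF z(1) _ z(4) _ K(2)] z(3) k(3) ZB MZ subgroup.subset[OF k(1)] by blast
      have "x \<in> L" if x: "x \<in> Z" for x
      proof -
        have xU: "x \<in> U" using x z(3) k(3) by blast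
        have *: "cj y u \<in> L" if y: "y \<in> Z" and u: "u \<in> L" for y u
        proof -
          have yU: "y \<in> U" using y z(3) k(3) by blast
          have "u \<in> U" using u l(3) by blast
          then obtain h c where c: "h \<in> K" "c \<in> B" "u = h \<otimes> c" using K(2) by (blast elim: mult_memE)
          have "commutator y u = commutator y h \<otimes> cj h (commutator y c)" unfolding c(3) using yU c k(3) b(3) by (intro cm) auto
          moreover have "commutator y h \<in> M" using y c Zi by blast
          moreover have "cj h (commutator y c) \<in> M" using True y c m(4) k(3) by blast
          ultimately have "commutator y u \<in> L" using sub_m[OF m(1)] l(2) by auto
          then have "commutator y u \<otimes> u \<in> L" using u sub_m[OF l(1)] by blast
          then show ?thesis using Uc yU \<open>u \<in> U\<close> by (simp add: word)
        qed
        have "cjs x L = L"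
        proof (rule cjs_eqI)
          show "x \<in> carrier G" using xU Uc by blast
          show "L \<subseteq> carrier G" using l subgroup.subset by blast
        qed (use * x sub_i[OF z(1)] in blast)+
        then show ?thesis using l(5) xU by blast
      qed
      then show ?thesis using H[OF ZU] MZ MZ' z(3) by blast
    next
      case False
      then obtain z0 b0 where z0: "z0 \<in> Z" and b0: "b0 \<in> B" "commutator z0 b0 \<notin> M" by blast
      have z0K: "z0 \<in> K" "z0 \<in> U" using z0 z(3) k(3) by blast+
      have z0c: "z0 \<in> carrier G" using z0K Kc by blast
      have fB: "commutator z0 c \<in> B" if "c \<in> B" for c
        using commutator_memI[OF B that z0K(2)] commutator_swap[of c z0] Bc[OF that] z0c sub_i[OF b(1)] by simp
      \<comment> \<open>As \<open>z0\<close> is central in \<open>K\<close> modulo \<open>M\<close>,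
        the map \<open>c \<mapsto> [z0, c]\<close> commutes with conjugation by \<open>K\<close> up
        to \<open>M\<close>; so its kernel and image are normal in \<open>U\<close>.\<close>
      have fk: "\<exists>q\<in>M. cj h (commutator z0 c) = q \<otimes> commutator z0 (cj h c)" if h: "h \<in> K" and c: "c \<in> B" for h c
      proof -
        define q where "q = commutator h z0"
        have hc: "h \<in> carrier G" "c \<in> carrier G" using h c Kc Bc by auto
        have "commutator z0 h \<in> M" using z0 h Zi by blast
        then have q: "q \<in> M" unfolding q_def using commutator_swap[of z0 h] hc z0c sub_i[OF m(1)] by simp
        have qc: "q \<in> carrier G" using q Mc by blast
        define d where "d = cj h c"
        have d: "d \<in> B" "d \<in> carrier G" unfolding d_def using b(4) h k(3) c Bc by blast+
        have "cj h z0 = q \<otimes> z0" unfolding q_def using hc z0c by (simp add: word)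
        then have "cj h (commutator z0 c) = commutator (q \<otimes> z0) d" using cj_commutator[of h z0 c] hc z0c unfolding d_def by simp
        also have "\<dots> = (cj q (commutator z0 d) \<otimes> commutator q d \<otimes> inv (commutator z0 d)) \<otimes> commutator z0 d"
          using qc d z0c by (simp add: word)
        also have "cj q (commutator z0 d) \<otimes> commutator q d \<otimes> inv (commutator z0 d) = q \<otimes> cj (commutator z0 d \<otimes> d) (inv q)"
          using qc d z0c by (simp add: word)
        finally have 1: "cj h (commutator z0 c) = (q \<otimes> cj (commutator z0 d \<otimes> d) (inv q)) \<otimes> commutator z0 d" .
        have "commutator z0 d \<otimes> d \<in> U" using fB d sub_m[OF b(1)] b(3) by blast
        then have "q \<otimes> cj (commutator z0 d \<otimes> d) (inv q) \<in> M" using q sub_i[OF m(1)] m(4) sub_m[OF m(1)] by blast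
        then show ?thesis using 1 unfolding d_def by blast
      qed
      define Bz where "Bz = {c \<in> B. commutator z0 c \<in> M}"
      have Bz: "normal_in Bz U"
      proof (rule nsubI[OF _ _ _ _ K(2)])
        show "subgroup Bz G"
        proof (rule subgroupI)
          show "Bz \<subseteq> carrier G" unfolding Bz_def using Bc by blast
          have "commutator z0 \<one> = \<one>" using z0c by (simp add: word)
          then have "\<one> \<in> Bz" unfolding Bz_def using sub_1[OF m(1)] sub_1[OF b(1)] by simp
          then show "Bz \<noteq> {}" by blast
          fix a assume a: "a \<in> Bz"
          then have a': "a \<in> B" "commutator z0 a \<in> M" unfolding Bz_def by auto
          have i: "inv a \<in> B" using a' sub_i[OF b(1)] by blast
          have "commutator z0 (inv a) = cj (inv a) (inv (commutator z0 a))" using a' Bc z0c by (simp add: word)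
          also have "\<dots> \<in> M" by (rule m(4)) (use i a' b(3) sub_i[OF m(1)] in auto)
          finally show "inv a \<in> Bz" unfolding Bz_def using i by blast
          fix d assume d: "d \<in> Bz"
          then have d': "d \<in> B" "commutator z0 d \<in> M" unfolding Bz_def by auto
          have "commutator z0 (a \<otimes> d) = commutator z0 a \<otimes> cj a (commutator z0 d)" using cm[OF z0K(2)] a' d' b(3) by blast
          also have "\<dots> \<in> M" by (rule sub_m[OF m(1) a'(2)], rule m(4)) (use a' d' b(3) in auto)
          finally show "a \<otimes> d \<in> Bz" unfolding Bz_def using a' d' sub_m[OF b(1)] by blast
        qed
        fix d assume d: "d \<in> Bz"
        then have d': "d \<in> B" "commutator z0 d \<in> M" unfolding Bz_def by auto
        show "cj h d \<in> Bz" if h: "h \<in> K" for h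
        proof -
          have dB: "cj h d \<in> B" using b(4) h k(3) d' by blast
          obtain q where q: "q \<in> M" "cj h (commutator z0 d) = q \<otimes> commutator z0 (cj h d)" using fk[OF h d'(1)] by blast
          have "cj h (commutator z0 d) \<in> M" using m(4) h k(3) d' by blast
          then have "inv q \<otimes> (q \<otimes> commutator z0 (cj h d)) \<in> M" using q sub_i[OF m(1)] sub_m[OF m(1)] by auto
          then have "commutator z0 (cj h d) \<in> M" using Mc q z0c Bc dB by simp
          then show ?thesis unfolding Bz_def using dB by blast
        qed
        show "commutator c d \<in> Bz" if "c \<in> B" for c
        proof -
          have M1: "commutator c d \<in> M" using ab that d' by blast
          then have "commutator (commutator c d) z0 \<in> M" using commutator_memI[OF M _ z0K(2)] by blast
          then have "commutator z0 (commutator c d) \<in> M" using commutator_swap[of "commutator c d" z0] z0c Mc[OF M1] sub_i[OF m(1)] by simp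
          then show ?thesis unfolding Bz_def using M1 MB by blast
        qed
      qed (use b(3) subgroup.subset[OF k(1)] in \<open>auto simp: Bz_def\<close>)
      have MBz: "M \<subseteq> Bz"
      proof
        fix q assume q: "q \<in> M"
        have "commutator q z0 \<in> M" using commutator_memI[OF M q z0K(2)] .
        then have "commutator z0 q \<in> M" using commutator_swap[of q z0] z0c Mc[OF q] sub_i[OF m(1)] by simp
        then show "q \<in> Bz" unfolding Bz_def using q MB by blast
      qed
      have "Bz = M" using min[OF Bz MBz] b0 unfolding Bz_def by blast
      then have inj: "c \<in> M" if "c \<in> B" "commutator z0 c \<in> M" for c using that unfolding Bz_def by blast
      \<comment> \<open>Minimality of \<open>B\<close> makes \<open>c \<mapsto> [z0, c]\<close> injective (\<open>Bz = M\<close>) and surjective (\<open>S = B\<close>) on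
        \<open>B / M\<close>. Hence a conjugate \<open>z1\<close> of \<open>z0\<close> lies in \<open>L\<close>, and \<open>L\<close> centralizes \<open>z1\<close> modulo \<open>M\<close>.\<close>
      define S where "S = {q \<otimes> commutator z0 c | q c. q \<in> M \<and> c \<in> B}"
      have SI: "y \<in> S" if "q \<in> M" "c \<in> B" "y = q \<otimes> commutator z0 c" for y q c using that unfolding S_def by blast
      have cMc: "cj c y \<otimes> inv y \<in> M" if "c \<in> B" "y \<in> B" for c y
        using ab[OF that] Bc that by (simp add: word)
      have SB: "S \<subseteq> B" using fB sub_m[OF b(1)] MB unfolding S_def by blast
      have MS: "M \<subseteq> S"
      proof
        fix q assume "q \<in> M"
        then show "q \<in> S" using SI[of q \<one> q] sub_1[OF b(1)] z0c Mc by (simp add: word)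
      qed
      have Smul: "q \<otimes> s \<in> S" if qs: "q \<in> M" "s \<in> S" for q s
      proof -
        obtain p c where s: "p \<in> M" "c \<in> B" "s = p \<otimes> commutator z0 c" using qs(2) unfolding S_def by blast
        have "q \<otimes> s = (q \<otimes> p) \<otimes> commutator z0 c" using s qs(1) Mc Bc z0c by (simp add: m_assoc)
        then show ?thesis using SI[OF sub_m[OF m(1) qs(1) s(1)] s(2)] by blast
      qed
      have S: "normal_in S U"
      proof (rule nsubI[OF _ _ _ _ K(2)])
        show "subgroup S G"
        proof (rule subgroupI)
          show "S \<subseteq> carrier G" using SB Bc by blast
          show "S \<noteq> {}" using MS sub_1[OF m(1)] by blast
          fix a assume "a \<in> S"
          then obtain p c where a: "p \<in> M" "c \<in> B" "a = p \<otimes> commutator z0 c" unfolding S_def by blast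
          have ic: "inv c \<in> B" using a sub_i[OF b(1)] by blast
          define y where "y = commutator z0 c"
          have y: "y \<in> B" "y \<in> carrier G" unfolding y_def using fB a Bc by blast+
          have pc: "p \<in> carrier G" "c \<in> carrier G" using a Mc Bc by auto
          have "commutator z0 (inv c) = cj (inv c) (inv y)" unfolding y_def using pc z0c by (simp add: word)
          then have e1: "inv y = inv (cj (inv c) (inv y) \<otimes> inv (inv y)) \<otimes> commutator z0 (inv c)"
            using y pc by (simp add: inv_mult_group m_assoc)
          have q: "inv (cj (inv c) (inv y) \<otimes> inv (inv y)) \<in> M"
            using cMc[OF ic, of "inv y"] y sub_i[OF b(1)] sub_i[OF m(1)] by blast
          have "inv y \<in> S" using SI[OF q ic e1] .
          have "inv a = cj (inv y) (inv p) \<otimes> inv y" unfolding a(3) y_def[symmetric] using y pc by (simp add: word)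
          moreover have "cj (inv y) (inv p) \<in> M" using m(4) a sub_i[OF m(1)] sub_i[OF b(1)] y b(3) by blast
          ultimately show "inv a \<in> S" using Smul \<open>inv y \<in> S\<close> by simp
          fix s assume "s \<in> S"
          then obtain q d where s: "q \<in> M" "d \<in> B" "s = q \<otimes> commutator z0 d" unfolding S_def by blast
          define w where "w = commutator z0 d"
          have w: "w \<in> B" "w \<in> carrier G" unfolding w_def using fB s Bc by blast+
          have qc: "q \<in> carrier G" "d \<in> carrier G" using s Mc Bc by auto
          \<comment> \<open>The commutator map is multiplicative only modulo \<open>M\<close>;
            \<open>r\<close> is the error that turns the product into a single commutator.\<close>
          define r where "r = p \<otimes> cj y q \<otimes> cj y (inv (cj c w \<otimes> inv w))"
          have "commutator z0 (c \<otimes> d) = y \<otimes> cj c w" unfolding y_def w_def using cm[OF z0K(2)] a s b(3) by blast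
          then have "a \<otimes> s = r \<otimes> commutator z0 (c \<otimes> d)"
            unfolding a(3) s(3) y_def[symmetric] w_def[symmetric] r_def using y w qc pc by (simp add: word)
          moreover have "r \<in> M" unfolding r_def
            using cMc[OF a(2) w(1)] sub_i[OF m(1)] sub_m[OF m(1)] m(4) y b(3) s(1) a(1) by (meson subsetD)
          ultimately show "a \<otimes> s \<in> S" using SI sub_m[OF b(1) a(2) s(2)] by blast
        qed
        fix d assume dS: "d \<in> S"
        then obtain p c where d: "p \<in> M" "c \<in> B" "d = p \<otimes> commutator z0 c" unfolding S_def by blast
        show "cj h d \<in> S" if h: "h \<in> K" for h
        proof -
          obtain q where q: "q \<in> M" "cj h (commutator z0 c) = q \<otimes> commutator z0 (cj h c)" using fk[OF h d(2)] by blast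
          have "cj h c \<in> B" using b(4) h k(3) d by blast
          then have "cj h (commutator z0 c) \<in> S" using SI[OF q(1) _ q(2)] by blast
          moreover have "cj h p \<in> M" using m(4) h k(3) d by blast
          moreover have "cj h d = cj h p \<otimes> cj h (commutator z0 c)" unfolding d(3) using cj_mult h Kc Mc d z0c Bc by simp
          ultimately show ?thesis using Smul by simp
        qed
        show "commutator c d \<in> S" if "c \<in> B" for c using ab[OF that, of d] SB dS MS by blast
      qed (use SB b(3) subgroup.subset[OF k(1)] in auto)
      have "commutator z0 b0 \<in> S" using SI[OF sub_1[OF m(1)] b0(1)] z0c Bc b0 by simp
      then have SBeq: "S = B" using min[OF S MS SB] b0 by blast
      obtain h0 c0 where h0: "h0 \<in> L" "c0 \<in> B" "z0 = h0 \<otimes> c0" using L(2) z0K by (blast elim: mult_memE)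
      have h0c: "h0 \<in> carrier G" "c0 \<in> carrier G" using h0 l(3) Uc Bc by blast+
      have "cj h0 c0 \<in> S" unfolding SBeq using b(4) h0 l(3) by blast
      \<comment> \<open>Surjectivity supplies \<open>d\<close> with \<open>[z0, d]\<close> congruent
        modulo \<open>M\<close> to the part by which \<open>z0\<close> deviates from
        \<open>L\<close>. Conjugating \<open>z0\<close> by \<open>d\<close> removes this part:
        \<open>cj d z0\<close> is an element of \<open>M\<close> times \<open>h0\<close>.\<close>
      then obtain q d where d: "q \<in> M" "d \<in> B" "cj h0 c0 = q \<otimes> commutator z0 d" unfolding S_def by blast
      have dc: "d \<in> carrier G" "q \<in> carrier G" "d \<in> U" using d Bc Mc b(3) by blast+
      define y where "y = commutator z0 d"
      have y: "y \<in> B" "y \<in> carrier G" unfolding y_def using fB d Bc by blast+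
      have "cj h0 c0 \<otimes> h0 = z0" unfolding h0(3) using h0c by (simp add: word)
      then have "z0 = q \<otimes> y \<otimes> h0" unfolding d(3) y_def by (rule sym)
      moreover have "cj d z0 = inv y \<otimes> z0" unfolding y_def using dc z0c by (simp add: word)
      ultimately have zz: "cj d z0 = cj (inv y) q \<otimes> h0" using y dc h0c by (simp add: word)
      define z1 where "z1 = cj d z0"
      have z1L: "z1 \<in> L" unfolding z1_def zz
        using m(4) d y b(3) sub_i[OF b(1)] l(2) sub_m[OF l(1)] h0 by (meson subsetD)
      define K1 where "K1 = cjs d K"
      have K1: "carter_mod U M K1" unfolding K1_def using carter_mod_cjs_in[OF dc(3) K(1) M] .
      note k1 = carter_modD[OF K1]
      have z1U: "z1 \<in> U" using z1L l(3) by blast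
      have cd: "commutator z1 (cj d x) = cj d (commutator z0 x)" if "x \<in> carrier G" for x
        unfolding z1_def using cj_commutator dc z0c that by simp
      have cen: "commutator z1 x \<in> M" if x: "x \<in> K1" for x
      proof -
        obtain h where h: "h \<in> K" "x = cj d h" using x unfolding K1_def by blast
        have "commutator z0 h \<in> M" using z0 h Zi by blast
        then show ?thesis using cd[of h] h Kc m(4) dc by simp
      qed
      have inj1: "x \<in> M" if x: "x \<in> B" "commutator z1 x \<in> M" for x
      proof -
        define v where "v = cj (inv d) x"
        have idU: "inv d \<in> U" using dc sub_i[OF b(2)] by blast
        have v: "v \<in> B" unfolding v_def using b(4) idU x by blast
        have xv: "x = cj d v" unfolding v_def using dc Bc x by simp
        have "cj (inv d) (cj d (commutator z0 v)) \<in> M" using x(2) cd[of v] v Bc m(4)[OF idU] unfolding xv by simp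
        then have "commutator z0 v \<in> M" using dc z0c v Bc by simp
        then have "v \<in> M" using inj v by blast
        then show ?thesis unfolding xv using m(4) dc by blast
      qed
      have K1B: "\<exists>h\<in>K1. \<exists>c\<in>B. x = h \<otimes> c" if x: "x \<in> U" for x
      proof -
        have "cj (inv d) x \<in> K <#> B" unfolding K(2) using cj_in_subgroup[OF b(2)] x dc sub_i[OF b(2)] by blast
        then obtain h c where h: "h \<in> K" "c \<in> B" "cj (inv d) x = h \<otimes> c" by (rule mult_memE)
        have "x = cj d (cj (inv d) x)" using dc x Uc by simp
        also have "\<dots> = cj d h \<otimes> cj d c" unfolding h(3) using cj_mult dc h Kc Bc by blast
        finally show ?thesis using h b(4) dc unfolding K1_def by blast
      qed
      \<comment> \<open>For \<open>x = h c\<close> in \<open>L\<close> the commutator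
        \<open>[z1, x]\<close> lies in \<open>L \<inter> B = M\<close>, and so does
        \<open>[z1, h]\<close>; hence \<open>[z1, c]\<close> is in \<open>M\<close>, and injectivity
        puts \<open>c\<close> into \<open>M\<close>.\<close>
      have "L \<subseteq> K1"
      proof
        fix x assume x: "x \<in> L"
        then obtain h c where h: "h \<in> K1" "c \<in> B" "x = h \<otimes> c" using K1B l(3) by blast
        have hU: "h \<in> U" "c \<in> U" using h k1(3) b(3) by blast+
        have eq: "commutator z1 x = commutator z1 h \<otimes> cj h (commutator z1 c)" unfolding h(3) using cm[OF z1U hU] .
        have c1: "commutator z1 c \<in> B" using commutator_memI[OF B h(2) z1U] commutator_swap[of c z1] Uc hU z1U sub_i[OF b(1)] by simp
        have "commutator z1 x \<in> B" unfolding eq using cen h MB b(4) hU c1 sub_m[OF b(1)] by blast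
        moreover have "commutator z1 x \<in> L" using commutator_in_subgroup[OF l(1) z1L x] .
        ultimately have "commutator z1 x \<in> M" using LM by blast
        then have "inv (commutator z1 h) \<otimes> commutator z1 x \<in> M" using cen h(1) sub_i[OF m(1)] sub_m[OF m(1)] by blast
        then have "cj h (commutator z1 c) \<in> M" unfolding eq using Uc z1U hU by simp
        then have "cj (inv h) (cj h (commutator z1 c)) \<in> M" using m(4) sub_i[OF b(2)] hU by blast
        then have "commutator z1 c \<in> M" using Uc z1U hU by simp
        then have "c \<in> M" using inj1 h by blast
        then show "x \<in> K1" unfolding h(3) using h(1) k1(1,2) sub_m by blast
      qed
      moreover have "normal_in M K1" using normal_in_sub[OF M k1(1,2,3)] .
      ultimately have "L = K1" using nilpotent_mod_self_normalizing[OF k1(4) _ l(1,2)] l(5) k1(3) by blast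
      then show ?thesis unfolding K1_def using dc by blast
    qed
  qed
qed

text \<open>The measure, the difference of the two orders, drops both when \<open>U\<close> shrinks
  (\<open>sub\<close>) and when \<open>M\<close> grows (\<open>quo\<close>). \<open>B\<close> is
  chosen minimal over \<open>M\<close> inside the center of \<open>E\<close> modulo
  \<open>M\<close>, hence abelian modulo \<open>M\<close>. The quotient by \<open>B\<close> makes
  \<open>K B\<close> and \<open>L B\<close> equal after conjugation; if they are proper,
  \<open>sub\<close> finishes, otherwise \<open>metanil_conj_core\<close> applies.\<close>

theorem metanil_carter_mod_conj:
  assumes "normal_in M U" "normal_in E U" "M \<subseteq> E" "nilpotent_mod E M" "nilpotent_mod U E" "carter_mod U M K" "carter_mod U M L"
  shows "\<exists>x\<in>U. L = cjs x K"
  using assms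
proof (induction "card U - card M" arbitrary: U M E K L rule: less_induct)
  case less
  note M = less.prems(1) and E = less.prems(2) and ME = less.prems(3)
  note m = normal_inD[OF M] and e = normal_inD[OF E]
  have Uc: "U \<subseteq> carrier G" using m subgroup.subset by blast
  have finU: "finite U" using fin_sub[OF m(2)] .
  show ?case
  proof (cases "E = M")
    case True
    then have "K = U" "L = U" using carter_mod_nilpotent_mod less.prems by blast+
    then show ?thesis using sub_1[OF m(2)] Uc by (intro bexI[of _ \<one>]) auto
  next
    case False
    have ME': "normal_in M E" using normal_in_sub[OF M e(1) ME e(3)] .
    define A where "A = upper_central E M (Suc 0)"
    have A: "normal_in A U" unfolding A_def using upper_central_normal_in_outer[OF M E ME] .
    have MA: "M \<subseteq> A" unfolding A_def using upper_central_base[OF ME'] .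
    have "M \<noteq> A"
    proof
      assume eq: "M = A"
      have "upper_central E M n = M" for n
      proof (induction n)
        case (Suc n) then show ?case using eq unfolding A_def by simp
      qed simp
      then show False using less.prems(4) ME False unfolding nilpotent_mod_def by blast
    qed
    then have "normal_in A U \<and> M \<subset> A \<and> A \<subseteq> A" using A MA by blast
    then obtain B where B': "normal_in B U \<and> M \<subset> B \<and> B \<subseteq> A" and Bmin: "\<And>D. normal_in D U \<and> M \<subset> D \<and> D \<subseteq> A \<Longrightarrow> card B \<le> card D"
      using ex_has_least_nat[of "\<lambda>D. normal_in D U \<and> M \<subset> D \<and> D \<subseteq> A" A card] by blast
    have B: "normal_in B U" and MB: "M \<subset> B" and BA: "B \<subseteq> A" using B' by auto
    note b = normal_inD[OF B]
    have BE: "B \<subseteq> E" using BA unfolding A_def by auto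
    have BEM: "commutator c x \<in> M" if "c \<in> B" "x \<in> E" for c x using that BA unfolding A_def by auto
    have min: "D = M \<or> D = B" if D: "normal_in D U" "M \<subseteq> D" "D \<subseteq> B" for D
    proof (rule disjCI)
      assume "D \<noteq> B"
      then have "card D < card B" using D(3) fin_sub[OF b(1)] by (simp add: psubset_card_mono psubset_eq)
      then have "\<not> M \<subset> D" using Bmin[of D] D BA by (meson leD subset_trans)
      then show "D = M" using D by blast
    qed
    have sub: "\<exists>x\<in>Y. L' = cjs x K'" if Y: "subgroup Y G" "Y \<subset> U" "M \<subseteq> Y" and "carter_mod Y M K'" "carter_mod Y M L'" for Y K' L'
    proof (rule less.hyps)
      have "card Y < card U" using Y finU psubset_card_mono by blast
      moreover have "card M \<le> card Y" using Y fin_sub card_mono by blast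
      ultimately show "card Y - card M < card U - card M" by linarith
      show "normal_in M Y" using normal_in_sub[OF M] Y by blast
      show "normal_in (E \<inter> Y) Y" using normal_in_restrict[OF E] Y by blast
      show "M \<subseteq> E \<inter> Y" using ME Y by blast
      show "nilpotent_mod (E \<inter> Y) M" using nilpotent_mod_sub'[OF less.prems(4) _ subgroups_Inter_pair[OF e(1) Y(1)]] by blast
      show "nilpotent_mod Y (E \<inter> Y)" using nilpotent_mod_sub[OF less.prems(5)] Y by blast
    qed fact+
    have quo: "\<exists>x\<in>U. L' = cjs x K'" if D: "normal_in D U" "M \<subset> D" and "carter_mod U D K'" "carter_mod U D L'" and DE: "normal_in D' U" "nilpotent_mod D' D" "D \<subseteq> D'" "nilpotent_mod U D'" for D D' K' L'
    proof (rule less.hyps)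
      have "card M < card D" using D fin_sub[OF normal_inD(1)[OF D(1)]] psubset_card_mono by blast
      moreover have "card D \<le> card U" using normal_inD(3)[OF D(1)] finU card_mono by blast
      ultimately show "card U - card D < card U - card M" by linarith
    qed fact+
    \<comment> \<open>If \<open>K' B\<close> is proper, conjugacy inside it is known by induction
      and the Frattini argument applies; if it is \<open>U\<close>, then \<open>U\<close> is
      nilpotent modulo \<open>B\<close> and is its own Carter subgroup.\<close>
    have up: "carter_mod U B (K' <#> B)" if K': "carter_mod U M K'" for K'
    proof -
      note k' = carter_modD[OF K'] and p = prod_normal_in[OF B carter_modD(1,3)[OF K']]
      have MB': "M \<subseteq> B" using MB by blast
      show ?thesis
      proof (cases "K' <#> B = U")
        case True
        then have "nilpotent_mod U B" using nilpotent_mod_mult[OF B k'(1,3,4) MB'] by simp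
        then show ?thesis using True carter_mod_refl[OF _ B] by simp
      next
        case False
        show ?thesis
        proof (rule carter_mod_prod[OF B M MB' K'])
          fix K'' assume "carter_mod (K' <#> B) M K''"
          moreover have "carter_mod (K' <#> B) M K'" using carter_mod_restrict[OF K' p(2,4)] .
          moreover have "K' <#> B \<subset> U" using p(4) False by blast
          moreover have "M \<subseteq> K' <#> B" using MB' p(3) by blast
          ultimately show "\<exists>x\<in>K' <#> B. K'' = cjs x K'" using sub[OF p(1)] by blast
        qed
      qed
    qed
    have "nilpotent_mod E B" using nilpotent_mod_mono[OF less.prems(4)] MB by blast
    then obtain x where x: "x \<in> U" "L <#> B = cjs x (K <#> B)"
      using quo[OF B MB up[OF less.prems(6)] up[OF less.prems(7)] E _ BE less.prems(5)] by blast
    have xc: "x \<in> carrier G" using x Uc by blast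
    define K1 where "K1 = cjs x K"
    have K1: "carter_mod U M K1" unfolding K1_def using carter_mod_cjs_in[OF x(1) less.prems(6) M] .
    have Kc: "K \<subseteq> carrier G" using carter_modD(1)[OF less.prems(6)] subgroup.subset by blast
    have eq: "L <#> B = K1 <#> B"
      unfolding K1_def x(2) using cjs_prod[OF xc Kc subgroup.subset[OF b(1)]] normal_in_cjs[OF B x(1)] by simp
    have "\<exists>y\<in>U. L = cjs y K1"
    proof (cases "K1 <#> B = U")
      case False
      note p = prod_normal_in[OF B carter_modD(1,3)[OF K1]] and q = prod_normal_in[OF B carter_modD(1,3)[OF less.prems(7)]]
      have "K1 <#> B \<subset> U" using p(4) False by blast
      moreover have "M \<subseteq> K1 <#> B" using MB p(3) by blast
      moreover have "carter_mod (K1 <#> B) M K1" using carter_mod_restrict[OF K1 p(2,4)] .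
      moreover have "carter_mod (K1 <#> B) M L" using carter_mod_restrict[OF less.prems(7) q(2,4)] unfolding eq .
      ultimately show ?thesis using sub[OF p(1)] p(4) by blast
    next
      case True
      show ?thesis
      proof (rule metanil_conj_core[OF M B MB min _ K1 True less.prems(7)])
        show "commutator c d \<in> M" if "c \<in> B" "d \<in> B" for c d using BEM that BE by blast
        show "L <#> B = U" using eq True by simp
        fix Z assume Z: "normal_in Z U" "M \<subset> Z" "Z \<subseteq> K1" "Z \<subseteq> L"
        have c: "carter_mod U Z K'" if K': "carter_mod U M K'" "Z \<subseteq> K'" for K'
          using carter_modD[OF K'(1)] K'(2) nilpotent_mod_mono[of K' M Z] Z(2) unfolding carter_mod_def by blast
        note p = prod_normal_in[OF Z(1) e(1,3)]
        \<comment> \<open>Modulo \<open>Z\<close> the role of \<open>E\<close> is taken over by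
          \<open>E Z\<close>, which need not be \<open>E\<close> because \<open>Z\<close> comes from
          \<open>K1\<close>.\<close>
        have "normal_in (E <#> Z) U"
        proof -
          have "cj u y \<in> E <#> Z" if u: "u \<in> U" and y: "y \<in> E <#> Z" for u y
          proof -
            obtain a d where a: "a \<in> E" "d \<in> Z" "y = a \<otimes> d" using y by (rule mult_memE)
            have "cj u y = cj u a \<otimes> cj u d" unfolding a(3) using cj_mult u a Uc e(3) normal_inD(3)[OF Z(1)] by blast
            then show ?thesis using e(4)[OF u a(1)] normal_inD(4)[OF Z(1) u a(2)] mult_memI by metis
          qed
          then show ?thesis using p m(2) unfolding normal_in_def by blast
        qed
        moreover have "nilpotent_mod (E <#> Z) Z" using nilpotent_mod_mult[OF Z(1) e(1,3) less.prems(4)] Z(2) by blast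
        moreover have "nilpotent_mod U (E <#> Z)" using nilpotent_mod_mono[OF less.prems(5) p(2)] .
        ultimately show "\<exists>x\<in>U. L = cjs x K1" using quo[OF Z(1,2) c[OF K1 Z(3)] c[OF less.prems(7) Z(4)]] p(3) by blast
      qed
    qed
    then obtain y where y: "y \<in> U" "L = cjs y K1" by blast
    then have "L = cjs (y \<otimes> x) K" unfolding K1_def using cjs_cjs[of y x K] Uc xc Kc by auto
    then show ?thesis using y x sub_m[OF m(2)] by blast
  qed
qed

end

subsection \<open>Component systems\<close>

context fin_group begin

definition stabil :: "'a set \<Rightarrow> 'a set \<Rightarrow> 'a set" where
  "stabil K C = {x \<in> K. cjs x C = C}"

text \<open>For \<open>C = C(T)\<close>, the image of \<open>stab_mult K C\<close> in \<open>N(C) / C\<close> is the group of automorphisms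
  that \<open>K\<close> induces on \<open>T\<close>.\<close>

definition stab_mult :: "'a set \<Rightarrow> 'a set \<Rightarrow> 'a set" where
  "stab_mult K C = stabil K C <#> C"

text \<open>An axiomatic form of \<open>N = T\<^sub>1 \<times> \<dots> \<times> T\<^sub>k\<close> with \<open>\<C> = {C(T\<^sub>1), \<dots>, C(T\<^sub>k)}\<close>: the third condition
  says that \<open>N\<close> maps onto the product of the groups \<open>N / (N \<inter> C)\<close>, the fourth that this map is
  injective. Unlike direct products, such systems pass to the stabilizer of a tuple of
  subgroups \<open>L C\<close>, where the factors may become trivial.\<close>

definition component_system :: "'a set \<Rightarrow> 'a set \<Rightarrow> 'a set set \<Rightarrow> bool" where
  "component_system U N \<C> \<longleftrightarrow> normal_in N U \<and>
     (\<forall>C\<in>\<C>. subgroup C G \<and> (\<forall>u\<in>U. cjs u C \<in> \<C>) \<and> (\<forall>n\<in>N. cjs n C = C)) \<and>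
     (\<forall>f. (\<forall>C\<in>\<C>. f C \<in> N) \<longrightarrow> (\<exists>n\<in>N. \<forall>C\<in>\<C>. \<exists>c\<in>C. n = c \<otimes> f C)) \<and>
     (\<forall>n\<in>N. (\<forall>C\<in>\<C>. n \<in> C) \<longrightarrow> n = \<one>)"

lemma stabil_subgroup: "subgroup K G \<Longrightarrow> C \<subseteq> carrier G \<Longrightarrow> subgroup (stabil K C) G"
  unfolding stabil_def by (rule stab_subgroup)

lemma stabilD: "x \<in> stabil K C \<Longrightarrow> x \<in> K" "x \<in> stabil K C \<Longrightarrow> cjs x C = C"
  unfolding stabil_def by auto

lemma stabilI: "x \<in> K \<Longrightarrow> cjs x C = C \<Longrightarrow> x \<in> stabil K C"
  unfolding stabil_def by auto

lemma stab_mult_props: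
  assumes K: "subgroup K G" and C: "subgroup C G"
  shows "subgroup (stab_mult K C) G" "stabil K C \<subseteq> stab_mult K C" "C \<subseteq> stab_mult K C" "normal_in C (stab_mult K C)"
    "nilpotent_mod K {\<one>} \<Longrightarrow> nilpotent_mod (stab_mult K C) C" "x \<in> stab_mult K C \<Longrightarrow> cjs x C = C"
proof -
  have Cc: "C \<subseteq> carrier G" using C subgroup.subset by blast
  have A: "normal_in C (stabil (carrier G) C)" unfolding stabil_def using normal_in_stab[OF subgroup_self C Cc] .
  have sK: "subgroup (stabil K C) G" using stabil_subgroup[OF K Cc] .
  have le: "stabil K C \<subseteq> stabil (carrier G) C" unfolding stabil_def using subgroup.subset[OF K] by blast
  note p = prod_normal_in[OF A sK le, folded stab_mult_def]
  show "subgroup (stab_mult K C) G" "stabil K C \<subseteq> stab_mult K C" "C \<subseteq> stab_mult K C" "normal_in C (stab_mult K C)" using p by auto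
  show "nilpotent_mod (stab_mult K C) C" if "nilpotent_mod K {\<one>}"
  proof -
    have "nilpotent_mod (stabil K C) {\<one>}" using nilpotent_mod_sub'[OF that _ sK order_refl] stabilD(1) by blast
    then show ?thesis unfolding stab_mult_def using nilpotent_mod_mult[OF A sK le] sub_1[OF C] by blast
  qed
  show "cjs x C = C" if "x \<in> stab_mult K C" using normal_in_cjs[OF p(5) that] .
qed

lemma stab_multE:
  assumes "x \<in> stab_mult K C"
  obtains k c where "k \<in> K" "cjs k C = C" "c \<in> C" "x = k \<otimes> c"
  using assms unfolding stab_mult_def stabil_def by (blast elim: mult_memE)

lemma stab_multI: "k \<in> K \<Longrightarrow> cjs k C = C \<Longrightarrow> c \<in> C \<Longrightarrow> k \<otimes> c \<in> stab_mult K C"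
  unfolding stab_mult_def stabil_def by (blast intro: mult_memI)

lemma stab_mult_mono: "K \<subseteq> L \<Longrightarrow> stab_mult K C \<subseteq> stab_mult L C"
  by (blast elim: stab_multE intro: stab_multI)

lemma cjs_stabil:
  assumes x: "x \<in> carrier G" and K: "K \<subseteq> carrier G" and C: "C \<subseteq> carrier G"
  shows "cjs x (stabil K C) = stabil (cjs x K) (cjs x C)"
proof -
  have "cjs h C = C \<longleftrightarrow> cjs (cj x h) (cjs x C) = cjs x C" if h: "h \<in> carrier G" for h
  proof -
    have "cj x h \<otimes> x = x \<otimes> h" using x h by (simp add: word)
    then have "cjs (cj x h) (cjs x C) = cjs x (cjs h C)" using cjs_cjs x h C by simp
    moreover have "cjs x (cjs h C) = cjs x C \<longleftrightarrow> cjs h C = C"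
      using cjs_cancel(1)[OF x C] cjs_cancel(1)[OF x cjs_closed[OF h C]] by metis
    ultimately show ?thesis by simp
  qed
  note eq = this
  show ?thesis
  proof (rule Set.set_eqI, rule iffI)
    fix z assume "z \<in> cjs x (stabil K C)"
    then obtain h where "h \<in> K" "cjs h C = C" "z = cj x h" unfolding stabil_def by blast
    then show "z \<in> stabil (cjs x K) (cjs x C)" using eq[of h] K by (intro stabilI) auto
  next
    fix z assume z: "z \<in> stabil (cjs x K) (cjs x C)"
    then obtain h where h: "h \<in> K" "z = cj x h" using stabilD(1) by blast
    then have "cjs h C = C" using eq[of h] K stabilD(2)[OF z] by blast
    then show "z \<in> cjs x (stabil K C)" unfolding h(2) using h(1) by (intro imageI stabilI)
  qed
qed

lemma cjs_stab_mult:
  assumes x: "x \<in> carrier G" and K: "K \<subseteq> carrier G" and C: "C \<subseteq> carrier G"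
  shows "cjs x (stab_mult K C) = stab_mult (cjs x K) (cjs x C)"
proof -
  have "stabil K C \<subseteq> carrier G" using K stabilD(1) by blast
  from cjs_prod[OF x this C] show ?thesis unfolding stab_mult_def cjs_stabil[OF assms] .
qed

lemma component_systemD:
  assumes "component_system U N \<C>"
  shows "normal_in N U" "C \<in> \<C> \<Longrightarrow> subgroup C G" "C \<in> \<C> \<Longrightarrow> u \<in> U \<Longrightarrow> cjs u C \<in> \<C>"
    "C \<in> \<C> \<Longrightarrow> n \<in> N \<Longrightarrow> cjs n C = C"
    "n \<in> N \<Longrightarrow> (\<And>C. C \<in> \<C> \<Longrightarrow> n \<in> C) \<Longrightarrow> n = \<one>"
  using assms unfolding component_system_def by auto

lemma component_system_indep:
  assumes "component_system U N \<C>" "\<And>C. C \<in> \<C> \<Longrightarrow> f C \<in> N"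
  obtains n where "n \<in> N" "\<And>C. C \<in> \<C> \<Longrightarrow> \<exists>c\<in>C. n = c \<otimes> f C"
proof -
  have "\<forall>f. (\<forall>C\<in>\<C>. f C \<in> N) \<longrightarrow> (\<exists>n\<in>N. \<forall>C\<in>\<C>. \<exists>c\<in>C. n = c \<otimes> f C)"
    using assms(1) unfolding component_system_def by (elim conjE)
  from this[THEN spec, of f] show thesis using assms(2) that by blast
qed

text \<open>Modulo the trivial intersection of all members of the system, \<open>E\<close> embeds
  into the product of its quotients by the \<open>C \<inter> E\<close>, each of them
  nilpotent.\<close>

lemma component_system_nilpotent_mod:
  assumes S: "component_system U N \<C>" and E: "subgroup E G" "E \<subseteq> N"
    and F: "\<And>C. C \<in> \<C> \<Longrightarrow> \<exists>F. E \<subseteq> F \<and> nilpotent_mod F C"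
  shows "nilpotent_mod E {\<one>}"
proof -
  have "\<C> \<subseteq> Pow (carrier G)" using component_systemD(2)[OF S] subgroup.subset by blast
  then have fin: "finite \<C>" using fin finite_subset by blast
  have n: "normal_in (C \<inter> E) E" if "C \<in> \<C>" for C
  proof -
    have "cj x y \<in> C" if x: "x \<in> E" and y: "y \<in> C \<inter> E" for x y
      using component_systemD(4)[OF S \<open>C \<in> \<C>\<close>, of x] x y E(2) by blast
    then show ?thesis using E component_systemD(2)[OF S that] subgroups_Inter_pair cj_in_subgroup[OF E(1)] unfolding normal_in_def by blast
  qed
  have ex: "\<exists>n. E \<subseteq> upper_central E (C \<inter> E) n" if "C \<in> \<C>" for C
    using F[OF that] nilpotent_mod_sub[OF _ _ E(1)] unfolding nilpotent_mod_def by blast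
  then obtain i where i: "\<And>C. C \<in> \<C> \<Longrightarrow> E \<subseteq> upper_central E (C \<inter> E) (i C)" by metis
  \<comment> \<open>Any common bound for the finitely many nilpotency classes will do; the sum is
    one.\<close>
  define m where "m = (\<Sum>C\<in>\<C>. i C)"
  have m: "E \<subseteq> upper_central E (C \<inter> E) m" if "C \<in> \<C>" for C
  proof -
    have "i C \<le> m" unfolding m_def using that fin by (simp add: member_le_sum)
    then show ?thesis using i[OF that] upper_central_mono_index[OF n[OF that]] by blast
  qed
  have "z \<in> upper_central E {\<one>} k" if "z \<in> E" "\<And>C. C \<in> \<C> \<Longrightarrow> z \<in> upper_central E (C \<inter> E) k" for z k
    using that
  proof (induction k arbitrary: z)
    case 0
    then have "z = \<one>" using E by (intro component_systemD(5)[OF S]) auto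
    then show ?case by simp
  next
    case (Suc k)
    have "commutator z x \<in> upper_central E {\<one>} k" if x: "x \<in> E" for x
    proof (rule Suc.IH)
      show "commutator z x \<in> E" using commutator_in_subgroup[OF E(1) Suc.prems(1) x] .
      show "commutator z x \<in> upper_central E (C \<inter> E) k" if "C \<in> \<C>" for C using Suc.prems(2)[OF that] x by simp
    qed
    then show ?case using Suc.prems(1) by simp
  qed
  then have "E \<subseteq> upper_central E {\<one>} m" using m by blast
  then show ?thesis unfolding nilpotent_mod_def by blast
qed

section \<open>The action of a Carter subgroup on a single component\<close>

text \<open>Testing elements of \<open>N\<close> is enough, since when \<open>K N = U\<close> every
  element of \<open>stab_mult U C\<close> is one of \<open>N\<close> times one of
  \<open>stab_mult K C\<close>. The lemma is also applied inside the stabilizer of a tuple, with its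
  smaller system.\<close>

lemma component_self_normalizing:
  assumes S: "component_system U N \<C>" and K: "carter_mod U {\<one>} K"
    and C: "C \<in> \<C>" and y: "y \<in> N" "cjs y (stab_mult K C) = stab_mult K C"
  shows "y \<in> stab_mult K C"
proof -
  note n = normal_inD[OF component_systemD(1)[OF S]] and k = carter_modD[OF K]
  have Uc: "x \<in> carrier G" if "x \<in> U" for x using that n subgroupD by blast
  have Kc: "K \<subseteq> carrier G" using k Uc by blast
  have sC: "subgroup B G" "B \<subseteq> carrier G" if "B \<in> \<C>" for B using component_systemD(2)[OF S that] subgroup.subset by blast+
  note sp = stab_mult_props[OF k(1) sC(1)]
  have spc: "stab_mult K B \<subseteq> carrier G" if "B \<in> \<C>" for B using sp(1)[OF that] subgroup.subset by blast
  have kspn: "cjs h (stab_mult K B) = stab_mult K (cjs h B)" if "h \<in> K" "B \<in> \<C>" for h B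
    using cjs_stab_mult[of h K B] cjs_self[OF k(1) that(1)] sC[OF that(2)] Kc that(1) by auto
  \<comment> \<open>A transversal of the \<open>K\<close>-orbit of \<open>C\<close>. The choice is
    arbitrary even at \<open>C\<close> itself, which is undone in the last lines.\<close>
  define xx where "xx B = (SOME h. h \<in> K \<and> cjs h C = B)" for B
  define orb where "orb B \<longleftrightarrow> (\<exists>h\<in>K. cjs h C = B)" for B
  have xx: "xx B \<in> K" "cjs (xx B) C = B" if "orb B" for B
    using someI_ex[of "\<lambda>h. h \<in> K \<and> cjs h C = B"] that unfolding xx_def orb_def by blast+
  \<comment> \<open>Spreading \<open>y\<close> over the \<open>K\<close>-orbit of \<open>C\<close> gives \<open>d\<close>, which commutes with \<open>K\<close> modulo \<open>E\<close>.\<close>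
  define f where "f B = (if orb B then cj (xx B) y else \<one>)" for B
  have fN: "f B \<in> N" for B
  proof (cases "orb B")
    case True
    then show ?thesis unfolding f_def using n(4)[OF subsetD[OF k(3) xx(1)[OF True]] y(1)] by simp
  qed (simp add: f_def sub_1[OF n(1)])
  have fc: "f B \<in> carrier G" for B using fN n(3) Uc by blast
  obtain d where d: "d \<in> N" "\<And>B. B \<in> \<C> \<Longrightarrow> \<exists>c\<in>B. d = c \<otimes> f B" using component_system_indep[OF S, of f] fN by blast
  have dc: "d \<in> carrier G" "d \<in> U" using d n(3) Uc by blast+
  have yc: "y \<in> carrier G" using y n(3) Uc by blast
  have fspn: "cjs (f B) (stab_mult K B) = stab_mult K B" if B: "B \<in> \<C>" for B
  proof (cases "orb B")
    case True
    note x = xx[OF True]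
    have xc: "xx B \<in> carrier G" using x Kc by blast
    have e: "cj (xx B) y \<otimes> xx B = xx B \<otimes> y" using xc yc by (simp add: word)
    have "stab_mult K B = cjs (xx B) (stab_mult K C)" using kspn[OF x(1) C] x(2) by simp
    then have "cjs (f B) (stab_mult K B) = cjs (xx B) (cjs y (stab_mult K C))"
      unfolding f_def using True cjs_cjs[of "cj (xx B) y" "xx B" "stab_mult K C"] cjs_cjs[of "xx B" y "stab_mult K C"] xc yc e spc[OF C] by simp
    then show ?thesis using y(2) kspn[OF x(1) C] x(2) by simp
  next
    case False
    then show ?thesis unfolding f_def using spc[OF B] by simp
  qed
  have dspn: "cjs d (stab_mult K B) = stab_mult K B" if B: "B \<in> \<C>" for B
  proof -
    obtain c where c: "c \<in> B" "d = c \<otimes> f B" using d(2)[OF B] by blast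
    have cc: "c \<in> carrier G" using c sC[OF B] by blast
    have "cjs d (stab_mult K B) = cjs c (cjs (f B) (stab_mult K B))" unfolding c(2) using cjs_cjs[OF cc fc spc[OF B]] by simp
    also have "\<dots> = stab_mult K B" unfolding fspn[OF B] using cjs_self[OF sp(1)[OF B]] c(1) sp(3)[OF B] by blast
    finally show ?thesis .
  qed
  define E where "E = {x \<in> N. \<forall>B\<in>\<C>. x \<in> stab_mult K B}"
  have EN: "E \<subseteq> N" unfolding E_def by blast
  have Ei: "x \<in> E" if "x \<in> N" "\<And>B. B \<in> \<C> \<Longrightarrow> x \<in> stab_mult K B" for x using that unfolding E_def by blast
  have ED: "x \<in> stab_mult K B" if "x \<in> E" "B \<in> \<C>" for x B using that unfolding E_def by blast
  have E: "subgroup E G"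
  proof (rule subgroupI)
    show "E \<subseteq> carrier G" using EN n(3) Uc by blast
    have "\<one> \<in> E" using sub_1[OF n(1)] sub_1[OF sp(1)] by (intro Ei)
    then show "E \<noteq> {}" by blast
    fix a assume a: "a \<in> E"
    show "inv a \<in> E" using a EN ED sub_i[OF n(1)] sub_i[OF sp(1)] by (intro Ei) auto
    fix b assume b: "b \<in> E"
    have N: "a \<in> N" "b \<in> N" using a b EN by auto
    show "a \<otimes> b \<in> E" using sub_m[OF n(1) N] sub_m[OF sp(1) ED[OF a] ED[OF b]] by (rule Ei)
  qed
  have EU: "E \<subseteq> U" using EN n(3) by blast
  have Ec: "E \<subseteq> carrier G" using EU Uc by blast
  have KE: "cj h e \<in> E" if h: "h \<in> K" and e: "e \<in> E" for h e
  proof (rule Ei)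
    show "cj h e \<in> N" using n(4) h e k(3) EN by blast
    fix B assume B: "B \<in> \<C>"
    have hc: "h \<in> carrier G" "inv h \<in> K" "inv h \<in> U" using h Kc sub_i[OF k(1)] k(3) by blast+
    define B' where "B' = cjs (inv h) B"
    have B': "B' \<in> \<C>" unfolding B'_def using component_systemD(3)[OF S B hc(3)] .
    have "cjs h B' = B" unfolding B'_def using hc sC[OF B] by simp
    then have "cjs h (stab_mult K B') = stab_mult K B" using kspn[OF h B'] by simp
    then show "cj h e \<in> stab_mult K B" using ED[OF e B'] by blast
  qed
  have KW: "K \<subseteq> {u \<in> U. cjs u E = E}"
  proof
    fix h assume h: "h \<in> K"
    have "cjs h E = E" by (rule cjs_eqI) (use h KE sub_i[OF k(1)] Kc Ec in auto)
    then show "h \<in> {u \<in> U. cjs u E = E}" using h k(3) by blast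
  qed
  define V where "V = K <#> E"
  note v = prod_normal_in[OF normal_in_stab[OF n(2) E EU] k(1) KW, folded V_def]
  have VU: "V \<subseteq> U" using v(4) by blast
  have dE: "cjs d E = E"
  proof (rule cjs_sub_eq[OF dc(1) Ec], rule image_subsetI, rule Ei)
    fix e assume e: "e \<in> E"
    show "cj d e \<in> N" using cj_in_subgroup[OF n(1) d(1)] e EN by blast
    show "cj d e \<in> stab_mult K B" if "B \<in> \<C>" for B using dspn[OF that] ED[OF e that] by blast
  qed
  \<comment> \<open>Checked component by component. Since \<open>d\<close> acts on \<open>B\<close>
    like a conjugate of \<open>y\<close>, comparing the components \<open>B\<close> and
    \<open>cjs h B\<close> only tests the independence of the transversal up to
    \<open>stab_mult K B\<close>.\<close>
  have comE: "cj (inv h) d \<otimes> inv d \<in> E" if h: "h \<in> K" for h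
  proof (rule Ei)
    have hc: "h \<in> carrier G" "inv h \<in> K" "inv h \<in> U" "h \<in> U" using h Kc sub_i[OF k(1)] k(3) by blast+
    show "cj (inv h) d \<otimes> inv d \<in> N" using n(4)[OF hc(3) d(1)] sub_i[OF n(1) d(1)] sub_m[OF n(1)] by blast
    fix B assume B: "B \<in> \<C>"
    define B' where "B' = cjs h B"
    have B': "B' \<in> \<C>" unfolding B'_def using component_systemD(3)[OF S B hc(4)] .
    obtain c where c: "c \<in> B" "d = c \<otimes> f B" using d(2)[OF B] by blast
    obtain c' where c': "c' \<in> B'" "d = c' \<otimes> f B'" using d(2)[OF B'] by blast
    have cc: "c \<in> carrier G" "c' \<in> carrier G" using c c' sC[OF B] sC[OF B'] by blast+
    have b: "cj (inv h) c' \<in> B" using c'(1) hc sC[OF B] unfolding B'_def by auto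
    have "\<exists>g\<in>stab_mult K B. cj (inv h) (f B') = g \<otimes> f B"
    proof (cases "orb B")
      case True
      note x = xx[OF True]
      have xc: "xx B \<in> carrier G" using x Kc by blast
      have "cjs (h \<otimes> xx B) C = B'" unfolding B'_def using cjs_cjs[of h "xx B" C] hc xc sC[OF C] x by simp
      then have T': "orb B'" unfolding orb_def by (rule bexI) (rule sub_m[OF k(1) h x(1)])
      note x' = xx[OF T']
      have x'c: "xx B' \<in> carrier G" using x' Kc by blast
      \<comment> \<open>The discrepancy between two paths from \<open>C\<close> to \<open>B\<close>.
        It stabilizes \<open>C\<close>, and \<open>y\<close> normalizes
        \<open>stab_mult K C\<close>, so the commutator of \<open>a\<close> and \<open>y\<close>
        stays there.\<close>
      define a where "a = inv (xx B) \<otimes> (inv h \<otimes> xx B')"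
      have aK: "a \<in> K" unfolding a_def
        by (rule sub_m[OF k(1) sub_i[OF k(1) x(1)] sub_m[OF k(1) hc(2) x'(1)]])
      have ac: "a \<in> carrier G" using aK Kc by blast
      have "cjs a C = cjs (inv (xx B)) (cjs (inv h) (cjs (xx B') C))" 
        unfolding a_def using xc x'c hc sC[OF C] by (simp add: cjs_cjs)
      also have "cjs (inv h) (cjs (xx B') C) = B" unfolding x'(2) unfolding B'_def using hc sC[OF B] by simp
      also have "cjs (inv (xx B)) B = C" using cjs_inv_eq[OF xc sC(2)[OF C] x(2)] .
      finally have aC: "a \<in> stabil K C" using aK by (intro stabilI)
      have aF: "a \<in> stab_mult K C" using aC sp(2)[OF C] by blast
      have "cj y (inv a) \<in> stab_mult K C" using y(2) sub_i[OF sp(1)[OF C] aF] by blast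
      then have g: "a \<otimes> cj y (inv a) \<in> stab_mult K C" using aF sub_m[OF sp(1)[OF C]] by blast
      have "cj (inv h) (f B') = cj (inv h \<otimes> xx B') y" unfolding f_def using T' hc x'c yc by (simp add: cj_cj)
      also have "inv h \<otimes> xx B' = xx B \<otimes> a" unfolding a_def using xc x'c hc by simp
      also have "cj (xx B \<otimes> a) y = cj (xx B) (a \<otimes> cj y (inv a)) \<otimes> f B"
        unfolding f_def using True xc ac yc by (simp add: word)
      finally have "cj (inv h) (f B') = cj (xx B) (a \<otimes> cj y (inv a)) \<otimes> f B" .
      moreover have "cj (xx B) (a \<otimes> cj y (inv a)) \<in> stab_mult K B"
        using imageI[OF g, of "cj (xx B)"] unfolding kspn[OF x(1) C] x(2) .
      ultimately show ?thesis by blast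
    next
      case False
      have "\<not> orb B'"
      proof
        assume "orb B'"
        then obtain g where g: "g \<in> K" "cjs g C = B'" unfolding orb_def by blast
        have gc: "g \<in> carrier G" using g Kc by blast
        have "cjs (inv h \<otimes> g) C = B" using cjs_cjs[of "inv h" g C] hc gc sC[OF C] sC[OF B] g(2) unfolding B'_def by auto
        then have "orb B" unfolding orb_def by (rule bexI) (rule sub_m[OF k(1) hc(2) g(1)])
        then show False using False by contradiction
      qed
      then have "cj (inv h) (f B') = \<one> \<otimes> f B" unfolding f_def using False hc by simp
      then show ?thesis using sub_1[OF sp(1)[OF B]] by blast
    qed
    then obtain g where g: "g \<in> stab_mult K B" "cj (inv h) (f B') = g \<otimes> f B" by blast
    have gc: "g \<in> carrier G" using g spc[OF B] by blast
    have "cj (inv h) d = cj (inv h) c' \<otimes> (g \<otimes> f B)"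
      using cj_mult[of "inv h" c' "f B'"] hc cc fc g(2) c'(2) by simp
    then have "cj (inv h) d \<otimes> inv d = cj (inv h) c' \<otimes> g \<otimes> inv c"
      unfolding c(2) using cc gc fc hc by (simp add: m_assoc inv_mult_group)
    moreover have "cj (inv h) c' \<otimes> g \<otimes> inv c \<in> stab_mult K B"
      using b g c sp(3)[OF B] sub_m[OF sp(1)[OF B]] sub_i[OF sp(1)[OF B]] by (meson subsetD)
    ultimately show "cj (inv h) d \<otimes> inv d \<in> stab_mult K B" by simp
  qed
  have dV: "cjs d V = V"
  proof (rule cjs_sub_eq[OF dc(1)])
    show "V \<subseteq> carrier G" using VU Uc by blast
    show "cjs d V \<subseteq> V"
    proof (rule image_subsetI)
      fix v assume "v \<in> V"
      then obtain h e where h: "h \<in> K" "e \<in> E" "v = h \<otimes> e" unfolding V_def by (rule mult_memE)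
      have hc: "h \<in> carrier G" "e \<in> carrier G" using h Kc Ec by blast+
      have "cj d v = h \<otimes> (cj (inv h) d \<otimes> inv d \<otimes> cj d e)" unfolding h(3) using hc dc by (simp add: word)
      moreover have "cj (inv h) d \<otimes> inv d \<otimes> cj d e \<in> E" using comE[OF h(1)] dE h(2) sub_m[OF E] by blast
      ultimately show "cj d v \<in> V" unfolding V_def using h(1) mult_memI by metis
    qed
  qed
  have "nilpotent_mod E {\<one>}"
  proof (rule component_system_nilpotent_mod[OF S E EN])
    show "\<exists>F. E \<subseteq> F \<and> nilpotent_mod F B" if "B \<in> \<C>" for B using ED that sp(5)[OF that k(4)] by blast
  qed
  moreover have "nilpotent_mod V E" unfolding V_def using nilpotent_mod_mult[OF normal_in_stab[OF n(2) E EU] k(1) KW k(4)] sub_1[OF E] by blast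
  moreover have cV: "carter_mod V {\<one>} K" using carter_mod_restrict[OF K v(2) VU] .
  moreover have "carter_mod V {\<one>} (cjs d K)" using carter_mod_cjs[OF dc(1) cV v(1)] dV dc by simp
  ultimately obtain g where g: "g \<in> V" "cjs d K = cjs g K"
    using metanil_carter_mod_conj[OF normal_in_one[OF v(1)] v(5)] sub_1[OF E] by blast
  have gc: "g \<in> carrier G" "g \<in> U" using g VU Uc by blast+
  have "cjs (inv g \<otimes> d) K = K" using cjs_cjs[of "inv g" d K] gc dc Kc g(2) by simp
  moreover have "inv g \<otimes> d \<in> U" using gc dc sub_i[OF n(2)] sub_m[OF n(2)] by blast
  ultimately have "inv g \<otimes> d \<in> V" using k(5) v(2) by blast
  then have "g \<otimes> (inv g \<otimes> d) \<in> V" using g sub_m[OF v(1)] by blast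
  then have "d \<in> V" using gc dc by simp
  then obtain h e where h: "h \<in> K" "e \<in> E" "d = h \<otimes> e" unfolding V_def by (rule mult_memE)
  have hc: "h \<in> carrier G" "e \<in> carrier G" using h Kc Ec by blast+
  have "h = d \<otimes> inv e" using h hc by (simp add: m_assoc)
  then have hN: "h \<in> N" using d(1) h(2) EN sub_i[OF n(1)] sub_m[OF n(1)] by blast
  \<comment> \<open>In general \<open>K\<close> permutes the components, but \<open>h\<close> also
    lies in \<open>N\<close>, which fixes each of them.\<close>
  have "h \<in> stab_mult K C" using stabilI[OF h(1) component_systemD(4)[OF S C hN]] sp(2)[OF C] by blast
  then have dF: "d \<in> stab_mult K C" unfolding h(3) using ED[OF h(2) C] sub_m[OF sp(1)[OF C]] by blast
  obtain c where c: "c \<in> C" "d = c \<otimes> f C" using d(2)[OF C] by blast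
  have cc: "c \<in> carrier G" using c sC[OF C] by blast
  have "inv c \<otimes> d \<in> stab_mult K C" using dF c(1) sp(3)[OF C] sub_i[OF sp(1)[OF C]] sub_m[OF sp(1)[OF C]] by blast
  then have fF: "f C \<in> stab_mult K C" unfolding c(2) using cc fc by simp
  have "cjs \<one> C = C" using sC[OF C] by simp
  then have oC: "orb C" unfolding orb_def using sub_1[OF k(1)] by blast
  note x = xx[OF oC]
  have xc: "xx C \<in> carrier G" using x Kc by blast
  have "xx C \<in> stab_mult K C" using stabilI[OF x] sp(2)[OF C] by blast
  then have "cj (inv (xx C)) (f C) \<in> stab_mult K C" using cj_in_subgroup[OF sp(1)[OF C]] sub_i[OF sp(1)[OF C]] fF by blast
  then show ?thesis unfolding f_def using oC xc yc by simp
qed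

text \<open>Since \<open>N\<close> fixes every component, an element of \<open>U = K N\<close>
  stabilizes \<open>C\<close> exactly when its \<open>K\<close>-part does.\<close>

lemma stab_mult_decomp:
  assumes S: "component_system U N \<C>" and K: "subgroup K G" "K \<subseteq> U" and KN: "K <#> N = U" and C: "C \<in> \<C>" and a: "a \<in> stab_mult U C"
  shows "\<exists>n\<in>N. \<exists>l\<in>stab_mult K C. a = n \<otimes> l"
proof -
  note n = normal_inD[OF component_systemD(1)[OF S]]
  have Cc: "C \<subseteq> carrier G" using component_systemD(2)[OF S C] subgroup.subset by blast
  obtain u c where u: "u \<in> U" "cjs u C = C" "c \<in> C" "a = u \<otimes> c" using a by (rule stab_multE)
  obtain k m where k: "k \<in> K" "m \<in> N" "u = k \<otimes> m" using u(1) KN by (blast elim: mult_memE)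
  have cc: "k \<in> carrier G" "m \<in> carrier G" "c \<in> carrier G" using k u n(1) K(1) Cc subgroupD by blast+
  have "cjs u C = cjs k (cjs m C)" unfolding k(3) using cjs_cjs[OF cc(1,2) Cc] by simp
  then have kC: "cjs k C = C" using u(2) component_systemD(4)[OF S C k(2)] by simp
  have "a = cj k m \<otimes> (k \<otimes> c)" unfolding u(4) k(3) using cc by (simp add: word)
  moreover have "cj k m \<in> N" using n(4) k K(2) by blast
  ultimately show ?thesis using stab_multI[OF k(1) kC u(3)] by blast
qed

lemma component_carter_mod:
  assumes S: "component_system U N \<C>" and K: "carter_mod U {\<one>} K" and KN: "K <#> N = U" and C: "C \<in> \<C>"
  shows "carter_mod (stab_mult U C) C (stab_mult K C)"
proof -
  note k = carter_modD[OF K] and n = normal_inD[OF component_systemD(1)[OF S]]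
  note sp = stab_mult_props[OF k(1) component_systemD(2)[OF S C]]
  have "x \<in> stab_mult K C" if x: "x \<in> stab_mult U C" "cjs x (stab_mult K C) = stab_mult K C" for x
  proof -
    obtain m l where m: "m \<in> N" "l \<in> stab_mult K C" "x = m \<otimes> l" using stab_mult_decomp[OF S k(1,3) KN C x(1)] by blast
    have cc: "m \<in> carrier G" "l \<in> carrier G" using m n(1) sp(1) subgroupD by blast+
    have "cjs x (stab_mult K C) = cjs m (cjs l (stab_mult K C))" unfolding m(3) using cjs_cjs[OF cc subgroup.subset[OF sp(1)]] by simp
    then have "cjs m (stab_mult K C) = stab_mult K C" using x(2) cjs_self[OF sp(1) m(2)] by simp
    then have "m \<in> stab_mult K C" using component_self_normalizing[OF S K C m(1)] by blast
    then show ?thesis unfolding m(3) using sub_m[OF sp(1)] m(2) by blast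
  qed
  then show ?thesis using sp(1,3) sp(5)[OF k(4)] stab_mult_mono[OF k(3)] unfolding carter_mod_def by blast
qed

section \<open>Tuples of Carter subgroups of the components\<close>

text \<open>The form in which condition (C) enters. Ranging over all \<open>Y\<close> between
  \<open>N\<close> and \<open>U\<close> makes it pass to smaller groups, as induction and the
  Frattini argument require.\<close>

definition components_conjugate :: "'a set \<Rightarrow> 'a set \<Rightarrow> 'a set set \<Rightarrow> bool" where
  "components_conjugate U N \<C> \<longleftrightarrow> (\<forall>Y C L M. subgroup Y G \<and> N \<subseteq> Y \<and> Y \<subseteq> U \<and> C \<in> \<C> \<and>
     carter_mod (stab_mult Y C) C L \<and> carter_mod (stab_mult Y C) C M \<longrightarrow> (\<exists>a\<in>stab_mult Y C. M = cjs a L))"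

lemma component_system_restrict:
  assumes "component_system U N \<C>" "subgroup Y G" "N \<subseteq> Y" "Y \<subseteq> U"
  shows "component_system Y N \<C>"
proof -
  note d = assms(1)[unfolded component_system_def]
  show ?thesis unfolding component_system_def
  proof (intro conjI)
    show "normal_in N Y" using normal_in_sub[OF component_systemD(1)[OF assms(1)] assms(2-4)] .
    show "\<forall>C\<in>\<C>. subgroup C G \<and> (\<forall>u\<in>Y. cjs u C \<in> \<C>) \<and> (\<forall>n\<in>N. cjs n C = C)"
      using d[THEN conjunct2, THEN conjunct1] assms(4) by blast
  qed (rule d[THEN conjunct2, THEN conjunct2, THEN conjunct1] d[THEN conjunct2, THEN conjunct2, THEN conjunct2])+
qed

text \<open>Let \<open>D = N C\<close>. Modulo \<open>D\<close> the group
  \<open>stab_mult U C\<close> is nilpotent, and the Frattini argument makes \<open>L D\<close> a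
  Carter subgroup modulo \<open>D\<close>, so \<open>L D\<close> is everything.\<close>

lemma carter_mod_stab_mult_decomp:
  assumes S: "component_system U N \<C>" and nU: "nilpotent_mod U N" and H: "components_conjugate U N \<C>" and C: "C \<in> \<C>"
    and L: "carter_mod (stab_mult U C) C L" and a: "a \<in> stab_mult U C"
  shows "\<exists>n\<in>N. \<exists>l\<in>L. a = n \<otimes> l"
proof -
  note n = normal_inD[OF component_systemD(1)[OF S]] and l = carter_modD[OF L]
  have sC: "subgroup C G" using component_systemD(2)[OF S C] .
  have Cc: "C \<subseteq> carrier G" using sC subgroup.subset by blast
  note sp = stab_mult_props[OF n(2) sC]
  have sN: "stabil N C = N" unfolding stabil_def using component_systemD(4)[OF S C] by blast
  define D where "D = stab_mult N C"
  have Di: "D = N <#> C" unfolding D_def stab_mult_def sN ..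
  note d = stab_mult_props[OF n(1) sC, folded D_def]
  define T where "T = stabil U C"
  have T: "subgroup T G" unfolding T_def using stabil_subgroup[OF n(2) Cc] .
  have NT: "N \<subseteq> T" unfolding T_def stabil_def using component_systemD(4)[OF S C] n(3) by blast
  have TU: "T \<subseteq> U" unfolding T_def stabil_def by blast
  have Tc: "x \<in> carrier G" if "x \<in> T" for x using that T subgroupD by blast
  have Cc': "x \<in> carrier G" if "x \<in> C" for x using that Cc by blast
  have spT: "stab_mult U C = T <#> C" unfolding stab_mult_def T_def ..
  have ND: "N \<subseteq> D" using d(2) sN by simp
  have DS: "D \<subseteq> stab_mult U C" unfolding D_def using stab_mult_mono[OF n(3)] .
  have TD: "cj t x \<in> D" if t: "t \<in> T" and x: "x \<in> D" for t x
  proof -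
    obtain m c where m: "m \<in> N" "c \<in> C" "x = m \<otimes> c" using x unfolding Di by (rule mult_memE)
    have "cj t x = cj t m \<otimes> cj t c" unfolding m(3) using cj_mult Tc t m Cc' NT by blast
    moreover have "cj t m \<in> N" using n(4) t TU m by blast
    moreover have "cj t c \<in> C" using t m stabilD(2) unfolding T_def by blast
    ultimately show ?thesis unfolding Di using mult_memI by metis
  qed
  have Dn: "normal_in D (stab_mult U C)"
  proof -
    have "cj x y \<in> D" if x: "x \<in> stab_mult U C" and y: "y \<in> D" for x y
    proof -
      obtain t c where t: "t \<in> T" "c \<in> C" "x = t \<otimes> c" using x unfolding spT by (rule mult_memE)
      have "cj c y \<in> D" using cj_in_subgroup[OF d(1)] d(3) t y by blast
      moreover have "cj x y = cj t (cj c y)" unfolding t(3) using cj_cj Tc t Cc' y d(1) subgroupD by metis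
      ultimately show ?thesis using TD[OF t(1)] by simp
    qed
    then show ?thesis using d(1) sp(1) DS unfolding normal_in_def by blast
  qed
  have TS: "T \<subseteq> stab_mult U C" unfolding T_def using sp(2) .
  have "nilpotent_mod T N" using nilpotent_mod_sub'[OF nU TU T order_refl] .
  then have "nilpotent_mod (T <#> D) D" using nilpotent_mod_mult[OF Dn T TS _ ND] by blast
  moreover have "T <#> D = stab_mult U C"
  proof
    show "T <#> D \<subseteq> stab_mult U C" using prod_subset[OF sp(1) TS DS] .
    show "stab_mult U C \<subseteq> T <#> D" unfolding spT using mono_set_mult[OF order_refl d(3)] .
  qed
  ultimately have nD: "nilpotent_mod (stab_mult U C) D" by simp
  define J where "J = L \<inter> T"
  have J: "subgroup J G" unfolding J_def using subgroups_Inter_pair[OF l(1) T] .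
  have JU: "J \<subseteq> U" "J \<subseteq> T" unfolding J_def using TU by auto
  have Jc: "x \<in> carrier G" if "x \<in> J" for x using that JU Tc by blast
  have LJ: "\<exists>j\<in>J. \<exists>c\<in>C. x = j \<otimes> c" if x: "x \<in> L" for x
  proof -
    obtain t c where t: "t \<in> T" "c \<in> C" "x = t \<otimes> c" using x l(3) unfolding spT by (blast elim: mult_memE)
    have "t = x \<otimes> inv c" using t Tc Cc' by (simp add: m_assoc)
    then have "t \<in> L" using x t l(2) sub_i[OF l(1)] sub_m[OF l(1)] by blast
    then show ?thesis unfolding J_def using t by blast
  qed
  \<comment> \<open>Conjugacy is only available in groups of the form \<open>stab_mult Y C\<close>.
    This \<open>Y\<close>, generated by \<open>N\<close> and the part of \<open>L\<close> inside the
    stabilizer of \<open>C\<close>, brings \<open>L D\<close> into that form.\<close>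
  define Y where "Y = J <#> N"
  note y = prod_normal_in[OF component_systemD(1)[OF S] J JU(1), folded Y_def]
  have YT: "Y \<subseteq> T" unfolding Y_def using prod_subset[OF T JU(2) NT] .
  have stY: "stabil Y C = Y" using YT unfolding T_def stabil_def by blast
  have LD: "L <#> D = stab_mult Y C"
  proof
    show "L <#> D \<subseteq> stab_mult Y C"
    proof
      fix x assume "x \<in> L <#> D"
      then obtain x1 x2 where x: "x1 \<in> L" "x2 \<in> D" "x = x1 \<otimes> x2" by (rule mult_memE)
      obtain j c where j: "j \<in> J" "c \<in> C" "x1 = j \<otimes> c" using LJ[OF x(1)] by blast
      have "c \<otimes> x2 \<in> D" using j d(3) x sub_m[OF d(1)] by blast
      then obtain m e where m: "m \<in> N" "e \<in> C" "c \<otimes> x2 = m \<otimes> e" unfolding Di by (rule mult_memE)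
      have "x = j \<otimes> (c \<otimes> x2)" unfolding x(3) j(3) using Jc Cc' j x d(1) subgroupD by (simp add: m_assoc)
      also have "\<dots> = (j \<otimes> m) \<otimes> e" unfolding m(3) using Jc Cc' j m NT Tc by (simp add: m_assoc subset_iff)
      finally have "x = (j \<otimes> m) \<otimes> e" .
      moreover have "j \<otimes> m \<in> Y" unfolding Y_def using mult_memI[OF j(1) m(1)] .
      ultimately show "x \<in> stab_mult Y C" unfolding stab_mult_def stY using mult_memI m(2) by metis
    qed
    have s: "subgroup (L <#> D) G" "L \<subseteq> L <#> D" "D \<subseteq> L <#> D" using prod_normal_in[OF Dn l(1,3)] by auto
    have "J \<subseteq> L <#> D" using s(2) unfolding J_def by blast
    then have "Y \<subseteq> L <#> D" unfolding Y_def using prod_subset[OF s(1)] s(3) ND by blast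
    then show "stab_mult Y C \<subseteq> L <#> D" unfolding stab_mult_def stY using prod_subset[OF s(1)] s(3) d(3) by blast
  qed
  have Ln: "C \<subseteq> D" using d(3) .
  have "carter_mod (stab_mult U C) D (L <#> D)"
  proof (rule carter_mod_prod[OF Dn sp(4) Ln L])
    fix K' assume "carter_mod (L <#> D) C K'"
    moreover have "carter_mod (L <#> D) C L" using carter_mod_restrict[OF L] prod_normal_in[OF Dn l(1,3)] by blast
    ultimately show "\<exists>x\<in>L <#> D. K' = cjs x L"
      using H C y(1,3,4) unfolding LD components_conjugate_def by blast
  qed
  then have "L <#> D = stab_mult U C" using carter_mod_nilpotent_mod[OF _ nD Dn] by blast
  then have "a \<in> L <#> D" using a by simp
  then have "a \<in> Y <#> C" unfolding LD stab_mult_def stY .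
  then obtain x c where x: "x \<in> Y" "c \<in> C" "a = x \<otimes> c" by (rule mult_memE)
  obtain j m where j: "j \<in> J" "m \<in> N" "x = j \<otimes> m" using x(1) unfolding Y_def by (rule mult_memE)
  have "a = cj j m \<otimes> (j \<otimes> c)" unfolding x(3) j(3) using Jc Cc' j x NT Tc by (simp add: word subset_iff)
  moreover have "cj j m \<in> N" using n(4) JU j by blast
  moreover have "j \<otimes> c \<in> L" using j x l(2) sub_m[OF l(1)] unfolding J_def by blast
  ultimately show ?thesis by blast
qed

text \<open>\<open>E\<close> is \<open>N \<inter> V\<close>, so \<open>V\<close> over
  \<open>E\<close> inherits nilpotency from \<open>U\<close> over \<open>N\<close>, while
  \<open>E\<close> is nilpotent because it acts on each component through the nilpotent group
  \<open>L C\<close>.\<close>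

lemma tuple_stabilizer:
  assumes S: "component_system U N \<C>" and nU: "nilpotent_mod U N" and L: "\<And>C. C \<in> \<C> \<Longrightarrow> carter_mod (stab_mult U C) C (L C)"
    and V: "V = {u \<in> U. \<forall>C\<in>\<C>. cjs u (L C) = L (cjs u C)}" and E: "E = {n \<in> N. \<forall>C\<in>\<C>. n \<in> L C}"
  shows "subgroup V G" "V \<subseteq> U" "normal_in E V" "nilpotent_mod E {\<one>}" "nilpotent_mod V E" "component_system V E \<C>" "E \<subseteq> N"
proof -
  note n = normal_inD[OF component_systemD(1)[OF S]]
  note l = carter_modD[OF L]
  have Uc: "x \<in> carrier G" if "x \<in> U" for x using that n subgroupD by blast
  have sC: "subgroup B G" "B \<subseteq> carrier G" if "B \<in> \<C>" for B using component_systemD(2)[OF S that] subgroup.subset by blast+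
  have lc: "L B \<subseteq> carrier G" if "B \<in> \<C>" for B using l(1)[OF that] subgroup.subset by blast
  show VU: "V \<subseteq> U" unfolding V by blast
  show EN: "E \<subseteq> N" unfolding E by blast
  have VD: "cjs v (L C) = L (cjs v C)" if "v \<in> V" "C \<in> \<C>" for v C using that unfolding V by blast
  have VI: "v \<in> V" if "v \<in> U" "\<And>C. C \<in> \<C> \<Longrightarrow> cjs v (L C) = L (cjs v C)" for v using that unfolding V by blast
  show sV: "subgroup V G"
  proof (rule subgroupI)
    show "V \<subseteq> carrier G" using VU Uc by blast
    have "\<one> \<in> V" by (rule VI) (use sub_1[OF n(2)] sC lc in auto)
    then show "V \<noteq> {}" by blast
    fix a assume a: "a \<in> V"
    have aU: "a \<in> U" using a VU by blast
    have ac: "a \<in> carrier G" using aU Uc by blast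
    show "inv a \<in> V"
    proof (rule VI)
      show iU: "inv a \<in> U" using aU sub_i[OF n(2)] by blast
      fix C assume C: "C \<in> \<C>"
      define B where "B = cjs (inv a) C"
      have B: "B \<in> \<C>" unfolding B_def using component_systemD(3)[OF S C iU] .
      have "cjs a B = C" unfolding B_def using ac sC[OF C] by simp
      then have "cjs a (L B) = L C" using VD[OF a B] by simp
      then show "cjs (inv a) (L C) = L (cjs (inv a) C)" unfolding B_def[symmetric] using cjs_inv_eq[OF ac lc[OF B]] by simp
    qed
    fix b assume b: "b \<in> V"
    have bU: "b \<in> U" using b VU by blast
    have bc: "b \<in> carrier G" using bU Uc by blast
    show "a \<otimes> b \<in> V"
    proof (rule VI)
      show "a \<otimes> b \<in> U" using aU bU sub_m[OF n(2)] by blast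
      fix C assume C: "C \<in> \<C>"
      have "cjs (a \<otimes> b) (L C) = cjs a (cjs b (L C))" using cjs_cjs[OF ac bc lc[OF C]] by simp
      also have "\<dots> = L (cjs a (cjs b C))" using VD[OF b C] VD[OF a component_systemD(3)[OF S C bU]] by simp
      finally show "cjs (a \<otimes> b) (L C) = L (cjs (a \<otimes> b) C)" using cjs_cjs[OF ac bc sC(2)[OF C]] by simp
    qed
  qed
  have Nspn: "x \<in> stab_mult U C" if "x \<in> N" "C \<in> \<C>" for x C
    using stabilI[of x U C] component_systemD(4)[OF S that(2,1)] n(3) that(1) stab_mult_props(2)[OF n(2) sC(1)[OF that(2)]] by blast
  \<comment> \<open>An element of \<open>N\<close> fixes every \<open>C\<close>; lying in
    \<open>V\<close> thus means normalizing each \<open>L C\<close>, which is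
    self-normalizing.\<close>
  have EV: "E = N \<inter> V"
  proof
    show "E \<subseteq> N \<inter> V"
    proof
      fix x assume x: "x \<in> E"
      then have xN: "x \<in> N" "\<And>C. C \<in> \<C> \<Longrightarrow> x \<in> L C" unfolding E by auto
      have "x \<in> V" using xN n(3) cjs_self[OF l(1)] component_systemD(4)[OF S] by (intro VI) auto
      then show "x \<in> N \<inter> V" using xN by blast
    qed
    show "N \<inter> V \<subseteq> E"
    proof
      fix x assume x: "x \<in> N \<inter> V"
      have "x \<in> L C" if C: "C \<in> \<C>" for C
      proof (rule l(5)[OF C])
        show "x \<in> stab_mult U C" using Nspn x C by blast
        show "cjs x (L C) = L C" using VD[of x C] x C component_systemD(4)[OF S C] by simp
      qed
      then show "x \<in> E" unfolding E using x by blast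
    qed
  qed
  show nE: "normal_in E V" unfolding EV using normal_in_restrict[OF component_systemD(1)[OF S] sV VU] .
  show "nilpotent_mod V E" unfolding EV using nilpotent_mod_sub[OF nU VU sV] .
  show "nilpotent_mod E {\<one>}"
  proof (rule component_system_nilpotent_mod[OF S normal_inD(1)[OF nE] EN])
    show "\<exists>F. E \<subseteq> F \<and> nilpotent_mod F C" if "C \<in> \<C>" for C using that l(4)[OF that] unfolding E by blast
  qed
  show "component_system V E \<C>" unfolding component_system_def
  proof (intro conjI nE ballI allI impI)
    fix C assume C: "C \<in> \<C>"
    show "subgroup C G" using sC[OF C] by blast
    show "cjs u C \<in> \<C>" if "u \<in> V" for u using component_systemD(3)[OF S C] that VU by blast
    show "cjs x C = C" if "x \<in> E" for x using component_systemD(4)[OF S C] that EN by blast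
  next
    fix f assume f: "\<forall>C\<in>\<C>. f C \<in> E"
    obtain x where x: "x \<in> N" "\<And>C. C \<in> \<C> \<Longrightarrow> \<exists>c\<in>C. x = c \<otimes> f C" using component_system_indep[OF S, of f] f EN by blast
    \<comment> \<open>Independence survives because membership in \<open>E\<close> is a condition on
      each component separately, and \<open>C\<close> lies in \<open>L C\<close>.\<close>
    have "x \<in> L C" if C: "C \<in> \<C>" for C
    proof -
      obtain c where "c \<in> C" "x = c \<otimes> f C" using x(2)[OF C] by blast
      then show ?thesis using f C l(2)[OF C] sub_m[OF l(1)[OF C]] unfolding E by blast
    qed
    then show "\<exists>n\<in>E. \<forall>C\<in>\<C>. \<exists>c\<in>C. n = c \<otimes> f C" unfolding E using x by blast
  next
    fix x assume "x \<in> E" "\<forall>C\<in>\<C>. x \<in> C"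
    then show "x = \<one>" using component_systemD(5)[OF S] EN by blast
  qed
qed

text \<open>By conjugacy in the metanilpotent group \<open>K E\<close>, the image of \<open>K\<close> is self-normalizing in
  \<open>V / E\<close>, which is nilpotent.\<close>

lemma metanil_supplement:
  assumes E: "normal_in E V" and n: "nilpotent_mod E {\<one>}" "nilpotent_mod V E" and K: "carter_mod V {\<one>} K"
  shows "K <#> E = V"
proof -
  note e = normal_inD[OF E] and k = carter_modD[OF K]
  note p = prod_normal_in[OF E k(1,3)]
  have 1: "{\<one>} \<subseteq> E" using sub_1[OF e(1)] by blast
  have "carter_mod V E (K <#> E)"
  proof (rule carter_mod_prod[OF E normal_in_one[OF e(2)] 1 K])
    fix K' assume "carter_mod (K <#> E) {\<one>} K'"
    then show "\<exists>x\<in>K <#> E. K' = cjs x K"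
      using metanil_carter_mod_conj[OF normal_in_one[OF p(1)] p(5) 1 n(1) nilpotent_mod_mult[OF E k(1,3,4) 1] carter_mod_restrict[OF K p(2,4)]] by blast
  qed
  then show ?thesis using carter_mod_nilpotent_mod n(2) E by blast
qed

section \<open>Existence and conjugacy over a component system\<close>

text \<open>For a Carter subgroup \<open>K\<close> of \<open>V\<close> to be self-normalizing in all
  of \<open>U\<close>, its image on each component has to fill \<open>L C\<close>; then whatever
  normalizes \<open>K\<close> respects the whole tuple up to an element of \<open>K\<close>.\<close>

theorem component_system_carter_mod_ex:
  assumes S: "component_system U N \<C>" and nU: "nilpotent_mod U N" and H: "components_conjugate U N \<C>"
    and ex: "\<And>C. C \<in> \<C> \<Longrightarrow> \<exists>L. carter_mod (stab_mult U C) C L"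
  shows "\<exists>K. carter_mod U {\<one>} K"
proof -
  note n = normal_inD[OF component_systemD(1)[OF S]]
  have Uc: "x \<in> carrier G" if "x \<in> U" for x using that n subgroupD by blast
  have Ucs: "U \<subseteq> carrier G" using Uc by blast
  have sC: "subgroup B G" "B \<subseteq> carrier G" if "B \<in> \<C>" for B using component_systemD(2)[OF S that] subgroup.subset by blast+
  obtain L where L: "\<And>C. C \<in> \<C> \<Longrightarrow> carter_mod (stab_mult U C) C (L C)" using ex by metis
  note l = carter_modD[OF L]
  have lc: "L B \<subseteq> carrier G" if "B \<in> \<C>" for B using l(1)[OF that] subgroup.subset by blast
  define V where "V = {u \<in> U. \<forall>C\<in>\<C>. cjs u (L C) = L (cjs u C)}"
  define E where "E = {n \<in> N. \<forall>C\<in>\<C>. n \<in> L C}"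
  note v = tuple_stabilizer[OF S nU L V_def E_def]
  have VN: "\<exists>v\<in>V. \<exists>m\<in>N. u = v \<otimes> m" if u: "u \<in> U" for u
  proof -
    have uc: "u \<in> carrier G" and iu: "inv u \<in> U" using u Uc sub_i[OF n(2)] by auto
    \<comment> \<open>Uniqueness up to conjugacy says that \<open>u\<close> moves the tuple to a
      conjugate one; by \<open>carter_mod_stab_mult_decomp\<close> the conjugating element can be
      taken from \<open>N\<close>, where choices on different components are independent.\<close>
    have "\<exists>m\<in>N. L C = cjs m (cjs u (L (cjs (inv u) C)))" if C: "C \<in> \<C>" for C
    proof -
      define B where "B = cjs (inv u) C"
      have B: "B \<in> \<C>" unfolding B_def using component_systemD(3)[OF S C iu] .
      have uB: "cjs u B = C" unfolding B_def using uc sC[OF C] by simp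
      have "carter_mod (cjs u (stab_mult U B)) (cjs u B) (cjs u (L B))"
        by (rule carter_mod_cjs[OF uc L[OF B] stab_mult_props(1)[OF n(2) sC(1)[OF B]]])
      then have c: "carter_mod (stab_mult U C) C (cjs u (L B))"
        using cjs_stab_mult[OF uc Ucs sC(2)[OF B]] uB cjs_self[OF n(2) u] by simp
      then obtain a where a: "a \<in> stab_mult U C" "cjs u (L B) = cjs a (L C)"
        using H L[OF C] n(2,3) C unfolding components_conjugate_def by blast
      obtain m x where m: "m \<in> N" "x \<in> L C" "a = m \<otimes> x" using carter_mod_stab_mult_decomp[OF S nU H C L[OF C] a(1)] by blast
      have mc: "m \<in> carrier G" "x \<in> carrier G" using m n(1) l(1)[OF C] subgroupD by blast+
      have "cjs u (L B) = cjs m (L C)"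
        unfolding a(2) m(3) using cjs_cjs[OF mc lc[OF C]] cjs_self[OF l(1)[OF C] m(2)] by simp
      then have "L C = cjs (inv m) (cjs u (L B))" using mc lc[OF C] by simp
      then show ?thesis unfolding B_def using sub_i[OF n(1) m(1)] by blast
    qed
    then obtain g where g: "\<And>C. C \<in> \<C> \<Longrightarrow> g C \<in> N \<and> L C = cjs (g C) (cjs u (L (cjs (inv u) C)))" by metis
    obtain m where m: "m \<in> N" "\<And>C. C \<in> \<C> \<Longrightarrow> \<exists>c\<in>C. m = c \<otimes> g C" using component_system_indep[OF S, of g] g by blast
    have mU: "m \<in> U" using m n(3) by blast
    have mc: "m \<in> carrier G" using mU Uc by blast
    have "m \<otimes> u \<in> V"
    proof -
      have "cjs (m \<otimes> u) (L B) = L (cjs (m \<otimes> u) B)" if B: "B \<in> \<C>" for B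
      proof -
        define C where "C = cjs u B"
        have C: "C \<in> \<C>" unfolding C_def using component_systemD(3)[OF S B u] .
        have BC: "cjs (inv u) C = B" unfolding C_def using uc sC[OF B] by simp
        obtain c where c: "c \<in> C" "m = c \<otimes> g C" using m(2)[OF C] by blast
        have cc: "c \<in> carrier G" "g C \<in> carrier G" using c sC[OF C] g[OF C] n(1) subgroupD by blast+
        have uL: "cjs u (L B) \<subseteq> carrier G" using cjs_closed[OF uc lc[OF B]] .
        have "cjs (m \<otimes> u) (L B) = cjs m (cjs u (L B))" using cjs_cjs[OF mc uc lc[OF B]] by simp
        also have "\<dots> = cjs c (cjs (g C) (cjs u (L B)))" unfolding c(2) using cjs_cjs[OF cc uL] by simp
        also have "\<dots> = cjs c (L C)" using g[OF C] unfolding BC by simp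
        also have "\<dots> = L C" using cjs_self[OF l(1)[OF C]] c(1) l(2)[OF C] by blast
        also have "C = cjs (m \<otimes> u) B" using cjs_cjs[OF mc uc sC(2)[OF B]] component_systemD(4)[OF S C m(1)] unfolding C_def by simp
        finally show ?thesis .
      qed
      then show ?thesis unfolding V_def using sub_m[OF n(2) mU u] by blast
    qed
    moreover have "u = (m \<otimes> u) \<otimes> cj (inv u) (inv m)" using uc mc by (simp add: word)
    moreover have "cj (inv u) (inv m) \<in> N" using n(4) iu sub_i[OF n(1) m(1)] by blast
    ultimately show ?thesis by blast
  qed
  have E1: "{\<one>} \<subseteq> E" using sub_1[OF normal_inD(1)[OF v(3)]] by blast
  obtain K where K: "carter_mod V {\<one>} K" using metanil_carter_mod_ex[OF normal_in_one[OF v(1)] v(3) E1 v(4,5)] by blast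
  note k = carter_modD[OF K]
  have KE: "K <#> E = V" using metanil_supplement[OF v(3,4,5) K] .
  have KU: "K \<subseteq> U" using k(3) v(2) by blast
  have Kc: "K \<subseteq> carrier G" using KU Uc by blast
  have KN: "K <#> N = U"
  proof
    show "K <#> N \<subseteq> U" using prod_subset[OF n(2) KU n(3)] .
    show "U \<subseteq> K <#> N"
    proof
      fix u assume "u \<in> U"
      then obtain w m where w: "w \<in> V" "m \<in> N" "u = w \<otimes> m" using VN by blast
      then obtain h e where h: "h \<in> K" "e \<in> E" "w = h \<otimes> e" using KE by (blast elim: mult_memE)
      have "u = h \<otimes> (e \<otimes> m)" unfolding w(3) h(3) using h w Kc n(1) v(7) subgroupD by (simp add: m_assoc subset_iff)
      moreover have "e \<otimes> m \<in> N" using h w v(7) sub_m[OF n(1)] by blast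
      ultimately show "u \<in> K <#> N" using mult_memI h(1) by metis
    qed
  qed
  note sp = stab_mult_props[OF k(1) sC(1)]
  \<comment> \<open>If the image were smaller, the normalizer condition in \<open>L C\<close> would
    give a further element normalizing it, and its \<open>N\<close>-part \<open>m\<close> would
    contradict \<open>component_self_normalizing\<close> for \<open>V\<close> and
    \<open>E\<close>.\<close>
  have FL: "stab_mult K C = L C" if C: "C \<in> \<C>" for C
  proof (rule ccontr)
    assume ne: "stab_mult K C \<noteq> L C"
    have "stabil K C \<subseteq> L C"
    proof
      fix x assume x: "x \<in> stabil K C"
      have "x \<in> V" using stabilD(1)[OF x] k(3) by blast
      then have "cjs x (L C) = L C" using stabilD(2)[OF x] C unfolding V_def by auto
      moreover have "x \<in> stab_mult U C" using sp(2)[OF C] x stab_mult_mono[OF KU] by blast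
      ultimately show "x \<in> L C" using l(5)[OF C] by blast
    qed
    then have FL: "stab_mult K C \<subseteq> L C" unfolding stab_mult_def using prod_subset[OF l(1)[OF C]] l(2)[OF C] by blast
    have "normal_in C (L C)" using normal_in_sub[OF stab_mult_props(4)[OF n(2) sC(1)[OF C]] l(1)[OF C] l(2)[OF C] l(3)[OF C]] .
    from nilpotent_mod_normalizer[OF this l(4)[OF C] sp(1)[OF C] sp(3)[OF C] FL ne]
    obtain y where y: "y \<in> L C" "y \<notin> stab_mult K C" "cjs y (stab_mult K C) = stab_mult K C" by blast
    obtain m h where m: "m \<in> N" "h \<in> stab_mult K C" "y = m \<otimes> h"
      using stab_mult_decomp[OF S k(1) KU KN C] y(1) l(3)[OF C] by blast
    have cc: "m \<in> carrier G" "h \<in> carrier G" using m n(1) sp(1)[OF C] subgroupD by blast+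
    have spc: "stab_mult K C \<subseteq> carrier G" using sp(1)[OF C] subgroup.subset by blast
    have "cjs y (stab_mult K C) = cjs m (cjs h (stab_mult K C))" unfolding m(3) using cjs_cjs[OF cc spc] by simp
    then have mF: "cjs m (stab_mult K C) = stab_mult K C" using y(3) cjs_self[OF sp(1)[OF C] m(2)] by simp
    have "m = y \<otimes> inv h" using m cc by (simp add: m_assoc)
    then have mL: "m \<in> L C" using y(1) m(2) FL sub_i[OF l(1)[OF C]] sub_m[OF l(1)[OF C]] by blast
    \<comment> \<open>To stay in \<open>E\<close>, \<open>m\<close> is replaced by an element acting
      like \<open>m\<close> on \<open>C\<close> and trivially on all other components.\<close>
    have "(if B = C then m else \<one>) \<in> N" for B using m(1) sub_1[OF n(1)] by simp
    then obtain m' where m': "m' \<in> N" "\<And>B. B \<in> \<C> \<Longrightarrow> \<exists>c\<in>B. m' = c \<otimes> (if B = C then m else \<one>)"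
      using component_system_indep[OF S, of "\<lambda>B. if B = C then m else \<one>"] by blast
    obtain c where c: "c \<in> C" "m' = c \<otimes> m" using m'(2)[OF C] by auto
    have cc': "c \<in> carrier G" using c sC[OF C] by blast
    have "m' \<in> L B" if B: "B \<in> \<C>" for B
    proof (cases "B = C")
      case True
      then show ?thesis using c mL l(2)[OF C] sub_m[OF l(1)[OF C]] by blast
    next
      case False
      then obtain c' where "c' \<in> B" "m' = c' \<otimes> \<one>" using m'(2)[OF B] by auto
      then have "m' = c'" using sC[OF B] by auto
      then show ?thesis using l(2)[OF B] \<open>c' \<in> B\<close> by blast
    qed
    then have m'E: "m' \<in> E" unfolding E_def using m'(1) by blast
    have "cjs m' (stab_mult K C) = cjs c (cjs m (stab_mult K C))" unfolding c(2) using cjs_cjs[OF cc' cc(1) spc] by simp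
    also have "\<dots> = stab_mult K C" unfolding mF using cjs_self[OF sp(1)[OF C]] sp(3)[OF C] c(1) by blast
    finally have "m' \<in> stab_mult K C" using component_self_normalizing[OF v(6) K C m'E] by blast
    then have "inv c \<otimes> m' \<in> stab_mult K C" using c(1) sp(3)[OF C] sub_i[OF sp(1)[OF C]] sub_m[OF sp(1)[OF C]] by blast
    then have "m \<in> stab_mult K C" unfolding c(2) using cc cc' by simp
    then have "y \<in> stab_mult K C" unfolding m(3) using m(2) sub_m[OF sp(1)[OF C]] by blast
    then show False using y(2) by blast
  qed
  \<comment> \<open>The \<open>N\<close>-part of a normalizing element normalizes every
    \<open>stab_mult K C = L C\<close>, so it lies in \<open>E\<close> and hence in
    \<open>V\<close>, where \<open>K\<close> is self-normalizing.\<close>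
  have "x \<in> K" if x: "x \<in> U" "cjs x K = K" for x
  proof -
    obtain h m where h: "h \<in> K" "m \<in> N" "x = h \<otimes> m" using x(1) KN by (blast elim: mult_memE)
    have cc: "h \<in> carrier G" "m \<in> carrier G" using h Kc n(1) subgroupD by blast+
    have "cjs h (cjs m K) = K" using x(2) cjs_cjs[OF cc Kc] unfolding h(3) by simp
    then have "cjs (inv h) (cjs h (cjs m K)) = cjs (inv h) K" by simp
    then have mK: "cjs m K = K" using cc Kc cjs_closed[OF cc(2) Kc] cjs_self[OF k(1) sub_i[OF k(1) h(1)]] by simp
    have "m \<in> L C" if C: "C \<in> \<C>" for C
    proof (rule l(5)[OF C])
      have "cjs m (stab_mult K C) = stab_mult K C" using cjs_stab_mult[OF cc(2) Kc sC(2)[OF C]] mK component_systemD(4)[OF S C h(2)] by simp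
      then show "cjs m (L C) = L C" unfolding FL[OF C] .
      show "m \<in> stab_mult U C"
        using stabilI[of m U C] component_systemD(4)[OF S C h(2)] h(2) n(3) stab_mult_props(2)[OF n(2) sC(1)[OF C]] by blast
    qed
    then have "m \<in> E" unfolding E_def using h(2) by blast
    then have "m \<in> V" using normal_inD(3)[OF v(3)] by blast
    then have "m \<in> K" using k(5) mK by blast
    then show ?thesis unfolding h(3) using h(1) sub_m[OF k(1)] by blast
  qed
  then have "carter_mod U {\<one>} K" using k(1,2,4) KU unfolding carter_mod_def by blast
  then show ?thesis by blast
qed

lemma component_system_carter_mod_conj_core:
  assumes S: "component_system U N \<C>" and nU: "nilpotent_mod U N" and H: "components_conjugate U N \<C>"
    and K: "carter_mod U {\<one>} K" "K <#> N = U" and L: "carter_mod U {\<one>} L" "L <#> N = U"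
  shows "\<exists>x\<in>U. L = cjs x K"
proof -
  note n = normal_inD[OF component_systemD(1)[OF S]] and k = carter_modD[OF K(1)] and l = carter_modD[OF L(1)]
  have Uc: "x \<in> carrier G" if "x \<in> U" for x using that n subgroupD by blast
  have Kc: "K \<subseteq> carrier G" "L \<subseteq> carrier G" using k(3) l(3) Uc by blast+
  have sC: "subgroup B G" "B \<subseteq> carrier G" if "B \<in> \<C>" for B using component_systemD(2)[OF S that] subgroup.subset by blast+
  have "\<exists>m\<in>N. stab_mult L C = cjs m (stab_mult K C)" if C: "C \<in> \<C>" for C
  proof -
    have cK: "carter_mod (stab_mult U C) C (stab_mult K C)" using component_carter_mod[OF S K C] .
    have cL: "carter_mod (stab_mult U C) C (stab_mult L C)" using component_carter_mod[OF S L C] .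
    obtain a where a: "a \<in> stab_mult U C" "stab_mult L C = cjs a (stab_mult K C)"
      using H cK cL n(2,3) C unfolding components_conjugate_def by blast
    obtain m x where m: "m \<in> N" "x \<in> stab_mult K C" "a = m \<otimes> x" using stab_mult_decomp[OF S k(1,3) K(2) C a(1)] by blast
    note sp = stab_mult_props(1)[OF k(1) sC(1)[OF C]]
    have mc: "m \<in> carrier G" "x \<in> carrier G" using m n(1) sp subgroupD by blast+
    have "stab_mult L C = cjs m (stab_mult K C)"
      unfolding a(2) m(3) using cjs_cjs[OF mc subgroup.subset[OF sp]] cjs_self[OF sp m(2)] by simp
    then show ?thesis using m(1) by blast
  qed
  \<comment> \<open>The conjugating elements depend on the component; independence combines them
    into one \<open>m\<close> in \<open>N\<close>.\<close>
  then obtain g where g: "\<And>C. C \<in> \<C> \<Longrightarrow> g C \<in> N \<and> stab_mult L C = cjs (g C) (stab_mult K C)" by metis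
  obtain m where m: "m \<in> N" "\<And>C. C \<in> \<C> \<Longrightarrow> \<exists>c\<in>C. m = c \<otimes> g C" using component_system_indep[OF S, of g] g by blast
  have mU: "m \<in> U" using m n(3) by blast
  have mc: "m \<in> carrier G" using mU Uc by blast
  define K' where "K' = cjs m K"
  have K': "carter_mod U {\<one>} K'" unfolding K'_def using carter_mod_cjs_in[OF mU K(1) normal_in_one[OF n(2)]] .
  note k' = carter_modD[OF K']
  have K'c: "K' \<subseteq> carrier G" using k'(3) Uc by blast
  have eq: "stab_mult K' C = stab_mult L C" if C: "C \<in> \<C>" for C
  proof -
    obtain c where c: "c \<in> C" "m = c \<otimes> g C" using m(2)[OF C] by blast
    have cc: "c \<in> carrier G" "g C \<in> carrier G" using c sC[OF C] g[OF C] n(1) subgroupD by blast+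
    note sK = stab_mult_props[OF k(1) sC(1)[OF C]] and sL = stab_mult_props[OF l(1) sC(1)[OF C]]
    have "stab_mult K' C = cjs m (stab_mult K C)" unfolding K'_def
      using cjs_stab_mult[OF mc Kc(1) sC(2)[OF C]] component_systemD(4)[OF S C m(1)] by simp
    also have "\<dots> = cjs c (cjs (g C) (stab_mult K C))" unfolding c(2) using cjs_cjs[OF cc subgroup.subset[OF sK(1)]] by simp
    also have "\<dots> = cjs c (stab_mult L C)" using g[OF C] by simp
    also have "\<dots> = stab_mult L C" using cjs_self[OF sL(1)] sL(3) c(1) by blast
    finally show ?thesis .
  qed
  define V where "V = {u \<in> U. \<forall>C\<in>\<C>. cjs u (stab_mult L C) = stab_mult L (cjs u C)}"
  define E where "E = {n \<in> N. \<forall>C\<in>\<C>. n \<in> stab_mult L C}"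
  note v = tuple_stabilizer[OF S nU component_carter_mod[OF S L] V_def E_def]
  have LV: "L \<subseteq> V"
  proof
    fix x assume x: "x \<in> L"
    then have "cjs x (stab_mult L C) = stab_mult L (cjs x C)" if "C \<in> \<C>" for C
      using cjs_stab_mult[of x L C] sC[OF that] Kc cjs_self[OF l(1) x] by auto
    then show "x \<in> V" unfolding V_def using x l(3) by blast
  qed
  have KV: "K' \<subseteq> V"
  proof
    fix x assume x: "x \<in> K'"
    then have xU: "x \<in> U" using k'(3) by blast
    have "cjs x (stab_mult L C) = stab_mult L (cjs x C)" if C: "C \<in> \<C>" for C
      using cjs_stab_mult[of x K' C] sC[OF C] K'c x cjs_self[OF k'(1) x] eq[OF C] eq[OF component_systemD(3)[OF S C xU]] by auto
    then show "x \<in> V" unfolding V_def using xU by blast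
  qed
  have E1: "{\<one>} \<subseteq> E" using sub_1[OF normal_inD(1)[OF v(3)]] by blast
  obtain y where y: "y \<in> V" "L = cjs y K'"
    using metanil_carter_mod_conj[OF normal_in_one[OF v(1)] v(3) E1 v(4,5) carter_mod_restrict[OF K' KV v(2)] carter_mod_restrict[OF L(1) LV v(2)]] by blast
  have yU: "y \<in> U" using y v(2) by blast
  have yc: "y \<in> carrier G" using yU Uc by blast
  have "L = cjs (y \<otimes> m) K" unfolding y(2) K'_def using cjs_cjs[OF yc mc Kc(1)] by simp
  then show ?thesis using sub_m[OF n(2) yU mU] by blast
qed

text \<open>Both claims need one induction: if \<open>K N\<close> were proper, conjugacy inside it
  would make it a Carter subgroup modulo \<open>N\<close> of \<open>U\<close>, which is nilpotent
  modulo \<open>N\<close>, so \<open>K N = U\<close> after all.\<close>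

theorem component_system_carter_mod_conj:
  assumes "component_system U N \<C>" "nilpotent_mod U N" "components_conjugate U N \<C>" "carter_mod U {\<one>} K"
  shows "K <#> N = U" "carter_mod U {\<one>} L \<Longrightarrow> \<exists>x\<in>U. L = cjs x K"
proof -
  have "K <#> N = U \<and> (carter_mod U {\<one>} L \<longrightarrow> (\<exists>x\<in>U. L = cjs x K))"
    using assms
  proof (induction "card U" arbitrary: U K L rule: less_induct)
    case less
    note S = less.prems(1) and nU = less.prems(2) and H = less.prems(3)
    note n = normal_inD[OF component_systemD(1)[OF S]]
    have 1: "{\<one>} \<subseteq> N" using sub_1[OF n(1)] by blast
    have sup: "K <#> N = U" if K: "carter_mod U {\<one>} K" for K
    proof (rule ccontr)
      assume ne: "K <#> N \<noteq> U"
      note k = carter_modD[OF K]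
      note p = prod_normal_in[OF component_systemD(1)[OF S] k(1,3)]
      have lt: "card (K <#> N) < card U" using p(4) ne fin_sub[OF n(2)] by (simp add: psubset_card_mono psubset_eq)
      have c: "component_system (K <#> N) N \<C>" using component_system_restrict[OF S p(1,3,4)] .
      have nn: "nilpotent_mod (K <#> N) N" using nilpotent_mod_sub'[OF nU p(4,1) order_refl] .
      have h: "components_conjugate (K <#> N) N \<C>" using H p(4) unfolding components_conjugate_def by (meson subset_trans)
      have "carter_mod U N (K <#> N)"
      proof (rule carter_mod_prod[OF component_systemD(1)[OF S] normal_in_one[OF n(2)] 1 K])
        fix K' assume "carter_mod (K <#> N) {\<one>} K'"
        then show "\<exists>x\<in>K <#> N. K' = cjs x K" using less.hyps[OF lt c nn h carter_mod_restrict[OF K p(2,4)]] by blast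
      qed
      then show False using carter_mod_nilpotent_mod[OF _ nU component_systemD(1)[OF S]] ne by blast
    qed
    show ?case using component_system_carter_mod_conj_core[OF S nU H] sup less.prems(4) by blast
  qed
  then show "K <#> N = U" "carter_mod U {\<one>} L \<Longrightarrow> \<exists>x\<in>U. L = cjs x K" by blast+
qed

end

subsection \<open>Transport along surjective homomorphisms\<close>

context group begin

lemma sub_commutator:
  assumes A: "subgroup A G" and xy: "x \<in> A" "y \<in> A"
  shows "group.commutator (G\<lparr>carrier := A\<rparr>) x y = commutator x y"
  using group.commutator_def[OF subgroup_imp_group[OF A]] m_inv_consistent[OF A] xy by (simp add: commutator_def)

lemma sub_upper_central:
  assumes A: "subgroup A G" and U: "U \<subseteq> A"
  shows "group.upper_central (G\<lparr>carrier := A\<rparr>) U M n = upper_central U M n"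
proof -
  interpret A: group "G\<lparr>carrier := A\<rparr>" using subgroup_imp_group[OF A] .
  show ?thesis
  proof (induction n)
    case (Suc n)
    have "A.commutator z x = commutator z x" if "z \<in> U" "x \<in> U" for z x using sub_commutator[OF A] that U by blast
    then show ?case using Suc by auto
  qed simp
qed

lemma sub_nilpotent_mod:
  assumes "subgroup A G" "U \<subseteq> A"
  shows "group.nilpotent_mod (G\<lparr>carrier := A\<rparr>) U M \<longleftrightarrow> nilpotent_mod U M"
  unfolding nilpotent_mod_def group.nilpotent_mod_def[OF subgroup_imp_group[OF assms(1)]] sub_upper_central[OF assms] ..

lemma lower_central_sub: "lower_central G n \<subseteq> carrier G"
proof (induction n)
  case (Suc n)
  then have "{x \<otimes> y \<otimes> inv x \<otimes> inv y | x y. x \<in> lower_central G n \<and> y \<in> carrier G} \<subseteq> carrier G" by auto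
  then show ?case using generate_incl by simp
qed simp

text \<open>The two central series are compared in opposite directions: lower term
  \<open>n - j\<close> lies in upper term \<open>j\<close> if lower term \<open>n\<close> is
  trivial, and lower term \<open>j\<close> lies in upper term \<open>n - j\<close> if upper term
  \<open>n\<close> is everything.\<close>

lemma nilpotent_group_iff: "nilpotent_group G \<longleftrightarrow> nilpotent_mod (carrier G) {\<one>}"
proof
  have M: "normal_in {\<one>} (carrier G)" using normal_in_one[OF subgroup_self] .
  have L: "commutator x y \<in> lower_central G (Suc k)" if "x \<in> lower_central G k" "y \<in> carrier G" for x y k
    using that by (auto simp: commutator_def intro!: generate.incl)
  assume "nilpotent_group G"
  then obtain n where n: "lower_central G n = {\<one>}" unfolding nilpotent_group_def by blast
  have "lower_central G (n - j) \<subseteq> upper_central (carrier G) {\<one>} j" if "j \<le> n" for j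
    using that
  proof (induction j)
    case (Suc j)
    have e: "n - j = Suc (n - Suc j)" using Suc.prems by simp
    have IH: "lower_central G (Suc (n - Suc j)) \<subseteq> upper_central (carrier G) {\<one>} j" using Suc by (simp only: e[symmetric])
    show ?case
    proof
      fix x assume x: "x \<in> lower_central G (n - Suc j)"
      have "commutator x y \<in> upper_central (carrier G) {\<one>} j" if "y \<in> carrier G" for y using L[OF x that] IH by blast
      then show "x \<in> upper_central (carrier G) {\<one>} (Suc j)" using x lower_central_sub by auto
    qed
  qed (simp add: n)
  from this[of n] show "nilpotent_mod (carrier G) {\<one>}" unfolding nilpotent_mod_def by auto
next
  have M: "normal_in {\<one>} (carrier G)" using normal_in_one[OF subgroup_self] .
  assume "nilpotent_mod (carrier G) {\<one>}"
  then obtain n where n: "carrier G \<subseteq> upper_central (carrier G) {\<one>} n" unfolding nilpotent_mod_def by blast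
  have "lower_central G j \<subseteq> upper_central (carrier G) {\<one>} (n - j)" if "j \<le> n" for j
    using that
  proof (induction j)
    case 0 show ?case using n by simp
  next
    case (Suc j)
    have e: "n - j = Suc (n - Suc j)" using Suc.prems by simp
    have IH: "lower_central G j \<subseteq> upper_central (carrier G) {\<one>} (Suc (n - Suc j))" using Suc by (simp only: e[symmetric])
    have "{x \<otimes> y \<otimes> inv x \<otimes> inv y | x y. x \<in> lower_central G j \<and> y \<in> carrier G} \<subseteq> upper_central (carrier G) {\<one>} (n - Suc j)"
      using IH by (auto simp: commutator_def)
    then show ?case using generate_subgroup_incl[OF _ normal_inD(1)[OF upper_central_normal_in[OF M]]] by simp
  qed
  from this[of n] have 1: "lower_central G n \<subseteq> {\<one>}" by simp
  have "\<one> \<in> lower_central G n" by (cases n) (auto intro: generate.one)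
  with 1 have "lower_central G n = {\<one>}" by blast
  then show "nilpotent_group G" unfolding nilpotent_group_def using is_group by blast
qed

lemma nilpotent_subgroup_iff: "nilpotent_subgroup K G \<longleftrightarrow> subgroup K G \<and> nilpotent_mod K {\<one>}"
proof (cases "subgroup K G")
  case True
  interpret K: group "G\<lparr>carrier := K\<rparr>" using subgroup_imp_group[OF True] .
  show ?thesis unfolding nilpotent_subgroup_def using True K.nilpotent_group_iff sub_nilpotent_mod[OF True order_refl] by simp
qed (simp add: nilpotent_subgroup_def)

lemma carter_iff: "carter_subgroup K G \<longleftrightarrow> carter_mod (carrier G) {\<one>} K"
proof (cases "subgroup K G")
  case True
  have Kc: "K \<subseteq> carrier G" using True subgroup.subset by blast
  have "K \<subseteq> {x \<in> carrier G. cjs x K = K}" using cjs_self[OF True] Kc by blast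
  then have "{x \<in> carrier G. cjs x K = K} = K \<longleftrightarrow> (\<forall>x\<in>carrier G. cjs x K = K \<longrightarrow> x \<in> K)" by blast
  then show ?thesis
    unfolding carter_subgroup_def carter_mod_def nilpotent_subgroup_iff normalizer_eq[OF Kc] using True Kc sub_1[OF True] by auto
qed (simp add: carter_subgroup_def carter_mod_def nilpotent_subgroup_def)

lemma lr_coset_cjs: "g <# K #> inv g = cjs g K"
  by (auto simp: l_coset_def r_coset_def cj_def)

lemma carter_conjugate_iff:
  "carter_conjugate G \<longleftrightarrow> (\<forall>K L. carter_mod (carrier G) {\<one>} K \<and> carter_mod (carrier G) {\<one>} L \<longrightarrow> (\<exists>g\<in>carrier G. L = cjs g K))"
  unfolding carter_conjugate_def carter_iff lr_coset_cjs ..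

end

text \<open>The homomorphism is defined on a subgroup only, since a normalizer acts on
  \<open>T\<close> but the ambient group need not. Projections onto quotients and maps to
  automorphism groups are instances; \<open>ker\<close> is the group over which Carter subgroups of
  \<open>H\<close> are read inside \<open>G\<close>.\<close>

locale surj_hom = fin_group G + H: group H for G (structure) and H +
  fixes A h
  assumes subA: "subgroup A G" and hom: "h \<in> hom (G\<lparr>carrier := A\<rparr>) H" and surj: "h ` A = carrier H"
begin

definition ker where "ker = {x \<in> A. h x = \<one>\<^bsub>H\<^esub>}"

definition pre where "pre L = {x \<in> A. h x \<in> L}"

sublocale A: group "G\<lparr>carrier := A\<rparr>" using subgroup_imp_group[OF subA] .

sublocale gh: group_hom "G\<lparr>carrier := A\<rparr>" H h
  by unfold_locales (rule hom)

lemma A_carrier: "x \<in> A \<Longrightarrow> x \<in> carrier G"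
  using subA subgroupD by blast

lemma h_closed: "x \<in> A \<Longrightarrow> h x \<in> carrier H"
  using surj by blast

lemma h_mult: "x \<in> A \<Longrightarrow> y \<in> A \<Longrightarrow> h (x \<otimes> y) = h x \<otimes>\<^bsub>H\<^esub> h y"
  using gh.hom_mult by simp

lemma h_inv: "x \<in> A \<Longrightarrow> h (inv x) = inv\<^bsub>H\<^esub> h x"
  using gh.hom_inv m_inv_consistent[OF subA] by simp

lemma h_one: "h \<one> = \<one>\<^bsub>H\<^esub>"
  using gh.hom_one by simp

lemma h_cj: "x \<in> A \<Longrightarrow> y \<in> A \<Longrightarrow> h (cj x y) = H.cj (h x) (h y)"
  by (simp add: cj_def H.cj_def h_mult h_inv sub_m[OF subA] sub_i[OF subA])

lemma h_cjs: "x \<in> A \<Longrightarrow> L \<subseteq> A \<Longrightarrow> h ` cjs x L = H.cjs (h x) (h ` L)"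
  unfolding image_image by (rule image_cong) (auto simp: h_cj)

lemma ker_normal_in: "normal_in ker A"
proof -
  have "subgroup ker G"
  proof (rule subgroupI)
    show "ker \<subseteq> carrier G" using A_carrier unfolding ker_def by blast
    have "\<one> \<in> ker" unfolding ker_def using sub_1[OF subA] h_one by simp
    then show "ker \<noteq> {}" by blast
    fix a assume a: "a \<in> ker"
    show "inv a \<in> ker" using a h_inv sub_i[OF subA] unfolding ker_def by simp
    fix b assume b: "b \<in> ker"
    show "a \<otimes> b \<in> ker" using a b h_mult sub_m[OF subA] unfolding ker_def by simp
  qed
  moreover have "cj x m \<in> ker" if "x \<in> A" "m \<in> ker" for x m
    using that h_cj[of x m] cj_in_subgroup[OF subA] h_closed unfolding ker_def by simp
  ultimately show ?thesis using subA unfolding normal_in_def ker_def by blast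
qed

lemma image_subgroup: "subgroup L G \<Longrightarrow> L \<subseteq> A \<Longrightarrow> subgroup (h ` L) H"
  using gh.subgroup_img_is_subgroup subgroup_incl[OF _ subA] by blast

lemma pre_subgroup:
  assumes "subgroup L H"
  shows "subgroup (pre L) G"
proof (rule subgroupI)
  show "pre L \<subseteq> carrier G" using A_carrier unfolding pre_def by blast
  have "\<one> \<in> pre L" unfolding pre_def using sub_1[OF subA] h_one H.sub_1[OF assms] by simp
  then show "pre L \<noteq> {}" by blast
  fix a assume a: "a \<in> pre L"
  show "inv a \<in> pre L" using a h_inv sub_i[OF subA] H.sub_i[OF assms] unfolding pre_def by simp
  fix b assume b: "b \<in> pre L"
  show "a \<otimes> b \<in> pre L" using a b h_mult sub_m[OF subA] H.sub_m[OF assms] unfolding pre_def by simp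
qed

lemma image_pre: "L \<subseteq> carrier H \<Longrightarrow> h ` pre L = L"
proof (rule subset_antisym)
  assume L: "L \<subseteq> carrier H"
  show "h ` pre L \<subseteq> L" unfolding pre_def by blast
  show "L \<subseteq> h ` pre L"
  proof
    fix y assume y: "y \<in> L"
    then have "y \<in> h ` A" using surj L by blast
    then show "y \<in> h ` pre L" unfolding pre_def using y by blast
  qed
qed

lemma pre_sub: "pre L \<subseteq> A"
  unfolding pre_def by blast

lemma ker_pre: "subgroup L H \<Longrightarrow> ker \<subseteq> pre L"
  unfolding ker_def pre_def using H.sub_1 by auto

lemma pre_image:
  assumes L: "subgroup L G" "ker \<subseteq> L" "L \<subseteq> A"
  shows "pre (h ` L) = L"
proof
  show "L \<subseteq> pre (h ` L)" unfolding pre_def using L by blast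
  show "pre (h ` L) \<subseteq> L"
  proof
    fix x assume "x \<in> pre (h ` L)"
    then obtain l where l: "x \<in> A" "l \<in> L" "h x = h l" unfolding pre_def by blast
    have lA: "l \<in> A" using l L by blast
    have "h (x \<otimes> inv l) = h x \<otimes>\<^bsub>H\<^esub> inv\<^bsub>H\<^esub> h l" using h_mult[OF l(1) sub_i[OF subA lA]] h_inv[OF lA] by simp
    then have "x \<otimes> inv l \<in> ker" unfolding ker_def using l lA h_closed sub_i[OF subA] sub_m[OF subA] by simp
    then have "x \<otimes> inv l \<otimes> l \<in> L" using L l sub_m[OF L(1)] by blast
    then show "x \<in> L" using l lA A_carrier by (simp add: m_assoc)
  qed
qed

lemma carter_mod_image:
  assumes L: "carter_mod A ker L"
  shows "H.carter_mod (carrier H) {\<one>\<^bsub>H\<^esub>} (h ` L)"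
proof -
  note l = carter_modD[OF L]
  have Lc: "L \<subseteq> carrier G" using l subgroup.subset by blast
  have kA: "ker \<subseteq> A" using normal_inD(3)[OF ker_normal_in] .
  have s: "subgroup (h ` L) H" using image_subgroup l by blast
  have "A.nilpotent_mod L ker" using l(4) sub_nilpotent_mod[OF subA l(3)] by simp
  then have "H.nilpotent_mod (h ` L) (h ` ker)" using gh.nilpotent_mod_image[of L ker] l(3) kA by simp
  moreover have "h ` ker \<subseteq> {\<one>\<^bsub>H\<^esub>}" unfolding ker_def by blast
  ultimately have n: "H.nilpotent_mod (h ` L) {\<one>\<^bsub>H\<^esub>}" using H.nilpotent_mod_mono by blast
  have "y \<in> h ` L" if y: "y \<in> carrier H" "H.cjs y (h ` L) = h ` L" for y
  proof -
    obtain x where x: "x \<in> A" "y = h x" using y(1) surj by blast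
    have "cjs x L \<subseteq> pre (h ` L)"
    proof (rule image_subsetI)
      fix l' assume l': "l' \<in> L"
      have "h (cj x l') = H.cj y (h l')" using h_cj[OF x(1), of l'] l' l(3) x(2) by blast
      then have "h (cj x l') \<in> h ` L" using y(2) l' by blast
      moreover have "cj x l' \<in> A" using cj_in_subgroup[OF subA x(1)] l' l(3) by blast
      ultimately show "cj x l' \<in> pre (h ` L)" unfolding pre_def by blast
    qed
    then have "cjs x L = L" unfolding pre_image[OF l(1,2,3)] using cjs_sub_eq[OF A_carrier[OF x(1)] Lc] by blast
    then show ?thesis using l(5)[OF x(1)] x(2) by blast
  qed
  then show ?thesis unfolding H.carter_mod_def using s n H.sub_1[OF s] subgroup.subset[OF s] by blast
qed

lemma carter_mod_pre:
  assumes L: "H.carter_mod (carrier H) {\<one>\<^bsub>H\<^esub>} L"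
  shows "carter_mod A ker (pre L)"
proof -
  have s: "subgroup L H" and n: "H.nilpotent_mod L {\<one>\<^bsub>H\<^esub>}" and N: "\<And>y. y \<in> carrier H \<Longrightarrow> H.cjs y L = L \<Longrightarrow> y \<in> L"
    using L unfolding H.carter_mod_def by auto
  have Lc: "L \<subseteq> carrier H" using s subgroup.subset by blast
  have p: "subgroup (pre L) G" using pre_subgroup[OF s] .
  have "H.nilpotent_mod (h ` pre L) {\<one>\<^bsub>H\<^esub>}" using n image_pre[OF Lc] by simp
  moreover have "x \<in> ker" if "x \<in> pre L" "h x \<in> {\<one>\<^bsub>H\<^esub>}" for x using that unfolding pre_def ker_def by blast
  ultimately have "A.nilpotent_mod (pre L) ker"
    using gh.nilpotent_mod_preimage[OF subgroup_incl[OF p subA pre_sub]] by blast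
  then have n': "nilpotent_mod (pre L) ker" using sub_nilpotent_mod[OF subA pre_sub] by simp
  have "x \<in> pre L" if x: "x \<in> A" "cjs x (pre L) = pre L" for x
  proof -
    have "H.cjs (h x) L = L" using h_cjs[OF x(1) pre_sub, of L] x(2) image_pre[OF Lc] by simp
    then show ?thesis unfolding pre_def using N[OF h_closed[OF x(1)]] x(1) by blast
  qed
  then show ?thesis unfolding carter_mod_def using p ker_pre[OF s] pre_sub n' by blast
qed

lemma carter_mod_ex_iff: "(\<exists>L. carter_mod A ker L) \<longleftrightarrow> (\<exists>L. carter_subgroup L H)"
  unfolding H.carter_iff using carter_mod_image carter_mod_pre by blast

lemma carter_mod_conj_from_image:
  assumes c: "carter_conjugate H" and L: "carter_mod A ker L" "carter_mod A ker M"
  shows "\<exists>a\<in>A. M = cjs a L"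
proof -
  note l = carter_modD[OF L(1)] and m = carter_modD[OF L(2)]
  obtain g where g: "g \<in> carrier H" "h ` M = H.cjs g (h ` L)"
    using c[unfolded H.carter_conjugate_iff] carter_mod_image[OF L(1)] carter_mod_image[OF L(2)] by blast
  obtain a where a: "a \<in> A" "g = h a" using g(1) surj by blast
  have ac: "a \<in> carrier G" using A_carrier a by blast
  have eq: "h ` M = h ` cjs a L" using g(2) h_cjs[OF a(1) l(3)] a(2) by simp
  have "ker \<subseteq> cjs a L" using normal_in_cjs[OF ker_normal_in a(1)] l(2) by blast
  moreover have "cjs a L \<subseteq> A" using cj_in_subgroup[OF subA a(1)] l(3) by blast
  ultimately have "pre (h ` cjs a L) = cjs a L" using pre_image[OF cjs_subgroup[OF ac l(1)]] by blast
  then have "M = cjs a L" using pre_image[OF m(1,2,3)] eq by simp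
  then show ?thesis using a by blast
qed

end

subsection \<open>Induced automorphism groups\<close>

context fin_group begin

lemma action_hom:
  assumes A: "subgroup A G" and S: "group S"
    and act: "\<And>x s. x \<in> A \<Longrightarrow> s \<in> carrier S \<Longrightarrow> act x s \<in> carrier S"
      "\<And>x s t. x \<in> A \<Longrightarrow> s \<in> carrier S \<Longrightarrow> t \<in> carrier S \<Longrightarrow> act x (s \<otimes>\<^bsub>S\<^esub> t) = act x s \<otimes>\<^bsub>S\<^esub> act x t"
      "\<And>x y s. x \<in> A \<Longrightarrow> y \<in> A \<Longrightarrow> s \<in> carrier S \<Longrightarrow> act (x \<otimes> y) s = act x (act y s)"
      "\<And>s. s \<in> carrier S \<Longrightarrow> act \<one> s = s"
  shows "(\<lambda>x. restrict (act x) (carrier S)) \<in> hom (G\<lparr>carrier := A\<rparr>) (AutoGroup S)"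
proof -
  interpret S: group S by fact
  let ?h = "\<lambda>x. restrict (act x) (carrier S)"
  have bij: "?h x \<in> Bij (carrier S)" if x: "x \<in> A" for x
  proof -
    have i: "inv x \<in> A" "x \<in> carrier G" using x A sub_i subgroupD by auto
    have "act (inv x) (act x s) = s" "act x (act (inv x) s) = s" if "s \<in> carrier S" for s
      using act(3)[of "inv x" x s] act(3)[of x "inv x" s] act(4) that x i by auto
    then have "bij_betw (act x) (carrier S) (carrier S)"
      using act(1) x i by (intro bij_betw_byWitness[where f' = "act (inv x)"]) auto
    then show ?thesis unfolding Bij_def by (simp add: bij_betw_def inj_on_def)
  qed
  have aut: "?h x \<in> auto S" if x: "x \<in> A" for x
    unfolding auto_def using bij[OF x] act(1,2) x by (auto simp: hom_def)
  have "?h (x \<otimes> y) = compose (carrier S) (?h x) (?h y)" if "x \<in> A" "y \<in> A" for x y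
    using act that by (auto simp: compose_def fun_eq_iff)
  then show ?thesis using aut bij by (auto simp: hom_def AutoGroup_def BijGroup_def)
qed

lemma surj_hom_image:
  assumes A: "subgroup A G" and K: "group K" and hom: "h \<in> hom (G\<lparr>carrier := A\<rparr>) K"
  shows "surj_hom G (K\<lparr>carrier := h ` A\<rparr>) A h"
proof -
  interpret gh: group_hom "G\<lparr>carrier := A\<rparr>" K h
    using subgroup_imp_group[OF A] K hom unfolding group_hom_def group_hom_axioms_def by blast
  have s: "subgroup (h ` A) K" using gh.subgroup_img_is_subgroup[OF gh.G.subgroup_self] by simp
  have "h \<in> hom (G\<lparr>carrier := A\<rparr>) (K\<lparr>carrier := h ` A\<rparr>)" using hom unfolding hom_def by auto
  then show ?thesis
    unfolding surj_hom_def surj_hom_axioms_def using A subgroup.subgroup_is_group[OF s K] fin_group_axioms by simp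
qed

section \<open>Automorphisms induced on a subgroup\<close>

definition centralizer :: "'a set \<Rightarrow> 'a set" where
  "centralizer T = {x \<in> carrier G. \<forall>t\<in>T. cj x t = t}"

text \<open>Modulo \<open>centralizer T\<close> this is \<open>Aut_Y(T)\<close>. Adjoining the full
  centralizer makes the kernel independent of \<open>Y\<close>.\<close>

definition norm_cent :: "'a set \<Rightarrow> 'a set \<Rightarrow> 'a set" where
  "norm_cent Y T = stabil Y T <#> centralizer T"

lemma centralizer_subgroup:
  assumes "T \<subseteq> carrier G"
  shows "subgroup (centralizer T) G"
proof (rule subgroupI)
  show "centralizer T \<subseteq> carrier G" unfolding centralizer_def by blast
  have "\<one> \<in> centralizer T" unfolding centralizer_def using assms by auto
  then show "centralizer T \<noteq> {}" by blast
  fix a assume a: "a \<in> centralizer T"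
  have "cj (inv a) t = t" if "t \<in> T" for t
  proof -
    have e: "cj a t = t" "a \<in> carrier G" using a that unfolding centralizer_def by auto
    have "cj (inv a) (cj a t) = t" using e(2) that assms by (intro cj_cancel) auto
    then show ?thesis unfolding e(1) .
  qed
  then show "inv a \<in> centralizer T" using a unfolding centralizer_def by auto
  fix b assume b: "b \<in> centralizer T"
  have "cj (a \<otimes> b) t = t" if "t \<in> T" for t
    using a b that assms cj_cj[of a b t] unfolding centralizer_def by auto
  then show "a \<otimes> b \<in> centralizer T" using a b unfolding centralizer_def by auto
qed

lemma centralizerD: "x \<in> centralizer T \<Longrightarrow> t \<in> T \<Longrightarrow> cj x t = t" "x \<in> centralizer T \<Longrightarrow> x \<in> carrier G"
  unfolding centralizer_def by auto

lemma centralizer_stabil: "centralizer T \<subseteq> stabil (carrier G) T"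
proof
  fix x assume x: "x \<in> centralizer T"
  then have "cjs x T = id ` T" by (intro image_cong) (auto dest: centralizerD)
  then show "x \<in> stabil (carrier G) T" using x centralizerD(2) by (intro stabilI) auto
qed

lemma cjs_centralizer:
  assumes x: "x \<in> carrier G" and T: "T \<subseteq> carrier G"
  shows "cjs x (centralizer T) = centralizer (cjs x T)"
proof -
  have 1: "cjs y (centralizer T) \<subseteq> centralizer (cjs y T)" if y: "y \<in> carrier G" and T: "T \<subseteq> carrier G" for y T
  proof (rule image_subsetI)
    fix c assume c: "c \<in> centralizer T"
    then have cc: "c \<in> carrier G" by (rule centralizerD)
    have "cj (cj y c) (cj y t) = cj y t" if "t \<in> T" for t
    proof -
      have tc: "t \<in> carrier G" using that T by blast
      have "cj (cj y c) (cj y t) = cj y (cj c t)" using y cc tc by (simp add: word)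
      then show ?thesis using centralizerD(1)[OF c that] by simp
    qed
    then show "cj y c \<in> centralizer (cjs y T)" unfolding centralizer_def using y cc by auto
  qed
  have xT: "cjs x T \<subseteq> carrier G" using cjs_closed[OF x T] .
  have "centralizer (cjs x T) \<subseteq> cjs x (centralizer T)"
  proof
    fix c assume c: "c \<in> centralizer (cjs x T)"
    then have cc: "c \<in> carrier G" by (rule centralizerD)
    have "cj (inv x) c \<in> centralizer (cjs (inv x) (cjs x T))" using 1[OF inv_closed[OF x] xT] c by blast
    then have "cj (inv x) c \<in> centralizer T" using x T by simp
    then show "c \<in> cjs x (centralizer T)" using cjs_mem_iff[OF x _ cc, of "centralizer T"] subgroup.subset[OF centralizer_subgroup[OF T]] by blast
  qed
  then show ?thesis using 1[OF x T] by blast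
qed

lemma norm_cent_props:
  assumes Y: "subgroup Y G" and T: "subgroup T G"
  shows "subgroup (norm_cent Y T) G" "stabil Y T \<subseteq> norm_cent Y T" "centralizer T \<subseteq> norm_cent Y T" "normal_in (centralizer T) (norm_cent Y T)"
    "norm_cent Y T \<subseteq> stabil (carrier G) T"
proof -
  have Tc: "T \<subseteq> carrier G" using T subgroup.subset by blast
  have "cj x c \<in> centralizer T" if "x \<in> stabil (carrier G) T" "c \<in> centralizer T" for x c
    using cjs_centralizer[OF stabilD(1)[OF that(1)] Tc] stabilD(2)[OF that(1)] that(2) by auto
  then have A: "normal_in (centralizer T) (stabil (carrier G) T)"
    unfolding normal_in_def using centralizer_subgroup[OF Tc] stabil_subgroup[OF subgroup_self Tc] centralizer_stabil by blast
  have le: "stabil Y T \<subseteq> stabil (carrier G) T" unfolding stabil_def using subgroup.subset[OF Y] by blast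
  from prod_normal_in[OF A stabil_subgroup[OF Y Tc] le]
  show "subgroup (norm_cent Y T) G" "stabil Y T \<subseteq> norm_cent Y T" "centralizer T \<subseteq> norm_cent Y T" "normal_in (centralizer T) (norm_cent Y T)"
    "norm_cent Y T \<subseteq> stabil (carrier G) T" unfolding norm_cent_def by auto
qed

lemma surj_hom_conj_aut:
  assumes A: "subgroup A G" "A \<subseteq> stabil (carrier G) T" "centralizer T \<subseteq> A" and T: "subgroup T G"
  defines "h \<equiv> \<lambda>x. restrict (cj x) T"
  shows "surj_hom G (AutoGroup (G\<lparr>carrier := T\<rparr>)\<lparr>carrier := h ` A\<rparr>) A h"
    and "surj_hom.ker (AutoGroup (G\<lparr>carrier := T\<rparr>)\<lparr>carrier := h ` A\<rparr>) A h = centralizer T"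
proof -
  interpret T: group "G\<lparr>carrier := T\<rparr>" using subgroup_imp_group[OF T] .
  have Tc: "t \<in> carrier G" if "t \<in> T" for t using that T subgroupD by blast
  have Ac: "x \<in> carrier G" if "x \<in> A" for x using that A subgroupD by blast
  have AT: "cj x t \<in> T" if "x \<in> A" "t \<in> T" for x t using that A(2) stabilD(2)[of x _ T] by blast
  have "h \<in> hom (G\<lparr>carrier := A\<rparr>) (AutoGroup (G\<lparr>carrier := T\<rparr>))"
    using action_hom[OF A(1) T.is_group, of cj] AT cj_mult cj_cj Tc Ac unfolding h_def by simp
  from surj_hom_image[OF A(1) T.AutoGroup this]
  show *: "surj_hom G (AutoGroup (G\<lparr>carrier := T\<rparr>)\<lparr>carrier := h ` A\<rparr>) A h" .
  have "h x = \<one>\<^bsub>AutoGroup (G\<lparr>carrier := T\<rparr>)\<^esub> \<longleftrightarrow> (\<forall>t\<in>T. cj x t = t)" for x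
    unfolding h_def AutoGroup_def BijGroup_def by (auto simp: fun_eq_iff restrict_def)
  then show "surj_hom.ker (AutoGroup (G\<lparr>carrier := T\<rparr>)\<lparr>carrier := h ` A\<rparr>) A h = centralizer T"
  proof -
    assume eq: "\<And>x. h x = \<one>\<^bsub>AutoGroup (G\<lparr>carrier := T\<rparr>)\<^esub> \<longleftrightarrow> (\<forall>t\<in>T. cj x t = t)"
    have "{x \<in> A. \<forall>t\<in>T. cj x t = t} = centralizer T" using A(3) Ac unfolding centralizer_def by blast
    then show ?thesis unfolding surj_hom.ker_def[OF *] by (simp add: eq)
  qed
qed

text \<open>Multiplying by \<open>centralizer T\<close> does not change the image in the
  automorphism group, so the correspondence of Carter subgroups along \<open>surj_hom\<close>
  applies.\<close>

lemma carter_induced_iff: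
  assumes Y: "subgroup Y G" and T: "subgroup T G"
  shows "(\<exists>L. carter_subgroup L (induced_aut_group G Y T {\<one>})) \<longleftrightarrow> (\<exists>L. carter_mod (norm_cent Y T) (centralizer T) L)"
proof -
  define S where "S = section_group G T {\<one>}"
  define A where "A = norm_cent Y T"
  define h where "h x = restrict (cjs x) (carrier S)" for x
  note a = norm_cent_props[OF Y T, folded A_def]
  interpret T: group "G\<lparr>carrier := T\<rparr>" using subgroup_imp_group[OF T] .
  have Tc: "t \<in> carrier G" if "t \<in> T" for t using that T subgroupD by blast
  have Tcs: "T \<subseteq> carrier G" using Tc by blast
  have Ac: "x \<in> carrier G" if "x \<in> A" for x using that a(1) subgroupD by blast
  have AT: "cj x t \<in> T" if "x \<in> A" "t \<in> T" for x t using that a(5) stabilD(2)[of x _ T] by blast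
  have cS: "carrier S = (\<lambda>t. {t}) ` T"
    unfolding S_def FactGroup_def RCOSETS_def using Tc by (auto simp: r_coset_def)
  have "{\<one>} \<lhd> G\<lparr>carrier := T\<rparr>" using T.one_is_normal by simp
  then have gS: "group S" unfolding S_def by (rule normal.factorgroup_is_group)
  have mS: "{s} \<otimes>\<^bsub>S\<^esub> {t} = {s \<otimes> t}" if "s \<in> T" "t \<in> T" for s t
    unfolding S_def by (simp add: set_mult_def)
  have "h \<in> hom (G\<lparr>carrier := A\<rparr>) (AutoGroup S)"
    unfolding h_def using AT Tc Ac by (intro action_hom[OF a(1) gS]) (auto simp: cS mS cj_mult cj_cj sub_m[OF T])
  from surj_hom_image[OF a(1) group.AutoGroup[OF gS] this]
  have sh: "surj_hom G (AutoGroup S\<lparr>carrier := h ` A\<rparr>) A h" .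
  have hx: "h x = h y \<longleftrightarrow> (\<forall>t\<in>T. cj x t = cj y t)" for x y
    unfolding h_def cS by (auto simp: fun_eq_iff restrict_def)
  have "\<one>\<^bsub>AutoGroup S\<^esub> = h \<one>"
    unfolding h_def AutoGroup_def BijGroup_def cS using Tc by (auto simp: fun_eq_iff restrict_def)
  moreover have "h x = h \<one> \<longleftrightarrow> (\<forall>t\<in>T. cj x t = t)" for x using hx[of x \<one>] Tc by simp
  moreover have "{x \<in> A. \<forall>t\<in>T. cj x t = t} = centralizer T" using a(3) Ac unfolding centralizer_def by blast
  ultimately have ker: "surj_hom.ker (AutoGroup S\<lparr>carrier := h ` A\<rparr>) A h = centralizer T"
    unfolding surj_hom.ker_def[OF sh] by simp
  have "cjs x {\<one>} = {\<one>}" if "x \<in> carrier G" for x using that by simp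
  then have "normalizer G {\<one>} = carrier G" using normalizer_eq[of "{\<one>}"] by blast
  then have sn: "section_normalizer G Y T {\<one>} = stabil Y T"
    unfolding section_normalizer_def normalizer_eq[OF Tcs] stabil_def using subgroup.subset[OF Y] by blast
  \<comment> \<open>The definition conjugates in the opposite direction; as
    \<open>stabil Y T\<close> is closed under inverses, the image is the same set.\<close>
  have ind: "induced_aut G T {\<one>} x = h (inv x)" if "x \<in> carrier G" for x
  proof -
    have "inv x <# W #> x = cjs (inv x) W" for W using lr_coset_cjs[of "inv x" W] that by simp
    then show ?thesis unfolding induced_aut_def h_def S_def by simp
  qed
  have sY: "subgroup (stabil Y T) G" using stabil_subgroup[OF Y Tcs] .
  have "induced_auts G Y T {\<one>} = h ` A"
  proof
    show "induced_auts G Y T {\<one>} \<subseteq> h ` A"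
      unfolding induced_auts_def sn using ind sub_i[OF sY] subgroupD[OF sY] a(2) by blast
    show "h ` A \<subseteq> induced_auts G Y T {\<one>}"
    proof (rule image_subsetI)
      fix x assume "x \<in> A"
      then obtain y c where y: "y \<in> stabil Y T" "c \<in> centralizer T" "x = y \<otimes> c" unfolding A_def norm_cent_def by (rule mult_memE)
      have yc: "y \<in> carrier G" "c \<in> carrier G" using y subgroupD[OF sY] centralizerD by blast+
      have "cj x t = cj y t" if "t \<in> T" for t
        using cj_cj[OF yc Tc[OF that]] centralizerD(1)[OF y(2) that] y(3) by simp
      then have "h x = h y" using hx by blast
      also have "\<dots> = induced_aut G T {\<one>} (inv y)" using ind[of "inv y"] yc by simp
      finally show "h x \<in> induced_auts G Y T {\<one>}" unfolding induced_auts_def sn using sub_i[OF sY y(1)] by blast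
    qed
  qed
  then have "induced_aut_group G Y T {\<one>} = AutoGroup S\<lparr>carrier := h ` A\<rparr>"
    unfolding induced_aut_group_def S_def by simp
  then show ?thesis using surj_hom.carter_mod_ex_iff[OF sh] unfolding ker unfolding A_def by simp
qed

text \<open>Abelian chief factors: \<open>N\<close> acts trivially on \<open>T\<close>, so the
  induced group is a quotient of a nilpotent one and is its own Carter subgroup.\<close>

lemma carter_mod_norm_cent_nilpotent_mod:
  assumes Y: "subgroup Y G" and T: "subgroup T G" and n: "nilpotent_mod Y N" and NT: "N \<subseteq> centralizer T"
  shows "carter_mod (norm_cent Y T) (centralizer T) (norm_cent Y T)"
proof -
  note a = norm_cent_props[OF Y T]
  have Tc: "T \<subseteq> carrier G" using T subgroup.subset by blast
  have sY: "subgroup (stabil Y T) G" using stabil_subgroup[OF Y Tc] .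
  have "nilpotent_mod (stabil Y T) (centralizer T)" using nilpotent_mod_sub'[OF n _ sY NT] stabilD(1) by blast
  then have "nilpotent_mod (norm_cent Y T) (centralizer T)" unfolding norm_cent_def using nilpotent_mod_mult[OF a(4) sY a(2)] by (simp add: norm_cent_def)
  then show ?thesis using carter_mod_refl a(4) by blast
qed

subsection \<open>Direct products of nonabelian simple groups\<close>

definition simple_subgroup :: "'a set \<Rightarrow> bool" where
  "simple_subgroup T \<longleftrightarrow> subgroup T G \<and> T \<noteq> {\<one>} \<and> (\<forall>D. normal_in D T \<longrightarrow> D = {\<one>} \<or> D = T)"

lemma commuting_normal:
  assumes "normal_in A N" "normal_in B N" "A \<inter> B = {\<one>}" and a: "a \<in> A" and b: "b \<in> B"
  shows "cj a b = b"
proof -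
  have c: "a \<in> carrier G" "b \<in> carrier G" using assms normal_inD subgroupD by blast+
  have "a \<in> N" "b \<in> N" using a b assms normal_inD by blast+
  then have "commutator a b \<in> A" using commutator_memI[OF assms(1) a] by blast
  moreover have "commutator b a \<in> B" using commutator_memI[OF assms(2) b \<open>a \<in> N\<close>] .
  then have "commutator a b \<in> B" using commutator_swap[OF c(2,1)] sub_i[OF normal_inD(1)[OF assms(2)]] by metis
  ultimately have "commutator a b = \<one>" using assms(3) by blast
  then have "commutator a b \<otimes> b = b" using c by simp
  then show ?thesis using c by (simp add: word)
qed

text \<open>A centralizer \<open>C(T_j)\<close> contains all factors but \<open>T_j\<close>, so
  modulo it only the \<open>j\<close>-th coordinate of an element of \<open>N\<close> is visible.
  Triviality of the centers makes the coordinates detect the identity, and makes each factor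
  recoverable from its centralizer.\<close>

theorem component_system_simple_product:
  assumes N: "normal_in N (carrier G)" and J: "finite J"
    and T: "\<And>j. j \<in> J \<Longrightarrow> normal_in (T j) N" "\<And>j. j \<in> J \<Longrightarrow> simple_subgroup (T j)"
    and disj: "\<And>j l. j \<in> J \<Longrightarrow> l \<in> J \<Longrightarrow> j \<noteq> l \<Longrightarrow> T j \<inter> T l = {\<one>}"
    and gen: "N \<subseteq> generate G (\<Union>j\<in>J. T j)"
    and nonab: "\<And>j. j \<in> J \<Longrightarrow> T j \<inter> centralizer (T j) = {\<one>}"
  shows "component_system (carrier G) N ((\<lambda>j. centralizer (T j)) ` J)"
    and "\<And>Y j. subgroup Y G \<Longrightarrow> j \<in> J \<Longrightarrow> stabil Y (centralizer (T j)) = stabil Y (T j)"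
    and "\<And>j x. j \<in> J \<Longrightarrow> x \<in> N \<Longrightarrow> \<exists>c\<in>centralizer (T j). \<exists>t\<in>T j. x = c \<otimes> t"
proof -
  note n = normal_inD[OF N]
  have sT: "subgroup (T j) G" "T j \<subseteq> N" "T j \<subseteq> carrier G" "T j \<noteq> {\<one>}" if "j \<in> J" for j
    using normal_inD[OF T(1)[OF that]] n(3) T(2)[OF that] unfolding simple_subgroup_def by auto
  have Tsub: "T l \<subseteq> centralizer (T j)" if "j \<in> J" "l \<in> J" "j \<noteq> l" for j l
    using commuting_normal[OF T(1)[OF that(2)] T(1)[OF that(1)] disj[OF that(2,1)]] that(3) sT[OF that(2)] unfolding centralizer_def by blast
  have sc: "subgroup (centralizer (T j)) G" if "j \<in> J" for j using centralizer_subgroup[OF sT(3)[OF that]] .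
  show decomp: "\<exists>c\<in>centralizer (T j). \<exists>t\<in>T j. x = c \<otimes> t" if j: "j \<in> J" and x: "x \<in> N" for j x
  proof -
    have A: "normal_in (T j) (stabil (carrier G) (T j))" unfolding stabil_def using normal_in_stab[OF subgroup_self sT(1)[OF j] sT(3)[OF j]] .
    note p = prod_normal_in[OF A sc[OF j] centralizer_stabil]
    have "T l \<subseteq> centralizer (T j) <#> T j" if "l \<in> J" for l
      using p(2,3) Tsub[OF j that] by (cases "j = l") auto
    then have "N \<subseteq> centralizer (T j) <#> T j" using generate_subgroup_incl[OF _ p(1), of "\<Union>j\<in>J. T j"] gen by blast
    then show ?thesis using x by (blast elim: mult_memE)
  qed
  \<comment> \<open>The prescribed coordinates are inserted one index at a time; a new factor
    centralizes all the others and does not disturb earlier coordinates.\<close>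
  have indep: "\<exists>m\<in>N. (\<forall>j\<in>F. \<exists>c\<in>centralizer (T j). m = c \<otimes> t j) \<and> (\<forall>j\<in>J - F. m \<in> centralizer (T j))"
    if "F \<subseteq> J" and t: "\<And>j. j \<in> J \<Longrightarrow> t j \<in> T j" for F t
    using finite_subset[OF \<open>F \<subseteq> J\<close> J] \<open>F \<subseteq> J\<close>
  proof (induction F)
    case empty
    show ?case using sub_1[OF n(1)] sub_1[OF sc] by blast
  next
    case (insert i F)
    then have i: "i \<in> J" by blast
    obtain m where m: "m \<in> N" "\<And>j. j \<in> F \<Longrightarrow> \<exists>c\<in>centralizer (T j). m = c \<otimes> t j" "\<And>j. j \<in> J - F \<Longrightarrow> m \<in> centralizer (T j)"
      using insert by blast
    have ti: "t i \<in> T i" "t i \<in> N" "t i \<in> carrier G" using t[OF i] sT[OF i] by blast+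
    have "\<exists>c\<in>centralizer (T j). m \<otimes> t i = c \<otimes> t j" if j: "j \<in> insert i F" for j
    proof (cases "j = i")
      case True
      then show ?thesis using m(3)[of i] i insert.hyps by blast
    next
      case False
      then have jF: "j \<in> F" "j \<in> J" using j insert by blast+
      obtain c where c: "c \<in> centralizer (T j)" "m = c \<otimes> t j" using m(2)[OF jF(1)] by blast
      have tiC: "t i \<in> centralizer (T j)" using Tsub[OF jF(2) i False] ti by blast
      have tj: "t j \<in> T j" "t j \<in> carrier G" using t[OF jF(2)] sT[OF jF(2)] by blast+
      have cc: "c \<in> carrier G" using c centralizerD by blast
      have "cj (t i) (t j) = t j" using centralizerD(1)[OF tiC tj(1)] .
      then have "t i \<otimes> t j = t j \<otimes> t i" using ti tj by (metis cj_def inv_solve_right m_closed)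
      then have "m \<otimes> t i = (c \<otimes> t i) \<otimes> t j" unfolding c(2) using cc ti tj by (simp add: m_assoc)
      then show ?thesis using sub_m[OF sc[OF jF(2)] c(1) tiC] by blast
    qed
    moreover have "m \<otimes> t i \<in> centralizer (T j)" if j: "j \<in> J - insert i F" for j
    proof -
      have "t i \<in> centralizer (T j)" using Tsub[of j i] j i ti by blast
      then show ?thesis using m(3)[of j] j sub_m[OF sc] by blast
    qed
    ultimately show ?case using sub_m[OF n(1) m(1) ti(2)] by blast
  qed
  \<comment> \<open>Split off the \<open>T i\<close>-part: the remaining factors centralize
    \<open>T i\<close>, so that part lies in the trivial center of \<open>T i\<close>.\<close>
  have triv0: "x = \<one>" if "F \<subseteq> J" "x \<in> generate G (\<Union>j\<in>F. T j)" "\<And>j. j \<in> F \<Longrightarrow> x \<in> centralizer (T j)" for F x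
    using finite_subset[OF \<open>F \<subseteq> J\<close> J] that
  proof (induction F arbitrary: x)
    case empty then show ?case by (simp add: generate_empty)
  next
    case (insert i F)
    then have i: "i \<in> J" by blast
    define W where "W = generate G (\<Union>j\<in>F. T j)"
    have WN: "W \<subseteq> N" unfolding W_def using insert sT by (intro generate_subgroup_incl[OF _ n(1)]) blast
    have W: "subgroup W G" unfolding W_def using insert sT by (intro generate_is_subgroup) blast
    note p = prod_normal_in[OF T(1)[OF i] W WN]
    have "(\<Union>j\<in>insert i F. T j) \<subseteq> W <#> T i" using p(2,3) generate.incl[of _ "\<Union>j\<in>F. T j" G] unfolding W_def by blast
    then have "x \<in> W <#> T i" using generate_subgroup_incl[OF _ p(1)] insert.prems(2) by blast
    then obtain w t where w: "w \<in> W" "t \<in> T i" "x = w \<otimes> t" by (rule mult_memE)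
    have cw: "w \<in> centralizer (T i)"
    proof -
      have "T j \<subseteq> centralizer (T i)" if "j \<in> F" for j using Tsub[of i j] that insert i by blast
      then have "W \<subseteq> centralizer (T i)" unfolding W_def by (intro generate_subgroup_incl[OF _ sc[OF i]]) blast
      then show ?thesis using w by blast
    qed
    have wc: "w \<in> carrier G" "t \<in> carrier G" using w WN n(3) sT[OF i] by blast+
    have "inv w \<otimes> x \<in> centralizer (T i)" using cw insert.prems(3)[of i] sub_i[OF sc[OF i]] sub_m[OF sc[OF i]] by blast
    then have "t \<in> centralizer (T i)" unfolding w(3) using wc by simp
    then have "t = \<one>" using nonab[OF i] w(2) by blast
    then have xw: "x = w" using w(3) wc by simp
    show ?case
    proof (rule insert.IH)
      show "F \<subseteq> J" using insert.prems by blast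
      show "x \<in> generate G (\<Union>j\<in>F. T j)" using xw w(1) unfolding W_def by simp
      show "x \<in> centralizer (T j)" if "j \<in> F" for j using insert.prems(3) that by blast
    qed
  qed
  have triv: "x = \<one>" if "x \<in> N" "\<And>j. j \<in> J \<Longrightarrow> x \<in> centralizer (T j)" for x
    using triv0[of J x] that gen by blast
  \<comment> \<open>A conjugate \<open>W\<close> of a factor is again simple and normal in
    \<open>N\<close>. It meets some factor nontrivially, for otherwise it would centralize all of
    them and be trivial; by simplicity it equals that factor.\<close>
  have perm: "\<exists>l\<in>J. cjs u (T j) = T l" if j: "j \<in> J" and u: "u \<in> carrier G" for j u
  proof -
    define W where "W = cjs u (T j)"
    have sW: "subgroup W G" unfolding W_def using cjs_subgroup[OF u sT(1)[OF j]] .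
    have iu: "inv u \<in> carrier G" using u by simp
    have WN: "W \<subseteq> N" unfolding W_def using sT(2)[OF j] n(4)[OF u] by blast
    have uW: "cjs (inv u) W = T j" unfolding W_def using u sT(3)[OF j] by simp
    have nW: "normal_in W N"
    proof -
      have "cj x w \<in> W" if x: "x \<in> N" and w: "w \<in> W" for x w
      proof -
        obtain t where t: "t \<in> T j" "w = cj u t" using w unfolding W_def by blast
        have c: "x \<in> carrier G" "t \<in> carrier G" using x n(3) t sT[OF j] by blast+
        have "cj (inv u) x \<in> N" using n(4)[OF iu x] .
        then have "cj (cj (inv u) x) t \<in> T j" using normal_inD(4)[OF T(1)[OF j]] t by blast
        moreover have "cj x w = cj u (cj (cj (inv u) x) t)" unfolding t(2) using c u by (simp add: word)
        ultimately show ?thesis unfolding W_def by blast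
      qed
      then show ?thesis unfolding normal_in_def using sW n(1) WN by blast
    qed
    have "\<exists>l\<in>J. W \<inter> T l \<noteq> {\<one>}"
    proof (rule ccontr)
      assume "\<not> (\<exists>l\<in>J. W \<inter> T l \<noteq> {\<one>})"
      then have d: "W \<inter> T l = {\<one>}" if "l \<in> J" for l using that by blast
      have "w \<in> centralizer (T l)" if "w \<in> W" "l \<in> J" for w l
        unfolding centralizer_def using commuting_normal[OF nW T(1)[OF that(2)] d[OF that(2)] that(1)] subgroupD[OF sW that(1)] by blast
      then have "W \<subseteq> {\<one>}" using triv WN by blast
      then have "W = {\<one>}" using sub_1[OF sW] by blast
      then have "T j = {\<one>}" using uW iu by simp
      then show False using sT(4)[OF j] by contradiction
    qed
    then obtain l where l: "l \<in> J" "W \<inter> T l \<noteq> {\<one>}" by blast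
    have D: "normal_in (W \<inter> T l) N" using normal_in_Int[OF nW T(1)[OF l(1)]] .
    have "normal_in (W \<inter> T l) (T l)" using normal_in_sub[OF D sT(1)[OF l(1)] _ sT(2)[OF l(1)]] by blast
    then have 1: "W \<inter> T l = T l" using T(2)[OF l(1)] l(2) unfolding simple_subgroup_def by blast
    have DW: "normal_in (W \<inter> T l) W" using normal_in_sub[OF D sW _ WN] by blast
    define D' where "D' = cjs (inv u) (W \<inter> T l)"
    have "normal_in D' (T j)"
    proof -
      have "subgroup D' G" unfolding D'_def using cjs_subgroup[OF iu normal_inD(1)[OF D]] .
      moreover have "D' \<subseteq> T j" unfolding D'_def using uW by blast
      moreover have "cj x y \<in> D'" if x: "x \<in> T j" and y: "y \<in> D'" for x y
      proof -
        obtain d where d: "d \<in> W \<inter> T l" "y = cj (inv u) d" using y unfolding D'_def by blast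
        have c: "x \<in> carrier G" "d \<in> carrier G" using x sT[OF j] d subgroupD[OF sW] by blast+
        have "cj u x \<in> W" unfolding W_def using x by blast
        then have "cj (cj u x) d \<in> W \<inter> T l" using normal_inD(4)[OF DW] d(1) by blast
        moreover have "cj x y = cj (inv u) (cj (cj u x) d)" unfolding d(2) using c u by (simp add: word)
        ultimately show ?thesis unfolding D'_def by blast
      qed
      ultimately show ?thesis unfolding normal_in_def using sT(1)[OF j] by blast
    qed
    then have "D' = {\<one>} \<or> D' = T j" using T(2)[OF j] unfolding simple_subgroup_def by blast
    moreover have uD: "cjs u D' = W \<inter> T l" unfolding D'_def using u subgroup.subset[OF normal_inD(1)[OF D]] by simp
    moreover have "cjs u {\<one>} = {\<one>}" using u by simp
    ultimately have "W \<inter> T l = W" using l(2) unfolding W_def by metis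
    then show ?thesis using 1 l(1) unfolding W_def by blast
  qed
  show stabil_eq: "stabil Y (centralizer (T j)) = stabil Y (T j)" if Y: "subgroup Y G" and j: "j \<in> J" for Y j
  proof
    show "stabil Y (T j) \<subseteq> stabil Y (centralizer (T j))"
    proof
      fix u assume u: "u \<in> stabil Y (T j)"
      have uc: "u \<in> carrier G" using stabilD(1)[OF u] subgroupD[OF Y] by blast
      show "u \<in> stabil Y (centralizer (T j))"
        using cjs_centralizer[OF uc sT(3)[OF j]] stabilD[OF u] by (intro stabilI) auto
    qed
    show "stabil Y (centralizer (T j)) \<subseteq> stabil Y (T j)"
    proof
      fix u assume u: "u \<in> stabil Y (centralizer (T j))"
      have uc: "u \<in> carrier G" using stabilD(1)[OF u] subgroupD[OF Y] by blast
      obtain l where l: "l \<in> J" "cjs u (T j) = T l" using perm[OF j uc] by blast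
      have eq: "centralizer (T l) = centralizer (T j)" using cjs_centralizer[OF uc sT(3)[OF j]] stabilD(2)[OF u] l(2) by simp
      have "l = j"
      proof (rule ccontr)
        assume "l \<noteq> j"
        then have "T l \<subseteq> centralizer (T l)" using Tsub[OF j l(1)] eq by blast
        then have "T l = {\<one>}" using nonab[OF l(1)] by blast
        then show False using sT(4)[OF l(1)] by contradiction
      qed
      then show "u \<in> stabil Y (T j)" using l(2) stabilD(1)[OF u] by (intro stabilI) auto
    qed
  qed
  show "component_system (carrier G) N ((\<lambda>j. centralizer (T j)) ` J)"
    unfolding component_system_def
  proof (intro conjI ballI allI impI)
    show "normal_in N (carrier G)" by fact
    fix C assume "C \<in> (\<lambda>j. centralizer (T j)) ` J"
    then obtain j where j: "j \<in> J" "C = centralizer (T j)" by blast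
    show "subgroup C G" using sc j by blast
    show "cjs u C \<in> (\<lambda>j. centralizer (T j)) ` J" if u: "u \<in> carrier G" for u
      using perm[OF j(1) u] cjs_centralizer[OF u sT(3)[OF j(1)]] unfolding j(2) by auto
    show "cjs x C = C" if x: "x \<in> N" for x
      using cjs_centralizer[of x "T j"] sT(3)[OF j(1)] normal_in_cjs[OF T(1)[OF j(1)] x] x n(3) unfolding j(2) by auto
  next
    fix f assume f: "\<forall>C\<in>(\<lambda>j. centralizer (T j)) ` J. f C \<in> N"
    have "\<exists>c t. c \<in> centralizer (T j) \<and> t \<in> T j \<and> f (centralizer (T j)) = c \<otimes> t" if "j \<in> J" for j
      using decomp[OF that] f that by blast
    then obtain c t where ct: "\<And>j. j \<in> J \<Longrightarrow> c j \<in> centralizer (T j) \<and> t j \<in> T j \<and> f (centralizer (T j)) = c j \<otimes> t j" by metis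
    obtain m where m: "m \<in> N" "\<And>j. j \<in> J \<Longrightarrow> \<exists>c\<in>centralizer (T j). m = c \<otimes> t j"
      using indep[OF order_refl, of t] ct by blast
    have "\<exists>e\<in>centralizer (T j). m = e \<otimes> f (centralizer (T j))" if j: "j \<in> J" for j
    proof -
      obtain d where d: "d \<in> centralizer (T j)" "m = d \<otimes> t j" using m(2)[OF j] by blast
      have c: "c j \<in> centralizer (T j)" "t j \<in> T j" "f (centralizer (T j)) = c j \<otimes> t j" using ct[OF j] by auto
      have cc: "d \<in> carrier G" "c j \<in> carrier G" "t j \<in> carrier G" using d c centralizerD(2) sT(3)[OF j] by blast+
      have "m = (d \<otimes> inv (c j)) \<otimes> f (centralizer (T j))" unfolding c(3) d(2) using cc by (simp add: m_assoc)
      then show ?thesis using sub_m[OF sc[OF j] d(1) sub_i[OF sc[OF j] c(1)]] by blast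
    qed
    then show "\<exists>n\<in>N. \<forall>C\<in>(\<lambda>j. centralizer (T j)) ` J. \<exists>c\<in>C. n = c \<otimes> f C" using m(1) by blast
  next
    fix x assume "x \<in> N" "\<forall>C\<in>(\<lambda>j. centralizer (T j)) ` J. x \<in> C"
    then show "x = \<one>" using triv by blast
  qed
qed

end

subsection \<open>Composition factors\<close>

context group begin

lemma normal_in_iff:
  assumes A: "subgroup A G"
  shows "normal_in B A \<longleftrightarrow> B \<lhd> G\<lparr>carrier := A\<rparr>"
proof -
  interpret A: group "G\<lparr>carrier := A\<rparr>" using subgroup_imp_group[OF A] .
  have 1: "subgroup B (G\<lparr>carrier := A\<rparr>) \<longleftrightarrow> subgroup B G \<and> B \<subseteq> A"
    using incl_subgroup[OF A] subgroup_incl[OF _ A] subgroup.subset[of B "G\<lparr>carrier := A\<rparr>"] by auto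
  show ?thesis unfolding A.normal_inv_iff 1 normal_in_def cj_def using A m_inv_consistent[OF A] by auto
qed

lemma normal_in_carrier_iff: "normal_in B (carrier G) \<longleftrightarrow> B \<lhd> G"
  using normal_in_iff[OF subgroup_self] by simp

end

lemma (in surj_hom) normal_in_pre:
  assumes W: "H.normal_in W (carrier H)"
  shows "normal_in (pre W) A"
proof -
  have s: "subgroup W H" using H.normal_inD(1)[OF W] .
  have "cj x y \<in> pre W" if x: "x \<in> A" and y: "y \<in> pre W" for x y
  proof -
    have yA: "y \<in> A" "h y \<in> W" using y unfolding pre_def by auto
    have "h (cj x y) \<in> W" using h_cj[OF x yA(1)] H.normal_inD(4)[OF W h_closed[OF x] yA(2)] by simp
    then show ?thesis unfolding pre_def using cj_in_subgroup[OF subA x yA(1)] by blast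
  qed
  then show ?thesis unfolding normal_in_def using pre_subgroup[OF s] subA pre_sub by blast
qed

context fin_group begin

lemma quot_surj_hom:
  assumes M: "normal_in M A"
  shows "surj_hom G (section_group G A M) A (\<lambda>x. M #> x)"
    and "surj_hom.ker (section_group G A M) A (\<lambda>x. M #> x) = M"
proof -
  note m = normal_inD[OF M]
  have n: "M \<lhd> G\<lparr>carrier := A\<rparr>" using normal_in_iff[OF m(2)] M by blast
  have "(\<lambda>x. M #> x) \<in> hom (G\<lparr>carrier := A\<rparr>) (section_group G A M)"
    using normal.r_coset_hom_Mod[OF n] by simp
  moreover have "(\<lambda>x. M #> x) ` A = carrier (section_group G A M)" unfolding carrier_FactGroup by simp
  ultimately show *: "surj_hom G (section_group G A M) A (\<lambda>x. M #> x)"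
    unfolding surj_hom_def surj_hom_axioms_def using m(2) normal.factorgroup_is_group[OF n] fin_group_axioms by blast
  have "M #> x = M \<longleftrightarrow> x \<in> M" if "x \<in> A" for x
    using rcos_self[of x M] coset_join2[of x M] subgroupD[OF m(2) that] m(1) by blast
  then show "surj_hom.ker (section_group G A M) A (\<lambda>x. M #> x) = M"
    unfolding surj_hom.ker_def[OF *] using m(3) by auto
qed

lemma simple_section:
  assumes D: "normal_in D A" "D \<noteq> A" and max: "\<And>W. normal_in W A \<Longrightarrow> D \<subseteq> W \<Longrightarrow> W = D \<or> W = A"
  shows "simple_group (section_group G A D)"
proof -
  define S where "S = section_group G A D"
  define h where "h = (\<lambda>x. D #> x)"
  note d = normal_inD[OF D(1)]
  interpret q: surj_hom G S A h unfolding S_def h_def by (rule quot_surj_hom[OF D(1)])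
  have ker: "q.ker = D" unfolding S_def h_def by (rule quot_surj_hom[OF D(1)])
  obtain a where a: "a \<in> A" "a \<notin> D" using D d(3) by blast
  have "h a \<noteq> \<one>\<^bsub>S\<^esub>" using a ker unfolding q.ker_def by blast
  moreover have "finite (carrier S)" unfolding q.surj[symmetric] using fin_sub[OF d(2)] by simp
  moreover have "{\<one>\<^bsub>S\<^esub>, h a} \<subseteq> carrier S" using q.h_closed[OF a(1)] by simp
  ultimately have o: "order S > 1" unfolding order_def using card_mono[of "carrier S" "{\<one>\<^bsub>S\<^esub>, h a}"] by simp
  have "W = carrier S \<or> W = {\<one>\<^bsub>S\<^esub>}" if W: "W \<lhd> S" for W
  proof -
    have W': "q.H.normal_in W (carrier S)" using q.H.normal_in_carrier_iff W by blast
    have s: "subgroup W S" using q.H.normal_inD(1)[OF W'] .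
    have "q.pre W = D \<or> q.pre W = A" using max[OF q.normal_in_pre[OF W']] q.ker_pre[OF s] ker by blast
    moreover have "h ` q.pre W = W" using q.image_pre subgroup.subset[OF s] by blast
    moreover have "h ` D = {\<one>\<^bsub>S\<^esub>}"
    proof -
      have "h ` D \<subseteq> {\<one>\<^bsub>S\<^esub>}" using ker unfolding q.ker_def by blast
      then show ?thesis using sub_1[OF d(1)] by blast
    qed
    ultimately show ?thesis using q.surj by auto
  qed
  then have "simple_group S" unfolding simple_group_def simple_group_axioms_def using q.H.is_group o by blast
  then show ?thesis unfolding S_def .
qed

text \<open>As a relation, series of unknown length can be concatenated by transitivity of its
  closure; indices appear only in \<open>composition_factorI\<close>.\<close>

definition simple_step :: "('a set \<times> 'a set) set" where
  "simple_step = {(A, B). normal_in B A \<and> simple_group (section_group G A B)}"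

lemma chain_ex: "normal_in B A \<Longrightarrow> (A, B) \<in> simple_step\<^sup>*"
proof (induction "card A" arbitrary: A rule: less_induct)
  case less
  note b = normal_inD[OF less.prems]
  show ?case
  proof (cases "B = A")
    case False
    define P where "P D \<longleftrightarrow> normal_in D A \<and> B \<subseteq> D \<and> D \<noteq> A" for D
    have "P B" unfolding P_def using less.prems False by blast
    moreover have "card D \<le> card A" if "P D" for D
      using that normal_inD(3)[of D A] card_mono[OF fin_sub[OF b(2)]] unfolding P_def by blast
    ultimately obtain D where D: "P D" "\<And>E. P E \<Longrightarrow> card E \<le> card D"
      using ex_has_greatest_nat[of P B card "Suc (card A)"] by (metis le_imp_less_Suc)
    have d: "normal_in D A" "B \<subseteq> D" "D \<noteq> A" using D(1) unfolding P_def by auto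
    have "W = D \<or> W = A" if W: "normal_in W A" "D \<subseteq> W" for W
    proof (rule disjCI)
      assume "W \<noteq> A"
      then have "P W" unfolding P_def using W d by blast
      then show "W = D" using D(2)[of W] card_seteq[OF fin_sub[OF normal_inD(1)[OF W(1)]] W(2)] by simp
    qed
    then have "(A, D) \<in> simple_step" unfolding simple_step_def using simple_section[OF d(1,3)] d(1) by blast
    moreover have "card D < card A" using d normal_inD(3)[OF d(1)] fin_sub[OF b(2)] by (simp add: psubset_card_mono psubset_eq)
    then have "(D, B) \<in> simple_step\<^sup>*" using less.hyps normal_in_sub[OF less.prems normal_inD(1)[OF d(1)] d(2) normal_inD(3)[OF d(1)]] by blast
    ultimately show ?thesis by (rule converse_rtrancl_into_rtrancl)
  qed simp
qed

text \<open>Simple steps lead from the whole group through \<open>N\<close> down to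
  \<open>A\<close>, then comes the given step to \<open>M\<close>, then a chain down to the trivial
  group.\<close>

lemma composition_factorI:
  assumes N: "normal_in N (carrier G)" and A: "normal_in A N" and M: "normal_in M (carrier G)" "normal_in M A"
    and s: "simple_group (section_group G A M)"
  shows "composition_factor G A M"
proof -
  have "(carrier G, A) \<in> simple_step\<^sup>*" using chain_ex[OF N] chain_ex[OF A] by (rule rtrancl_trans)
  then obtain p where "(carrier G, A) \<in> simple_step ^^ p" using rtrancl_is_UN_relpow by blast
  then obtain f where f: "f 0 = carrier G" "f p = A" "\<And>i. i < p \<Longrightarrow> (f i, f (Suc i)) \<in> simple_step"
    unfolding relpow_fun_conv by blast
  have "(M, {\<one>}) \<in> simple_step\<^sup>*" using chain_ex[OF normal_in_one[OF normal_inD(1)[OF M(1)]]] .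
  then obtain q where "(M, {\<one>}) \<in> simple_step ^^ q" using rtrancl_is_UN_relpow by blast
  then obtain g where g: "g 0 = M" "g q = {\<one>}" "\<And>i. i < q \<Longrightarrow> (g i, g (Suc i)) \<in> simple_step"
    unfolding relpow_fun_conv by blast
  \<comment> \<open>\<open>A\<close> sits at index \<open>p\<close> and \<open>M\<close> at
    \<open>Suc p\<close>, so the wanted factor is the step with index \<open>p\<close>.\<close>
  define F where "F i = (if i \<le> p then f i else g (i - Suc p))" for i
  define m where "m = Suc (p + q)"
  have st: "(F i, F (Suc i)) \<in> simple_step" if i: "i < m" for i
  proof -
    consider "i < p" | "i = p" | "p < i" by linarith
    then show ?thesis
    proof cases
      case 1 then show ?thesis unfolding F_def using f by simp
    next
      case 2 then show ?thesis unfolding F_def using f g M(2) s unfolding simple_step_def by simp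
    next
      case 3
      then have "i - Suc p < q" "Suc i - Suc p = Suc (i - Suc p)" using i unfolding m_def by auto
      then show ?thesis unfolding F_def using g(3) 3 by simp
    qed
  qed
  have Fm: "F m = {\<one>}" unfolding F_def m_def using g by simp
  have sub: "subgroup (F i) G" if "i \<le> m" for i
  proof (cases "i = m")
    case True then show ?thesis using Fm triv_subgroup by simp
  next
    case False
    then have "(F i, F (Suc i)) \<in> simple_step" using st that by simp
    then show ?thesis unfolding simple_step_def using normal_inD(2) by blast
  qed
  have "composition_series G m F"
    unfolding composition_series_def
  proof (intro conjI allI impI)
    show "F 0 = carrier G" unfolding F_def using f by simp
    show "F m = {\<one>}" by (rule Fm)
    show "subgroup (F i) G" if "i \<le> m" for i using sub that .
    fix i assume i: "i < m"
    have "normal_in (F (Suc i)) (F i)" "simple_group (section_group G (F i) (F (Suc i)))" using st[OF i] unfolding simple_step_def by auto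
    then show "F (Suc i) \<lhd> G\<lparr>carrier := F i\<rparr>" "simple_group (section_group G (F i) (F (Suc i)))"
      using normal_in_iff[OF sub[of i]] i by auto
  qed
  moreover have "F p = A" "F (Suc p) = M" unfolding F_def using f g by auto
  moreover have "p < m" unfolding m_def by simp
  ultimately show ?thesis unfolding composition_factor_def by metis
qed

lemma fin_group_section:
  assumes "normal_in M A"
  shows "fin_group (section_group G A M)"
proof -
  interpret q: surj_hom G "section_group G A M" A "\<lambda>x. M #> x" using quot_surj_hom[OF assms] by blast
  have "finite (carrier (section_group G A M))" unfolding q.surj[symmetric] using fin_sub[OF q.subA] by simp
  then show ?thesis unfolding fin_group_def fin_group_axioms_def using q.H.is_group by blast
qed

section \<open>Condition (C) for nilpotent sections\<close>

text \<open>The preimage of \<open>Y\<close> in \<open>G\<close> is \<open>R N0\<close> with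
  \<open>R\<close> nilpotent. By \<open>dec\<close>, elements of \<open>N\<close> that act on
  \<open>T\<close> act as elements of \<open>T\<close>, so \<open>Y\<close> and \<open>R\<close>
  induce the same automorphisms up to inner ones, and the group in (C) for \<open>R\<close> is the
  one that \<open>norm_cent Y T\<close> induces.\<close>

lemma condition_C_conj:
  fixes M N0 T Y
  defines "Q \<equiv> G Mod M" and "N \<equiv> (\<lambda>x. M #> x) ` N0"
  assumes C: "condition_C G" and M: "normal_in M (carrier G)" and N0: "normal_in N0 (carrier G)" "M \<subseteq> N0"
    and T: "group.normal_in Q T N" "simple_group (Q\<lparr>carrier := T\<rparr>)" "\<not> comm_group (Q\<lparr>carrier := T\<rparr>)"
    and dec: "\<And>n. n \<in> N \<Longrightarrow> \<exists>c\<in>fin_group.centralizer Q T. \<exists>t\<in>T. n = c \<otimes>\<^bsub>Q\<^esub> t"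
    and Y: "subgroup Y Q" "N \<subseteq> Y" "group.nilpotent_mod Q Y N"
    and L: "group.carter_mod Q (fin_group.norm_cent Q Y T) (fin_group.centralizer Q T) L1"
      "group.carter_mod Q (fin_group.norm_cent Q Y T) (fin_group.centralizer Q T) L2"
  shows "\<exists>a\<in>fin_group.norm_cent Q Y T. L2 = group.cj Q a ` L1"
proof -
  define \<pi> where "\<pi> = (\<lambda>x. M #> x)"
  have Qeq: "Q = section_group G (carrier G) M" unfolding Q_def by simp
  interpret Q: fin_group Q unfolding Qeq using fin_group_section[OF M] .
  interpret q: surj_hom G Q "carrier G" \<pi> unfolding Qeq \<pi>_def using quot_surj_hom(1)[OF M] .
  have ker: "q.ker = M" unfolding Qeq \<pi>_def using quot_surj_hom(2)[OF M] .
  have N: "N = \<pi> ` N0" unfolding N_def \<pi>_def ..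
  note m = normal_inD[OF M] and n0 = normal_inD[OF N0(1)] and t = Q.normal_inD[OF T(1)]
  have Tc: "T \<subseteq> carrier Q" using t(1) subgroup.subset by blast
  have Yc: "Y \<subseteq> carrier Q" using Y(1) subgroup.subset by blast
  \<comment> \<open>The composition factor for (C) is \<open>A\<close> over \<open>M\<close>, which
    is literally the group on \<open>T\<close> in \<open>Q\<close>: both consist of the same cosets
    of \<open>M\<close>.\<close>
  define A where "A = q.pre T"
  have sA: "subgroup A G" unfolding A_def using q.pre_subgroup[OF t(1)] .
  have Ac: "A \<subseteq> carrier G" using sA subgroup.subset by blast
  have \<pi>A: "\<pi> ` A = T" unfolding A_def using q.image_pre[OF Tc] .
  have MA: "M \<subseteq> A" unfolding A_def using q.ker_pre[OF t(1)] ker by simp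
  have preN: "q.pre N = N0" unfolding N using q.pre_image[OF n0(1)] N0(2) ker n0(3) by simp
  have AN: "A \<subseteq> N0" unfolding A_def preN[symmetric] using t(3) unfolding q.pre_def by blast
  have nA: "normal_in A N0"
  proof -
    have "cj x a \<in> A" if x: "x \<in> N0" and a: "a \<in> A" for x a
    proof -
      have c: "x \<in> carrier G" "a \<in> carrier G" using x a n0(3) Ac by blast+
      have "\<pi> x \<in> N" "\<pi> a \<in> T" using x a N \<pi>A by blast+
      then have "\<pi> (cj x a) \<in> T" using q.h_cj[OF c] t(4) by simp
      then show ?thesis unfolding A_def q.pre_def using c by simp
    qed
    then show ?thesis unfolding normal_in_def using sA n0(1) AN by blast
  qed
  have nMA: "normal_in M A" using normal_in_sub[OF M sA MA Ac] .
  have "(#>) M ` A = T" using \<pi>A unfolding \<pi>_def .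
  then have "carrier (section_group G A M) = T" unfolding carrier_FactGroup by simp
  moreover have "set_mult (G\<lparr>carrier := A\<rparr>) = set_mult G" by (intro ext) simp
  ultimately have S: "section_group G A M = Q\<lparr>carrier := T\<rparr>" unfolding Q_def FactGroup_def by simp
  have cf: "composition_factor G A M"
    by (rule composition_factorI[OF N0(1) nA M nMA]) (use T(2) S in simp)
  define Yt where "Yt = q.pre Y"
  have sYt: "subgroup Yt G" unfolding Yt_def using q.pre_subgroup[OF Y(1)] .
  have \<pi>Y: "\<pi> ` Yt = Y" unfolding Yt_def using q.image_pre[OF Yc] .
  have NYt: "N0 \<subseteq> Yt" unfolding Yt_def preN[symmetric] using Y(2) unfolding q.pre_def by blast
  have Ytc: "Yt \<subseteq> carrier G" using sYt subgroup.subset by blast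
  have nYt: "normal_in N0 Yt" using normal_in_sub[OF N0(1) sYt NYt Ytc] .
  have "nilpotent_mod Yt N0"
  proof -
    have "x \<in> N0" if "x \<in> Yt" "\<pi> x \<in> N" for x using that preN Ytc unfolding q.pre_def by blast
    moreover have "Q.nilpotent_mod (\<pi> ` Yt) N" using Y(3) \<pi>Y by simp
    ultimately have "group.nilpotent_mod (G\<lparr>carrier := carrier G\<rparr>) Yt N0"
      using q.gh.nilpotent_mod_preimage[OF subgroup_incl[OF sYt q.subA Ytc]] by blast
    then show ?thesis by simp
  qed
  then obtain R where R: "subgroup R G" "R \<subseteq> Yt" "nilpotent_mod R {\<one>}" "R <#> N0 = Yt" using nilpotent_mod_lift[OF nYt] by blast
  have nR: "nilpotent_subgroup R G" unfolding nilpotent_subgroup_iff using R by blast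
  define h where "h = (\<lambda>x. restrict (Q.cj x) T)"
  define \<Gamma> where "\<Gamma> = AutoGroup (Q\<lparr>carrier := T\<rparr>)"
  define B where "B = Q.norm_cent Y T"
  note b = Q.norm_cent_props[OF Y(1) t(1), folded B_def]
  have sh: "surj_hom Q (\<Gamma>\<lparr>carrier := h ` B\<rparr>) B h"
    and kh: "surj_hom.ker (\<Gamma>\<lparr>carrier := h ` B\<rparr>) B h = Q.centralizer T"
    unfolding \<Gamma>_def h_def using Q.surj_hom_conj_aut[OF b(1,5,3) t(1)] by blast+
  interpret TT: group "Q\<lparr>carrier := T\<rparr>" using Q.subgroup_imp_group[OF t(1)] .
  interpret \<Gamma>: group \<Gamma> unfolding \<Gamma>_def by (rule TT.AutoGroup)
  interpret hb: surj_hom Q "\<Gamma>\<lparr>carrier := h ` B\<rparr>" B h by (rule sh)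
  have Bc: "x \<in> carrier Q" if "x \<in> B" for x using that b(1) Q.subgroupD by blast
  have hmem: "h x \<in> carrier \<Gamma>" if x: "x \<in> B" for x
  proof -
    have "h \<in> hom (Q\<lparr>carrier := B\<rparr>) \<Gamma>" unfolding h_def \<Gamma>_def
    proof -
      have "Q.cj y s \<in> T" if "y \<in> B" "s \<in> T" for y s using b(5) Q.stabilD(2)[of y _ T] that by blast
      then show "(\<lambda>x. restrict (Q.cj x) T) \<in> hom (Q\<lparr>carrier := B\<rparr>) (AutoGroup (Q\<lparr>carrier := T\<rparr>))"
        using Q.action_hom[OF b(1) TT.is_group, of Q.cj] Q.cj_mult Q.cj_cj Tc Bc by (simp add: subset_iff)
    qed
    then show ?thesis using x unfolding hom_def by auto
  qed
  have sub: "subgroup (h ` B) \<Gamma>"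
  proof (rule \<Gamma>.subgroupI)
    show "h ` B \<subseteq> carrier \<Gamma>" using hmem by blast
    show "h ` B \<noteq> {}" using Q.sub_1[OF b(1)] by blast
    have mult: "h x \<otimes>\<^bsub>\<Gamma>\<^esub> h y = h (x \<otimes>\<^bsub>Q\<^esub> y)" if "x \<in> B" "y \<in> B" for x y using hb.h_mult[OF that] by simp
    have one: "h \<one>\<^bsub>Q\<^esub> = \<one>\<^bsub>\<Gamma>\<^esub>" using hb.h_one by simp
    fix a assume "a \<in> h ` B"
    then obtain x where x: "x \<in> B" "a = h x" by blast
    have ix: "inv\<^bsub>Q\<^esub> x \<in> B" using Q.sub_i[OF b(1) x(1)] .
    have "h (inv\<^bsub>Q\<^esub> x) \<otimes>\<^bsub>\<Gamma>\<^esub> h x = \<one>\<^bsub>\<Gamma>\<^esub>" using mult[OF ix x(1)] Q.l_inv[OF Bc[OF x(1)]] one by simp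
    then have "inv\<^bsub>\<Gamma>\<^esub> a = h (inv\<^bsub>Q\<^esub> x)" unfolding x(2) using \<Gamma>.inv_equality hmem x ix by blast
    then show "inv\<^bsub>\<Gamma>\<^esub> a \<in> h ` B" using ix by blast
    fix c assume "c \<in> h ` B"
    then obtain y where y: "y \<in> B" "c = h y" by blast
    show "a \<otimes>\<^bsub>\<Gamma>\<^esub> c \<in> h ` B" unfolding x(2) y(2) mult[OF x(1) y(1)] using Q.sub_m[OF b(1) x(1) y(1)] by blast
  qed
  have ind: "induced_aut G A M x = h (\<pi> (inv x))" if x: "x \<in> carrier G" for x
  proof -
    have xM: "x \<in> normalizer G M" using normalizer_eq[OF subgroup.subset[OF m(1)]] normal_in_cjs[OF M x] x by blast
    have ix: "inv x \<in> carrier G" using x by simp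
    have "induced_aut G A M x w = h (\<pi> (inv x)) w" for w
    proof (cases "w \<in> T")
      case True
      then obtain a where a: "a \<in> A" "w = \<pi> a" using \<pi>A by blast
      have ac: "a \<in> carrier G" using a Ac by blast
      have "induced_aut G A M x (M #> a) = M #> (inv x \<otimes> a \<otimes> x)"
        using induced_aut_coset[OF sA _ xM a(1)] normal_in_iff[OF sA] nMA by blast
      also have "\<dots> = \<pi> (cj (inv x) a)" unfolding \<pi>_def cj_def using x by simp
      also have "\<dots> = Q.cj (\<pi> (inv x)) (\<pi> a)" using q.h_cj[OF ix ac] .
      finally have "induced_aut G A M x w = Q.cj (\<pi> (inv x)) w" unfolding a(2) \<pi>_def .
      then show ?thesis unfolding h_def using True by simp
    next
      case False
      then show ?thesis unfolding h_def induced_aut_def S by simp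
    qed
    then show ?thesis by (rule ext)
  qed
  have norm: "cjs x A = A \<longleftrightarrow> Q.cjs (\<pi> x) T = T" if x: "x \<in> carrier G" for x
  proof
    assume "cjs x A = A"
    then show "Q.cjs (\<pi> x) T = T" using q.h_cjs[OF x Ac] \<pi>A by simp
  next
    assume e: "Q.cjs (\<pi> x) T = T"
    have "cjs x A \<subseteq> A"
    proof (rule image_subsetI)
      fix a assume a: "a \<in> A"
      have ac: "a \<in> carrier G" using a Ac by blast
      have "\<pi> (cj x a) = Q.cj (\<pi> x) (\<pi> a)" using q.h_cj[OF x ac] .
      moreover have "\<pi> a \<in> T" using a \<pi>A by blast
      ultimately have "\<pi> (cj x a) \<in> T" using e by blast
      then show "cj x a \<in> A" unfolding A_def q.pre_def using x ac by simp
    qed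
    then show "cjs x A = A" using cjs_sub_eq[OF x Ac] by blast
  qed
  have sn: "x \<in> section_normalizer G R A M \<longleftrightarrow> x \<in> R \<and> Q.cjs (\<pi> x) T = T" for x
  proof (cases "x \<in> carrier G")
    case True
    then show ?thesis
      unfolding section_normalizer_def normalizer_eq[OF Ac] normalizer_eq[OF subgroup.subset[OF m(1)]]
      using normal_in_cjs[OF M True] norm[OF True] by simp
  next
    case False
    then show ?thesis unfolding section_normalizer_def using subgroupD[OF R(1), of x] by auto
  qed
  have RB: "\<pi> x \<in> Q.stabil Y T" if "x \<in> R" "Q.cjs (\<pi> x) T = T" for x
    using that R(2) \<pi>Y by (intro Q.stabilI) blast+
  have RX: "inv x \<in> R \<and> Q.cjs (\<pi> (inv x)) T = T" if "x \<in> R" "Q.cjs (\<pi> x) T = T" for x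
  proof
    show "inv x \<in> R" using sub_i[OF R(1) that(1)] .
    have c: "x \<in> carrier G" using subgroupD[OF R(1) that(1)] .
    have "Q.cjs (inv\<^bsub>Q\<^esub> (\<pi> x)) T = T" using Q.cjs_inv_eq[OF q.h_closed[OF c] Tc that(2)] .
    then show "Q.cjs (\<pi> (inv x)) T = T" using q.h_inv[OF c] by simp
  qed
  have TY: "T \<subseteq> Q.stabil Y T"
  proof
    fix x assume x: "x \<in> T"
    then have "x \<in> Y" using t(3) Y(2) by blast
    then show "x \<in> Q.stabil Y T" using Q.cjs_self[OF t(1) x] by (rule Q.stabilI)
  qed
  have inner: "inner_auts (Q\<lparr>carrier := T\<rparr>) = h ` T"
  proof -
    have e: "(\<lambda>x\<in>carrier (Q\<lparr>carrier := T\<rparr>). inv\<^bsub>Q\<lparr>carrier := T\<rparr>\<^esub> g \<otimes>\<^bsub>Q\<lparr>carrier := T\<rparr>\<^esub> x \<otimes>\<^bsub>Q\<lparr>carrier := T\<rparr>\<^esub> g) = h (inv\<^bsub>Q\<^esub> g)"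
      if "g \<in> T" for g
      unfolding h_def Q.cj_def using Q.m_inv_consistent[OF t(1) that] Tc that by auto
    have "inner_auts (Q\<lparr>carrier := T\<rparr>) = (\<lambda>g. h (inv\<^bsub>Q\<^esub> g)) ` T"
      unfolding inner_auts_def using e by (intro image_cong) auto
    also have "\<dots> = h ` T"
    proof
      show "(\<lambda>g. h (inv\<^bsub>Q\<^esub> g)) ` T \<subseteq> h ` T" using Q.sub_i[OF t(1)] by blast
      show "h ` T \<subseteq> (\<lambda>g. h (inv\<^bsub>Q\<^esub> g)) ` T"
      proof (rule image_subsetI)
        fix g assume g: "g \<in> T"
        have "h g = h (inv\<^bsub>Q\<^esub> (inv\<^bsub>Q\<^esub> g))" using g Tc by auto
        then show "h g \<in> (\<lambda>g. h (inv\<^bsub>Q\<^esub> g)) ` T" using Q.sub_i[OF t(1) g] by blast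
      qed
    qed
    finally show ?thesis .
  qed
  define X0 where "X0 = induced_auts G R A M \<union> inner_auts (Q\<lparr>carrier := T\<rparr>)"
  have X0i: "h (\<pi> x) \<in> X0" if "x \<in> R" "Q.cjs (\<pi> x) T = T" for x
  proof -
    have c: "x \<in> carrier G" using subgroupD[OF R(1) that(1)] .
    have "induced_aut G A M (inv x) = h (\<pi> x)" using ind[of "inv x"] c by simp
    moreover have "inv x \<in> section_normalizer G R A M" using RX[OF that] unfolding sn .
    then have "induced_aut G A M (inv x) \<in> induced_auts G R A M" unfolding induced_auts_def by (rule imageI)
    ultimately show ?thesis unfolding X0_def by simp
  qed
  have X0s: "X0 \<subseteq> h ` B"
  proof -
    have "induced_auts G R A M \<subseteq> h ` B"
      unfolding induced_auts_def
    proof (rule image_subsetI)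
      fix x assume "x \<in> section_normalizer G R A M"
      then have x: "x \<in> R" "Q.cjs (\<pi> x) T = T" using sn by auto
      have c: "x \<in> carrier G" using subgroupD[OF R(1) x(1)] .
      show "induced_aut G A M x \<in> h ` B" unfolding ind[OF c] using RB RX[OF x] b(2) by blast
    qed
    then show ?thesis unfolding X0_def inner using TY b(2) by blast
  qed
  have gen: "generate \<Gamma> X0 = h ` B"
  proof
    show "generate \<Gamma> X0 \<subseteq> h ` B" using \<Gamma>.generate_subgroup_incl[OF X0s sub] .
    show "h ` B \<subseteq> generate \<Gamma> X0"
    proof (rule image_subsetI)
      fix x assume "x \<in> B"
      then obtain y c where y: "y \<in> Q.stabil Y T" "c \<in> Q.centralizer T" "x = y \<otimes>\<^bsub>Q\<^esub> c" unfolding B_def Q.norm_cent_def by (rule Q.mult_memE)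
      have ker_one: "h z = \<one>\<^bsub>\<Gamma>\<^esub>" if "z \<in> Q.centralizer T" for z using that kh unfolding hb.ker_def by auto
      have yB: "y \<in> B" "c \<in> B" using y b(2,3) by blast+
      have yY: "y \<in> Y" "y \<in> carrier Q" using Q.stabilD(1)[OF y(1)] Yc by blast+
      have hx: "h x = h y" unfolding y(3) using hb.h_mult[OF yB] ker_one[OF y(2)] hmem[OF yB(1)] by simp
      obtain z where z: "z \<in> Yt" "y = \<pi> z" using yY(1) \<pi>Y by blast
      obtain r u where r: "r \<in> R" "u \<in> N0" "z = r \<otimes> u" using z(1) R(4) by (blast elim: mult_memE)
      have c: "r \<in> carrier G" "u \<in> carrier G" using r R(1) n0(1) subgroupD by blast+
      have \<pi>c: "\<pi> r \<in> carrier Q" "\<pi> u \<in> carrier Q" using c q.h_closed by auto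
      have yru: "y = \<pi> r \<otimes>\<^bsub>Q\<^esub> \<pi> u" unfolding z(2) r(3) using q.h_mult[OF c] .
      have uN: "\<pi> u \<in> N" using r N by blast
      obtain d s where d: "d \<in> Q.centralizer T" "s \<in> T" "\<pi> u = d \<otimes>\<^bsub>Q\<^esub> s" using dec[OF uN] by blast
      have uT: "Q.cjs (\<pi> u) T = T" using Q.normal_in_cjs[OF T(1) uN] .
      have "Q.cjs y T = Q.cjs (\<pi> r) (Q.cjs (\<pi> u) T)" unfolding yru using Q.cjs_cjs[OF \<pi>c Tc] by simp
      \<comment> \<open>Both \<open>y\<close> and the \<open>N\<close>-part of \<open>y\<close>
        stabilize \<open>T\<close>, hence so does the \<open>R\<close>-part, whose action is one of
        the generators.\<close>
      then have rT: "Q.cjs (\<pi> r) T = T" using Q.stabilD(2)[OF y(1)] uT by simp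
      have rB: "\<pi> r \<in> B" using RB[OF r(1) rT] b(2) by blast
      have dB: "d \<in> B" "s \<in> B" using d b(2,3) TY by blast+
      have uB: "\<pi> u \<in> B" unfolding d(3) using Q.sub_m[OF b(1) dB] .
      have "h y = h (\<pi> r) \<otimes>\<^bsub>\<Gamma>\<^esub> h (\<pi> u)" unfolding yru using hb.h_mult[OF rB uB] by simp
      also have "h (\<pi> u) = h s" unfolding d(3) using hb.h_mult[OF dB] ker_one[OF d(1)] hmem[OF dB(2)] by simp
      finally have "h y = h (\<pi> r) \<otimes>\<^bsub>\<Gamma>\<^esub> h s" .
      moreover have "h (\<pi> r) \<in> generate \<Gamma> X0" using generate.incl[OF X0i[OF r(1) rT]] .
      moreover have "h s \<in> generate \<Gamma> X0" using d(2) inner unfolding X0_def by (intro generate.incl) blast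
      ultimately show "h x \<in> generate \<Gamma> X0" unfolding hx using generate.eng by metis
    qed
  qed
  have "carter_conjugate (\<Gamma>\<lparr>carrier := h ` B\<rparr>)"
  proof -
    have "\<not> comm_group (section_group G A M)" using T(3) unfolding S .
    then have "carter_conjugate (AutoGroup (section_group G A M)\<lparr>carrier :=
      generate (AutoGroup (section_group G A M)) (induced_auts G R A M \<union> inner_auts (section_group G A M))\<rparr>)"
      using C cf nR unfolding condition_C_def Let_def by blast
    then show ?thesis unfolding S unfolding \<Gamma>_def[symmetric] X0_def[symmetric] gen .
  qed
  from hb.carter_mod_conj_from_image[OF this, unfolded kh, of L1 L2] show ?thesis using L unfolding B_def by blast
qed

end

subsection \<open>Ascent along a chief factor\<close>

context fin_group begin

text \<open>The common interface of abelian and nonabelian chief factors. It ranges over all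
  \<open>Y\<close> with nilpotent \<open>Y / N\<close>, because it is used for preimages of Carter
  subgroups of the quotient as well as for \<open>K N\<close>.\<close>

definition chief_criterion :: "'a set \<Rightarrow> 'i set \<Rightarrow> ('i \<Rightarrow> 'a set) \<Rightarrow> bool" where
  "chief_criterion N J T \<longleftrightarrow> (\<forall>Y. subgroup Y G \<and> N \<subseteq> Y \<and> nilpotent_mod Y N \<longrightarrow>
     (\<forall>K. carter_mod Y {\<one>} K \<longrightarrow> K <#> N = Y) \<and>
     (\<forall>K L. carter_mod Y {\<one>} K \<and> carter_mod Y {\<one>} L \<longrightarrow> (\<exists>x\<in>Y. L = cjs x K)) \<and>
     ((\<exists>K. carter_mod Y {\<one>} K) \<longleftrightarrow> (\<forall>j\<in>J. \<exists>L. carter_mod (norm_cent Y (T j)) (centralizer (T j)) L)))"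

text \<open>Here \<open>Y\<close> is metanilpotent, and both sides of the existence equivalence are
  simply true.\<close>

lemma chief_criterion_abelian:
  assumes N: "normal_in N (carrier G)" and ab: "\<And>a b. a \<in> N \<Longrightarrow> b \<in> N \<Longrightarrow> commutator a b = \<one>"
    and T: "\<And>j. j \<in> J \<Longrightarrow> subgroup (T j) G" "\<And>j. j \<in> J \<Longrightarrow> N \<subseteq> centralizer (T j)"
  shows "chief_criterion N J T"
  unfolding chief_criterion_def
proof (intro allI impI, elim conjE)
  fix Y assume Y: "subgroup Y G" "N \<subseteq> Y" and n: "nilpotent_mod Y N"
  have NY: "normal_in N Y" using normal_in_sub[OF N Y subgroup.subset[OF Y(1)]] .
  have "N \<subseteq> upper_central N {\<one>} (Suc 0)" using ab by auto
  then have nN: "nilpotent_mod N {\<one>}" unfolding nilpotent_mod_def by blast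
  have 1: "{\<one>} \<subseteq> N" using sub_1[OF normal_inD(1)[OF N]] by blast
  note one = normal_in_one[OF Y(1)]
  have "K <#> N = Y" if "carter_mod Y {\<one>} K" for K using metanil_supplement[OF NY nN n that] .
  moreover have "\<exists>x\<in>Y. L = cjs x K" if "carter_mod Y {\<one>} K" "carter_mod Y {\<one>} L" for K L
    using metanil_carter_mod_conj[OF one NY 1 nN n that] .
  moreover have "\<exists>K. carter_mod Y {\<one>} K" using metanil_carter_mod_ex[OF one NY 1 nN n] .
  moreover have "carter_mod (norm_cent Y (T j)) (centralizer (T j)) (norm_cent Y (T j))" if "j \<in> J" for j
    using carter_mod_norm_cent_nilpotent_mod[OF Y(1) T(1)[OF that] n T(2)[OF that]] .
  ultimately show "(\<forall>K. carter_mod Y {\<one>} K \<longrightarrow> K <#> N = Y) \<and>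
     (\<forall>K L. carter_mod Y {\<one>} K \<and> carter_mod Y {\<one>} L \<longrightarrow> (\<exists>x\<in>Y. L = cjs x K)) \<and>
     ((\<exists>K. carter_mod Y {\<one>} K) \<longleftrightarrow> (\<forall>j\<in>J. \<exists>L. carter_mod (norm_cent Y (T j)) (centralizer (T j)) L))"
    by blast
qed

lemma chief_criterion_nonabelian:
  assumes N: "normal_in N (carrier G)"
    and S: "component_system (carrier G) N ((\<lambda>j. centralizer (T j)) ` J)"
    and st: "\<And>Y j. subgroup Y G \<Longrightarrow> j \<in> J \<Longrightarrow> stabil Y (centralizer (T j)) = stabil Y (T j)"
    and conj: "\<And>Y j L M. subgroup Y G \<Longrightarrow> N \<subseteq> Y \<Longrightarrow> nilpotent_mod Y N \<Longrightarrow> j \<in> J \<Longrightarrow>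
      carter_mod (norm_cent Y (T j)) (centralizer (T j)) L \<Longrightarrow> carter_mod (norm_cent Y (T j)) (centralizer (T j)) M \<Longrightarrow> \<exists>a\<in>norm_cent Y (T j). M = cjs a L"
  shows "chief_criterion N J T"
  unfolding chief_criterion_def
proof (intro allI impI, elim conjE)
  fix Y assume Y: "subgroup Y G" "N \<subseteq> Y" and n: "nilpotent_mod Y N"
  define \<C> where "\<C> = (\<lambda>j. centralizer (T j)) ` J"
  have S': "component_system Y N \<C>" unfolding \<C>_def using component_system_restrict[OF S Y subgroup.subset[OF Y(1)]] .
  have sp: "stab_mult Z (centralizer (T j)) = norm_cent Z (T j)" if "subgroup Z G" "j \<in> J" for Z j
    unfolding stab_mult_def norm_cent_def st[OF that] ..
  have H: "components_conjugate Y N \<C>"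
    unfolding components_conjugate_def
  proof (intro allI impI, elim conjE)
    fix Z C L M assume Z: "subgroup Z G" "N \<subseteq> Z" "Z \<subseteq> Y" and C: "C \<in> \<C>"
      and L: "carter_mod (stab_mult Z C) C L" and M: "carter_mod (stab_mult Z C) C M"
    obtain j where j: "j \<in> J" "C = centralizer (T j)" using C unfolding \<C>_def by blast
    have "nilpotent_mod Z N" using nilpotent_mod_sub'[OF n Z(3,1) order_refl] .
    from conj[OF Z(1,2) this j(1)] L M show "\<exists>a\<in>stab_mult Z C. M = cjs a L" unfolding j(2) sp[OF Z(1) j(1)] by blast
  qed
  have "K <#> N = Y" if "carter_mod Y {\<one>} K" for K using component_system_carter_mod_conj(1)[OF S' n H that] .
  moreover have "\<exists>x\<in>Y. L = cjs x K" if "carter_mod Y {\<one>} K" "carter_mod Y {\<one>} L" for K L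
    using component_system_carter_mod_conj(2)[OF S' n H that] .
  moreover have "(\<exists>K. carter_mod Y {\<one>} K) \<longleftrightarrow> (\<forall>j\<in>J. \<exists>L. carter_mod (norm_cent Y (T j)) (centralizer (T j)) L)"
  proof
    assume "\<exists>K. carter_mod Y {\<one>} K"
    then obtain K where K: "carter_mod Y {\<one>} K" by blast
    have "carter_mod (norm_cent Y (T j)) (centralizer (T j)) (stab_mult K (centralizer (T j)))" if j: "j \<in> J" for j
      using component_carter_mod[OF S' K component_system_carter_mod_conj(1)[OF S' n H K], of "centralizer (T j)"] j sp[OF Y(1) j] unfolding \<C>_def by simp
    then show "\<forall>j\<in>J. \<exists>L. carter_mod (norm_cent Y (T j)) (centralizer (T j)) L" by blast
  next
    assume ex: "\<forall>j\<in>J. \<exists>L. carter_mod (norm_cent Y (T j)) (centralizer (T j)) L"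
    show "\<exists>K. carter_mod Y {\<one>} K"
    proof (rule component_system_carter_mod_ex[OF S' n H])
      fix C assume "C \<in> \<C>"
      then obtain j where j: "j \<in> J" "C = centralizer (T j)" unfolding \<C>_def by blast
      show "\<exists>L. carter_mod (stab_mult Y C) C L" unfolding j(2) sp[OF Y(1) j(1)] using ex j(1) by blast
    qed
  qed
  ultimately show "(\<forall>K. carter_mod Y {\<one>} K \<longrightarrow> K <#> N = Y) \<and>
     (\<forall>K L. carter_mod Y {\<one>} K \<and> carter_mod Y {\<one>} L \<longrightarrow> (\<exists>x\<in>Y. L = cjs x K)) \<and>
     ((\<exists>K. carter_mod Y {\<one>} K) \<longleftrightarrow> (\<forall>j\<in>J. \<exists>L. carter_mod (norm_cent Y (T j)) (centralizer (T j)) L))"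
    by blast
qed

text \<open>Once \<open>B\<close> is a Carter subgroup modulo \<open>N\<close>, conjugacy in the
  quotient moves every Carter subgroup \<open>K\<close> into \<open>B\<close> with
  \<open>K N = B\<close> (\<open>step\<close>), and the criterion for \<open>Y = B\<close> answers
  the rest.\<close>

lemma chief_ascent:
  assumes N: "normal_in N (carrier G)" and g: "chief_criterion N J T"
    and hc: "\<And>K L. carter_mod (carrier G) N K \<Longrightarrow> carter_mod (carrier G) N L \<Longrightarrow> \<exists>x\<in>carrier G. L = cjs x K"
  shows "carter_mod (carrier G) {\<one>} K \<Longrightarrow> carter_mod (carrier G) N (K <#> N)"
    and "carter_mod (carrier G) {\<one>} K \<Longrightarrow> carter_mod (carrier G) {\<one>} L \<Longrightarrow> \<exists>x\<in>carrier G. L = cjs x K"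
    and "carter_mod (carrier G) N B \<Longrightarrow>
      (\<exists>K. carter_mod (carrier G) {\<one>} K) \<longleftrightarrow> (\<forall>j\<in>J. \<exists>L. carter_mod (norm_cent B (T j)) (centralizer (T j)) L)"
proof -
  note n = normal_inD[OF N]
  have 1: "{\<one>} \<subseteq> N" using sub_1[OF n(1)] by blast
  have one: "normal_in {\<one>} (carrier G)" using normal_in_one[OF subgroup_self] .
  have sup: "K <#> N = Y" if "subgroup Y G" "N \<subseteq> Y" "nilpotent_mod Y N" "carter_mod Y {\<one>} K" for Y K
    using g that unfolding chief_criterion_def by blast
  have cj: "\<exists>x\<in>Y. L = cjs x K" if "subgroup Y G" "N \<subseteq> Y" "nilpotent_mod Y N" "carter_mod Y {\<one>} K" "carter_mod Y {\<one>} L" for Y K L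
    using g that unfolding chief_criterion_def by blast
  have ex: "(\<exists>K. carter_mod Y {\<one>} K) \<longleftrightarrow> (\<forall>j\<in>J. \<exists>L. carter_mod (norm_cent Y (T j)) (centralizer (T j)) L)"
    if "subgroup Y G" "N \<subseteq> Y" "nilpotent_mod Y N" for Y
    using g that unfolding chief_criterion_def by blast
  show up: "carter_mod (carrier G) N (K <#> N)" if K: "carter_mod (carrier G) {\<one>} K" for K
  proof (rule carter_mod_prod[OF N one 1 K])
    note k = carter_modD[OF K]
    note p = prod_normal_in[OF N k(1,3)]
    fix K' assume K': "carter_mod (K <#> N) {\<one>} K'"
    have "nilpotent_mod (K <#> N) N" using nilpotent_mod_mult[OF N k(1,3,4) 1] .
    then show "\<exists>x\<in>K <#> N. K' = cjs x K" using cj[OF p(1,3) _ carter_mod_restrict[OF K p(2,4)] K'] by blast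
  qed
  have step: "\<exists>x\<in>carrier G. cjs x K <#> N = B \<and> carter_mod (carrier G) {\<one>} (cjs x K) \<and> carter_mod B {\<one>} (cjs x K)"
    if K: "carter_mod (carrier G) {\<one>} K" and B: "carter_mod (carrier G) N B" for K B
  proof -
    note k = carter_modD[OF K]
    obtain x where x: "x \<in> carrier G" "B = cjs x (K <#> N)" using hc[OF up[OF K] B] by blast
    have e: "cjs x K <#> N = B"
      unfolding x(2) using cjs_prod[OF x(1) subgroup.subset[OF k(1)] subgroup.subset[OF n(1)]] normal_in_cjs[OF N x(1)] by simp
    have c: "carter_mod (carrier G) {\<one>} (cjs x K)" using carter_mod_cjs_in[OF x(1) K one] .
    note p = prod_normal_in[OF N carter_modD(1,3)[OF c], unfolded e]
    show ?thesis using x(1) e c carter_mod_restrict[OF c p(2,4)] by blast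
  qed
  show "\<exists>x\<in>carrier G. L = cjs x K" if K: "carter_mod (carrier G) {\<one>} K" and L: "carter_mod (carrier G) {\<one>} L" for K L
  proof -
    define B where "B = L <#> N"
    note l = carter_modD[OF L]
    have B: "carter_mod (carrier G) N B" unfolding B_def using up[OF L] .
    note b = carter_modD[OF B]
    obtain x where x: "x \<in> carrier G" "carter_mod B {\<one>} (cjs x K)" using step[OF K B] by blast
    have "carter_mod B {\<one>} L" using carter_mod_restrict[OF L] prod_normal_in(2,4)[OF N l(1,3)] unfolding B_def by blast
    then obtain y where y: "y \<in> B" "L = cjs y (cjs x K)" using cj[OF b(1,2,4) x(2)] by blast
    have yc: "y \<in> carrier G" using y b(3) by blast
    have "L = cjs (y \<otimes> x) K" unfolding y(2) using cjs_cjs[OF yc x(1) carter_modD(3)[OF K]] .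
    then show ?thesis using yc x(1) by blast
  qed
  show "(\<exists>K. carter_mod (carrier G) {\<one>} K) \<longleftrightarrow> (\<forall>j\<in>J. \<exists>L. carter_mod (norm_cent B (T j)) (centralizer (T j)) L)" if B: "carter_mod (carrier G) N B"
  proof -
    note b = carter_modD[OF B]
    have "(\<exists>K. carter_mod (carrier G) {\<one>} K) \<longleftrightarrow> (\<exists>K. carter_mod B {\<one>} K)"
    proof
      assume "\<exists>K. carter_mod (carrier G) {\<one>} K"
      then show "\<exists>K. carter_mod B {\<one>} K" using step[OF _ B] by blast
    next
      assume "\<exists>K. carter_mod B {\<one>} K"
      then obtain K where K: "carter_mod B {\<one>} K" by blast
      have "K <#> N = B" using sup[OF b(1,2,4) K] .
      then show "\<exists>K. carter_mod (carrier G) {\<one>} K" using carter_mod_trans[OF B K _ N] by blast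
    qed
    then show ?thesis using ex[OF b(1,2,4)] by simp
  qed
qed

lemma comm_group_iff_centralizer:
  assumes T: "subgroup T G"
  shows "comm_group (G\<lparr>carrier := T\<rparr>) \<longleftrightarrow> T \<subseteq> centralizer T"
proof -
  interpret T: group "G\<lparr>carrier := T\<rparr>" using subgroup_imp_group[OF T] .
  have c: "cj s t = t \<longleftrightarrow> s \<otimes> t = t \<otimes> s" if "s \<in> T" "t \<in> T" for s t
  proof -
    have "s \<in> carrier G" "t \<in> carrier G" using that T subgroupD by blast+
    then show ?thesis unfolding cj_def by (metis inv_solve_right m_closed)
  qed
  show ?thesis
  proof
    assume "comm_group (G\<lparr>carrier := T\<rparr>)"
    then interpret C: comm_group "G\<lparr>carrier := T\<rparr>" .
    have "s \<otimes> t = t \<otimes> s" if "s \<in> T" "t \<in> T" for s t using C.m_comm that by simp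
    then show "T \<subseteq> centralizer T" unfolding centralizer_def using c subgroup.subset[OF T] by blast
  next
    assume TT: "T \<subseteq> centralizer T"
    have "s \<otimes> t = t \<otimes> s" if "s \<in> T" "t \<in> T" for s t using c[OF that] TT centralizerD(1)[OF _ that(2)] that(1) by blast
    then show "comm_group (G\<lparr>carrier := T\<rparr>)" by (intro T.group_comm_groupI) simp
  qed
qed

lemma simple_subgroupI:
  assumes T: "subgroup T G" and s: "simple_group (G\<lparr>carrier := T\<rparr>)"
  shows "simple_subgroup T"
  using simple_group.simple_not_triv[OF s] simple_group.no_real_normal_subgroup[OF s] normal_in_iff[OF T] T
  unfolding simple_subgroup_def by auto

text \<open>Everything is carried out in \<open>Q = G / M\<close>, with \<open>N\<close> the image
  of \<open>N0\<close>, and only at the end read off through the natural map onto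
  \<open>G / N0\<close>.\<close>

theorem chief_step:
  fixes M N0 and T :: "'i \<Rightarrow> 'a set set"
  defines "Q \<equiv> G Mod M" and "P \<equiv> section_group G N0 M"
  assumes C: "condition_C G" and M: "normal_in M (carrier G)" and N0: "normal_in N0 (carrier G)" "M \<subseteq> N0" and J: "finite J"
    and dp: "internal_direct_product P J T"
    and si: "\<And>j. j \<in> J \<Longrightarrow> simple_group (P\<lparr>carrier := T j\<rparr>)"
    and iso: "\<And>j l. j \<in> J \<Longrightarrow> l \<in> J \<Longrightarrow> P\<lparr>carrier := T j\<rparr> \<cong> P\<lparr>carrier := T l\<rparr>"
    and hc: "carter_conjugate (G Mod N0)"
  shows "carter_conjugate Q"
    and "carter_subgroup K Q \<Longrightarrow> \<exists>L. carter_subgroup L (G Mod N0)"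
    and "carter_subgroup B (G Mod N0) \<Longrightarrow> (\<exists>K. carter_subgroup K Q) \<longleftrightarrow>
      (\<forall>j\<in>J. \<exists>L. carter_subgroup L (induced_aut_group Q (factor_preimage G N0 M B) (T j) {\<one>\<^bsub>Q\<^esub>}))"
proof -
  define \<pi> where "\<pi> = (\<lambda>x. M #> x)"
  define N where "N = \<pi> ` N0"
  note m = normal_inD[OF M] and n0 = normal_inD[OF N0(1)]
  have Qeq: "Q = section_group G (carrier G) M" unfolding Q_def by simp
  interpret Q: fin_group Q unfolding Qeq using fin_group_section[OF M] .
  interpret q: surj_hom G Q "carrier G" \<pi> unfolding Qeq \<pi>_def using quot_surj_hom(1)[OF M] .
  have Mc: "M \<subseteq> carrier G" and N0c: "N0 \<subseteq> carrier G" using m(3) n0(3) by auto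
  have cP: "carrier P = N" unfolding P_def N_def \<pi>_def carrier_FactGroup by simp
  have "set_mult (G\<lparr>carrier := N0\<rparr>) = set_mult G" by (intro ext) simp
  then have Peq: "P = Q\<lparr>carrier := N\<rparr>" using cP unfolding Q_def P_def FactGroup_def by simp
  have PT: "P\<lparr>carrier := W\<rparr> = Q\<lparr>carrier := W\<rparr>" for W unfolding Peq by simp
  have sN: "subgroup N Q" unfolding N_def using q.image_subgroup[OF n0(1,3)] .
  have Nn: "Q.normal_in N (carrier Q)"
  proof -
    have "Q.cj x y \<in> N" if x: "x \<in> carrier Q" and y: "y \<in> N" for x y
    proof -
      obtain a where a: "a \<in> carrier G" "x = \<pi> a" using x q.surj by blast
      obtain b where b: "b \<in> N0" "y = \<pi> b" using y unfolding N_def by blast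
      have "Q.cj x y = \<pi> (cj a b)" unfolding a(2) b(2) using q.h_cj[OF a(1)] b(1) N0c by auto
      then show ?thesis unfolding N_def using n0(4)[OF a(1) b(1)] by blast
    qed
    then show ?thesis unfolding Q.normal_in_def using sN Q.subgroup_self subgroup.subset[OF sN] by blast
  qed
  \<comment> \<open>The natural map from \<open>G / M\<close> to \<open>G / N0\<close> in the form
    used by \<open>factor_preimage\<close>, so that full preimages agree by definition.\<close>
  define \<phi> where "\<phi> = (\<lambda>W. N0 <#> W)"
  define R where "R = G Mod N0"
  have N0n: "N0 \<lhd> G" using normal_in_carrier_iff N0(1) by blast
  interpret R: group R unfolding R_def using normal.factorgroup_is_group[OF N0n] .
  have \<phi>\<pi>: "\<phi> (\<pi> x) = N0 #> x" if x: "x \<in> carrier G" for x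
  proof -
    have "N0 <#> M = N0"
    proof
      show "N0 <#> M \<subseteq> N0" using prod_subset[OF n0(1) order_refl N0(2)] .
      show "N0 \<subseteq> N0 <#> M" using prod_normal_in(2)[OF M n0(1) N0c] .
    qed
    then show ?thesis unfolding \<phi>_def \<pi>_def using setmult_rcos_assoc[OF N0c Mc x] by simp
  qed
  have "surj_hom Q R (carrier Q) \<phi>"
  proof -
    have "\<phi> \<in> hom Q R"
    proof (rule homI)
      show "\<phi> W \<in> carrier R" if W: "W \<in> carrier Q" for W
      proof -
        obtain a where "a \<in> carrier G" "W = \<pi> a" using W q.surj by blast
        then show ?thesis using \<phi>\<pi> unfolding R_def carrier_FactGroup by simp
      qed
      show "\<phi> (W \<otimes>\<^bsub>Q\<^esub> Z) = \<phi> W \<otimes>\<^bsub>R\<^esub> \<phi> Z" if W: "W \<in> carrier Q" and Z: "Z \<in> carrier Q" for W Z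
      proof -
        obtain a where a: "a \<in> carrier G" "W = \<pi> a" using W q.surj by blast
        obtain b where b: "b \<in> carrier G" "Z = \<pi> b" using Z q.surj by blast
        have "W \<otimes>\<^bsub>Q\<^esub> Z = \<pi> (a \<otimes> b)" unfolding a(2) b(2) using q.h_mult[OF a(1) b(1)] by simp
        then show ?thesis
          using \<phi>\<pi> a b normal.rcos_sum[OF N0n a(1) b(1)] unfolding R_def by simp
      qed
    qed
    moreover have "\<phi> ` carrier Q = carrier R"
      unfolding q.surj[symmetric] image_image R_def carrier_FactGroup using \<phi>\<pi> by (intro image_cong) auto
    ultimately show ?thesis
      unfolding surj_hom_def surj_hom_axioms_def
      using Q.fin_group_axioms R.is_group Q.subgroup_self by simp
  qed
  then interpret f: surj_hom Q R "carrier Q" \<phi> .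
  have kerf: "f.ker = N"
  proof -
    have 1: "\<phi> (\<pi> a) = \<one>\<^bsub>R\<^esub> \<longleftrightarrow> a \<in> N0" if a: "a \<in> carrier G" for a
      unfolding \<phi>\<pi>[OF a] R_def using rcos_self[OF a n0(1)] coset_join2[OF a n0(1)] by auto
    show ?thesis
    proof
      show "f.ker \<subseteq> N"
      proof
        fix W assume W: "W \<in> f.ker"
        then obtain a where a: "a \<in> carrier G" "W = \<pi> a" using q.surj unfolding f.ker_def by blast
        then show "W \<in> N" using W 1 unfolding f.ker_def N_def by blast
      qed
      show "N \<subseteq> f.ker" unfolding f.ker_def N_def using 1 N0c q.h_closed by blast
    qed
  qed
  have pref: "f.pre B = factor_preimage G N0 M B" for B
    unfolding f.pre_def unfolding factor_preimage_def \<phi>_def Q_def by (rule refl)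
  have Tn: "Q.normal_in (T j) N" and Ts: "Q.simple_subgroup (T j)" and Tsub: "subgroup (T j) Q" and Tin: "T j \<subseteq> N" if j: "j \<in> J" for j
  proof -
    have "T j \<lhd> P" using dp j unfolding internal_direct_product_def by blast
    then show n: "Q.normal_in (T j) N" unfolding Peq Q.normal_in_iff[OF sN] .
    show s: "subgroup (T j) Q" using Q.normal_inD(1)[OF n] .
    show "T j \<subseteq> N" using Q.normal_inD(3)[OF n] .
    show "Q.simple_subgroup (T j)" using Q.simple_subgroupI[OF s] si[OF j] unfolding PT .
  qed
  have onePQ: "\<one>\<^bsub>P\<^esub> = \<one>\<^bsub>Q\<^esub>" unfolding Peq by simp
  have UN: "(\<Union>j\<in>J. T j) \<subseteq> N" using Tin by blast
  have genc: "generate P W = generate Q W" if "W \<subseteq> N" for W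
    unfolding Peq using Q.generate_consistent[OF that sN] by simp
  have gen: "N \<subseteq> generate Q (\<Union>j\<in>J. T j)"
    using dp genc[OF UN] unfolding internal_direct_product_def cP by simp
  have disj: "T j \<inter> T l = {\<one>\<^bsub>Q\<^esub>}" if jl: "j \<in> J" "l \<in> J" "j \<noteq> l" for j l
  proof -
    have "T j \<inter> generate P (\<Union>l\<in>J - {j}. T l) = {\<one>\<^bsub>P\<^esub>}" using dp jl(1) unfolding internal_direct_product_def by blast
    moreover have "T l \<subseteq> generate P (\<Union>l\<in>J - {j}. T l)" using jl generate.incl[of _ "\<Union>l\<in>J - {j}. T l" P] by blast
    moreover have "\<one>\<^bsub>Q\<^esub> \<in> T j \<inter> T l" using Q.sub_1[OF Tsub] jl by blast
    ultimately show ?thesis unfolding onePQ by blast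
  qed
  have crit: "Q.chief_criterion N J T"
  \<comment> \<open>By the isomorphisms, one abelian factor makes all of them abelian; as distinct
    factors commute anyway, \<open>N\<close> is then abelian.\<close>
  proof (cases "\<exists>j\<in>J. comm_group (P\<lparr>carrier := T j\<rparr>)")
    case True
    then obtain i where i: "i \<in> J" "comm_group (P\<lparr>carrier := T i\<rparr>)" by blast
    have ab: "T j \<subseteq> Q.centralizer (T j)" if j: "j \<in> J" for j
    proof -
      have "monoid (P\<lparr>carrier := T j\<rparr>)" unfolding PT using Q.subgroup_imp_group[OF Tsub[OF j]] by (simp add: group.is_monoid)
      then have "comm_group (P\<lparr>carrier := T j\<rparr>)" using comm_group.iso_imp_comm_group[OF i(2) iso[OF i(1) j]] by blast
      then show ?thesis unfolding PT Q.comm_group_iff_centralizer[OF Tsub[OF j]] .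
    qed
    have Nc: "N \<subseteq> carrier Q" using subgroup.subset[OF sN] .
    have TN: "N \<subseteq> Q.centralizer (T j)" if j: "j \<in> J" for j
    proof -
      have "T l \<subseteq> Q.centralizer (T j)" if l: "l \<in> J" for l
      proof (cases "l = j")
        case False
        then show ?thesis
          using Q.commuting_normal[OF Tn[OF l] Tn[OF j] disj[OF l j]] Tin[OF l] Nc unfolding Q.centralizer_def by blast
      qed (use ab j in simp)
      moreover have "subgroup (Q.centralizer (T j)) Q" using Q.centralizer_subgroup Tin[OF j] Nc by blast
      ultimately have "generate Q (\<Union>j\<in>J. T j) \<subseteq> Q.centralizer (T j)" by (intro Q.generate_subgroup_incl) blast+
      then show ?thesis using gen by blast
    qed
    have sw: "Q.cj y x = x" if "Q.cj x y = y" "x \<in> carrier Q" "y \<in> carrier Q" for x y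
      using that unfolding Q.cj_def by (metis Q.inv_solve_right Q.m_closed)
    have "T j \<subseteq> Q.centralizer N" if j: "j \<in> J" for j
    proof
      fix t assume t: "t \<in> T j"
      have tc: "t \<in> carrier Q" using t Tin[OF j] Nc by blast
      have "Q.cj t x = x" if x: "x \<in> N" for x
        using sw[OF Q.centralizerD(1)[OF _ t]] TN[OF j] x Nc tc by blast
      then show "t \<in> Q.centralizer N" unfolding Q.centralizer_def using tc by blast
    qed
    then have "generate Q (\<Union>j\<in>J. T j) \<subseteq> Q.centralizer N"
      by (intro Q.generate_subgroup_incl[OF _ Q.centralizer_subgroup[OF Nc]]) blast
    then have NN: "N \<subseteq> Q.centralizer N" using gen by blast
    have "Q.commutator a b = \<one>\<^bsub>Q\<^esub>" if "a \<in> N" "b \<in> N" for a b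
    proof -
      have c: "a \<in> carrier Q" "b \<in> carrier Q" using that Nc by auto
      have "Q.cj a b = b" using Q.centralizerD(1) NN that by blast
      then have "Q.cj a b \<otimes>\<^bsub>Q\<^esub> inv\<^bsub>Q\<^esub> b = \<one>\<^bsub>Q\<^esub>" using c by simp
      then show ?thesis using c by (simp add: Q.word)
    qed
    then show ?thesis by (rule Q.chief_criterion_abelian[OF Nn _ Tsub TN])
  next
    case False
    have nab: "T j \<inter> Q.centralizer (T j) = {\<one>\<^bsub>Q\<^esub>}" if j: "j \<in> J" for j
    proof -
      have Tc: "T j \<subseteq> carrier Q" using subgroup.subset[OF Tsub[OF j]] .
      have sc: "subgroup (Q.centralizer (T j)) Q" using Q.centralizer_subgroup[OF Tc] .
      have "Q.cj x y \<in> T j \<inter> Q.centralizer (T j)" if x: "x \<in> T j" and y: "y \<in> T j \<inter> Q.centralizer (T j)" for x y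
      proof -
        have "Q.cjs x (Q.centralizer (T j)) = Q.centralizer (T j)"
          using Q.cjs_centralizer[of x "T j"] x Tc Q.cjs_self[OF Tsub[OF j] x] by auto
        then show ?thesis using y Q.cj_in_subgroup[OF Tsub[OF j] x] by blast
      qed
      then have "Q.normal_in (T j \<inter> Q.centralizer (T j)) (T j)"
        unfolding Q.normal_in_def using Q.subgroups_Inter_pair[OF Tsub[OF j] sc] Tsub[OF j] by blast
      then have "T j \<inter> Q.centralizer (T j) = {\<one>\<^bsub>Q\<^esub>} \<or> T j \<inter> Q.centralizer (T j) = T j" using Ts[OF j] unfolding Q.simple_subgroup_def by blast
      moreover have "\<not> T j \<subseteq> Q.centralizer (T j)" using False j Q.comm_group_iff_centralizer[OF Tsub[OF j]] unfolding PT by blast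
      ultimately show ?thesis by blast
    qed
    have sp1: "Q.component_system (carrier Q) N ((\<lambda>j. Q.centralizer (T j)) ` J)"
      by (rule Q.component_system_simple_product(1)[OF Nn J Tn Ts disj gen nab])
    have sp2: "Q.stabil Y (Q.centralizer (T j)) = Q.stabil Y (T j)" if "subgroup Y Q" "j \<in> J" for Y j
      by (rule Q.component_system_simple_product(2)[OF Nn J Tn Ts disj gen nab that])
    have sp3: "\<exists>c\<in>Q.centralizer (T j). \<exists>t\<in>T j. x = c \<otimes>\<^bsub>Q\<^esub> t" if "j \<in> J" "x \<in> N" for j x
      by (rule Q.component_system_simple_product(3)[OF Nn J Tn Ts disj gen nab that])
    show ?thesis
    proof (rule Q.chief_criterion_nonabelian[OF Nn sp1 sp2])
      fix Y j L1 L2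
      assume Y: "subgroup Y Q" "N \<subseteq> Y" "Q.nilpotent_mod Y N" and j: "j \<in> J"
        and L: "Q.carter_mod (Q.norm_cent Y (T j)) (Q.centralizer (T j)) L1" "Q.carter_mod (Q.norm_cent Y (T j)) (Q.centralizer (T j)) L2"
      have nc: "\<not> comm_group (Q\<lparr>carrier := T j\<rparr>)" using False j unfolding PT by blast
      have ss: "simple_group (Q\<lparr>carrier := T j\<rparr>)" using si[OF j] unfolding PT .
      show "\<exists>a\<in>Q.norm_cent Y (T j). L2 = Q.cjs a L1"
        using condition_C_conj[OF C M N0, folded Q_def, folded \<pi>_def, folded N_def,
            OF Tn[OF j] ss nc sp3[OF j] Y L] .
    qed
  qed
  have hcN: "\<exists>x\<in>carrier Q. L = Q.cjs x K" if "Q.carter_mod (carrier Q) N K" "Q.carter_mod (carrier Q) N L" for K L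
    by (rule f.carter_mod_conj_from_image[unfolded kerf, OF _ that]) (use hc in \<open>simp add: R_def\<close>)
  have asc1: "Q.carter_mod (carrier Q) N (K <#>\<^bsub>Q\<^esub> N)" if "Q.carter_mod (carrier Q) {\<one>\<^bsub>Q\<^esub>} K" for K
    by (rule Q.chief_ascent(1)[OF Nn crit hcN that])
  have asc2: "\<exists>x\<in>carrier Q. L = Q.cjs x K"
    if "Q.carter_mod (carrier Q) {\<one>\<^bsub>Q\<^esub>} K" "Q.carter_mod (carrier Q) {\<one>\<^bsub>Q\<^esub>} L" for K L
    by (rule Q.chief_ascent(2)[OF Nn crit hcN that])
  have asc3: "(\<exists>K. Q.carter_mod (carrier Q) {\<one>\<^bsub>Q\<^esub>} K) \<longleftrightarrow> (\<forall>j\<in>J. \<exists>L. Q.carter_mod (Q.norm_cent D (T j)) (Q.centralizer (T j)) L)"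
    if "Q.carter_mod (carrier Q) N D" for D
    by (rule Q.chief_ascent(3)[OF Nn crit hcN that])
  show "carter_conjugate Q" unfolding Q.carter_conjugate_iff using asc2 by blast
  show "\<exists>L. carter_subgroup L (G Mod N0)" if "carter_subgroup K Q"
  proof -
    have "Q.carter_mod (carrier Q) N (K <#>\<^bsub>Q\<^esub> N)" using asc1 that unfolding Q.carter_iff .
    then have "\<exists>L. carter_subgroup L R" using f.carter_mod_ex_iff unfolding kerf by blast
    then show ?thesis unfolding R_def .
  qed
  show "(\<exists>K. carter_subgroup K Q) \<longleftrightarrow>
      (\<forall>j\<in>J. \<exists>L. carter_subgroup L (induced_aut_group Q (factor_preimage G N0 M B) (T j) {\<one>\<^bsub>Q\<^esub>}))"
    if B: "carter_subgroup B (G Mod N0)"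
  proof -
    have "R.carter_mod (carrier R) {\<one>\<^bsub>R\<^esub>} B" using B R.carter_iff unfolding R_def by blast
    then have c: "Q.carter_mod (carrier Q) N (f.pre B)" using f.carter_mod_pre unfolding kerf by blast
    have "(\<exists>L. carter_subgroup L (induced_aut_group Q (f.pre B) (T j) {\<one>\<^bsub>Q\<^esub>})) \<longleftrightarrow>
        (\<exists>L. Q.carter_mod (Q.norm_cent (f.pre B) (T j)) (Q.centralizer (T j)) L)" if "j \<in> J" for j
      using Q.carter_induced_iff[OF Q.carter_modD(1)[OF c] Tsub[OF that]] .
    then show ?thesis using asc3[OF c] unfolding Q.carter_iff pref by blast
  qed
qed

end

section \<open>Induction along the chief series\<close>

theorem mainTheorem1:
  fixes G :: "('a, 'b) monoid_scheme"
    and n :: nat and H :: "nat \<Rightarrow> 'a set"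
    and k :: "nat \<Rightarrow> nat" and T :: "nat \<Rightarrow> nat \<Rightarrow> 'a set set"
    and Kbar :: "nat \<Rightarrow> 'a set set"
  assumes "group G" and "finite (carrier G)"
    and "condition_C G"
    and "chief_series G n H"
    and "chief_decomposition G n H k T"
    and "carter_choice G n H Kbar"
  shows "(\<exists>K. carter_subgroup K G) \<longleftrightarrow> condition_E G n H k T Kbar"
proof -
  interpret fin_group G using assms(1,2) unfolding fin_group_def fin_group_axioms_def by blast
  have H0: "H 0 = carrier G" and Hn: "H n = {\<one>\<^bsub>G\<^esub>}" and Hnorm: "\<And>i. i \<le> n \<Longrightarrow> normal_in (H i) (carrier G)"
    and Hsub: "\<And>i. i < n \<Longrightarrow> H (Suc i) \<subseteq> H i"
    using assms(4) normal_in_carrier_iff unfolding chief_series_def by auto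
  define ex where "ex i \<longleftrightarrow> (\<exists>K. carter_subgroup K (G Mod H i))" for i
  define clause where "clause i \<longleftrightarrow> (\<forall>j\<in>{1..k i}. \<exists>L. carter_subgroup L
    (induced_aut_group (G Mod H (Suc i)) (factor_preimage G (H i) (H (Suc i)) (Kbar i)) (T i j) {\<one>\<^bsub>G Mod H (Suc i)\<^esub>}))" for i
  have step: "carter_conjugate (G Mod H (Suc i)) \<and> (ex (Suc i) \<longrightarrow> ex i) \<and>
      (carter_subgroup (Kbar i) (G Mod H i) \<longrightarrow> (ex (Suc i) \<longleftrightarrow> clause i))"
    if i: "i < n" and hc: "carter_conjugate (G Mod H i)" for i
  proof -
    let ?P = "section_group G (H i) (H (Suc i))"
    have d: "internal_direct_product ?P {1..k i} (T i)" "\<And>j. j \<in> {1..k i} \<Longrightarrow> simple_group (?P\<lparr>carrier := T i j\<rparr>)"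
      "\<And>j l. j \<in> {1..k i} \<Longrightarrow> l \<in> {1..k i} \<Longrightarrow> ?P\<lparr>carrier := T i j\<rparr> \<cong> ?P\<lparr>carrier := T i l\<rparr>"
      using assms(5) i unfolding chief_decomposition_def Let_def by blast+
    note s = chief_step[OF assms(3) Hnorm Hnorm Hsub[OF i] finite_atLeastAtMost d hc]
    show ?thesis unfolding ex_def clause_def using s i by auto
  qed
  \<comment> \<open>\<open>G / H 0\<close> is trivial and its own Carter subgroup, which starts the
    induction and makes \<open>Kbar 0\<close> a Carter subgroup like all later choices.\<close>
  have triv: "carrier (G Mod H 0) = {\<one>\<^bsub>G Mod H 0\<^esub>}"
    unfolding H0 carrier_FactGroup using coset_join2[OF _ subgroup_self] by force
  interpret Z: fin_group "G Mod H 0"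
    using fin_group_section[OF Hnorm[of 0]] by simp
  have Z1: "Z.normal_in {\<one>\<^bsub>G Mod H 0\<^esub>} (carrier (G Mod H 0))" using Z.normal_in_one[OF Z.subgroup_self] .
  have Zn: "Z.nilpotent_mod (carrier (G Mod H 0)) {\<one>\<^bsub>G Mod H 0\<^esub>}" using Z.nilpotent_mod_refl triv by simp
  have K0: "carter_subgroup {\<one>\<^bsub>G Mod H 0\<^esub>} (G Mod H 0)"
    using Z.carter_mod_refl[OF Zn Z1] unfolding Z.carter_iff triv .
  have c0: "carter_conjugate (G Mod H 0)"
    unfolding Z.carter_conjugate_iff
  proof (intro allI impI, elim conjE)
    fix K L assume "Z.carter_mod (carrier (G Mod H 0)) {\<one>\<^bsub>G Mod H 0\<^esub>} K" "Z.carter_mod (carrier (G Mod H 0)) {\<one>\<^bsub>G Mod H 0\<^esub>} L"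
    then have "K = carrier (G Mod H 0)" "L = carrier (G Mod H 0)" using Z.carter_mod_nilpotent_mod[OF _ Zn Z1] by blast+
    then have "L = Z.cjs \<one>\<^bsub>G Mod H 0\<^esub> K" using Z.cjs_one[OF order_refl] by (simp only:)
    then show "\<exists>g\<in>carrier (G Mod H 0). L = Z.cjs g K" using Z.one_closed by blast
  qed
  have conj: "carter_conjugate (G Mod H i)" if "i \<le> n" for i
    using that
  proof (induction i)
    case 0 show ?case by (rule c0)
  next
    case (Suc i) then show ?case using step[of i] by simp
  qed
  have Kb: "carter_subgroup (Kbar i) (G Mod H i)" if "i < n" "ex i" for i
    using assms(6) that K0 unfolding carter_choice_def ex_def by (cases i) auto
  \<comment> \<open>The escape disjunct adds nothing: if the conditions for all \<open>l < i\<close>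
    hold, then by induction \<open>G / H i\<close> has a Carter subgroup, so at \<open>i\<close> the
    clause itself must hold.\<close>
  have main: "ex i \<longleftrightarrow> (\<forall>l<i. clause l \<or> (1 \<le> l \<and> \<not> ex l))" if "i \<le> n" for i
    using that
  proof (induction i)
    case 0 then show ?case using K0 unfolding ex_def by blast
  next
    case (Suc i)
    have i: "i < n" using Suc.prems by simp
    note s = step[OF i conj[OF less_imp_le[OF i]]]
    have "ex (Suc i) \<longleftrightarrow> ex i \<and> clause i" using s Kb[OF i] by blast
    then show ?case using Suc.IH i by (auto simp: less_Suc_eq)
  qed
  have "condition_E G n H k T Kbar \<longleftrightarrow> (\<forall>l<n. clause l \<or> (1 \<le> l \<and> \<not> ex l))"
    unfolding condition_E_def clause_def ex_def Let_def by blast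
  moreover have "ex n \<longleftrightarrow> (\<exists>K. carter_subgroup K G)"
  proof -
    have one: "normal_in {\<one>\<^bsub>G\<^esub>} (carrier G)" using normal_in_one[OF subgroup_self] .
    have "surj_hom G (G Mod {\<one>\<^bsub>G\<^esub>}) (carrier G) (\<lambda>x. {\<one>\<^bsub>G\<^esub>} #>\<^bsub>G\<^esub> x)"
      and "surj_hom.ker (G Mod {\<one>\<^bsub>G\<^esub>}) (carrier G) (\<lambda>x. {\<one>\<^bsub>G\<^esub>} #>\<^bsub>G\<^esub> x) = {\<one>\<^bsub>G\<^esub>}"
      using quot_surj_hom[OF one] by simp_all
    then show ?thesis using surj_hom.carter_mod_ex_iff[of G "G Mod {\<one>\<^bsub>G\<^esub>}" "carrier G" "\<lambda>x. {\<one>\<^bsub>G\<^esub>} #>\<^bsub>G\<^esub> x"] carter_iff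
      unfolding ex_def Hn by simp
  qed
  ultimately show ?thesis using main[of n] by blast
qed

end
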